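(* Assume $A:=\max_{x\in\mathcal X}|\mathcal A(x)|\ge 2$ and let $\mu^s$ be a positive sampling policy. Run LocalOMD (as defined in the context) with $\mu^1$ the uniform policy ($\mu^1(a|x)=1/|\mathcal A(x)|$), with $\Psi_x(p)=\sum_{a\in\mathcal A(x)}p(a)\log p(a)$ (the negative Shannon entropy on $\mathbb R_{\ge0}^{|\mathcal A(x)|}$, so that $D_x$ is the Kullback–Leibler divergence on the simplex), and with the constant learning rates $\eta^t(x)=\eta/\kappa(\mu^s|x)$ for all $t$ and $x$, where $\eta=\sqrt{\log(A)\,\kappa(\mu^s)/(3HT)}$. Then for every $\delta\in(0,1)$, with probability at least $1-\delta$, \[\mathcal R^T_{\min}\le (4+2\sqrt3)\,H^{3/2}\sqrt{\log(A)\,\iota\,\kappa(\mu^s)\,T},\qquad \iota=\log\big(2(A_{\mathcal X}+1)/\delta\big).\]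
   Context: Game structure. Fix an integer $H\ge1$. The min-player's information sets form a finite set $\mathcal X$; each $x\in\mathcal X$ has a depth $h(x)\in\{1,\dots,H\}$ and a finite nonempty action set $\mathcal A(x)$. Perfect recall: every $x$ of depth $h$ has a unique history $(x_1,a_1,\dots,x_{h-1},a_{h-1},x_h=x)$ with $x_i$ of depth $i$ and $a_i\in\mathcal A(x_i)$, and the history of any $x'$ whose history contains $x$ extends the history of $x$. We say $x'$ directly follows $(x,a)$ if $h(x')=h(x)+1$ and the history of $x'$ contains $x$ followed by action $a$; we say $x$ is in the history of $x'$ if $x=x'_i$ for some $i$ (including $x=x'$). $\mathcal X_1$ is the set of depth-1 information sets, $A_{\mathcal X}=\sum_{x}|\mathcal A(x)|$. A policy is $\mu=(\mu(\cdot|x))_{x\in\mathcal X}$ with $\mu(\cdot|x)\in\Delta_{\mathcal A(x)}$ (probability simplex); $\Pi_{\min}$ is the set of policies; $\mu$ is positive if $\mu(a|x)>0$ for all $x,a$. For $x$ of depth $h$ with history $(x_1,a_1,\dots,x_h=x)$ and $a\in\mathcal A(x)$, putting $a_h=a$, the realization plan is $\mu_{1:}(x,a)=\prod_{i=1}^h\mu(a_i|x_i)$ and $\mu_{1:}(x)=\sum_{a}\mu_{1:}(x,a)=\prod_{i=1}^{h-1}\mu(a_i|x_i)$. For $x$ of depth $h$ and $(x',a')$ with $x$ in the history of $x'$, $x'$ of depth $h'$ with history $(x'_1,a'_1,\dots,x'_{h'})$ and $a'_{h'}=a'$, set $\mu_{h:}(x',a')=\prod_{i=h}^{h'}\mu(a'_i|x'_i)$.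 $\langle\cdot,\cdot\rangle$ is the standard inner product on $\mathbb R^{A_{\mathcal X}}$ indexed by pairs $(x,a)$. Complexity quantities. For positive $\mu^s$: $\kappa(\mu^s)=\max_{\mu\in\Pi_{\min}}\sum_{x\in\mathcal X}\sum_{a\in\mathcal A(x)}\mu_{1:}(x,a)/\mu^s_{1:}(x,a)$, and for $x$ of depth $h$, $\kappa(\mu^s|x)=\max_{\mu\in\Pi_{\min}}\sum_{x':\,x\text{ in history of }x'}\sum_{a'\in\mathcal A(x')}\mu_{h:}(x',a')/\mu^s_{h:}(x',a')$. Episodes and learning protocol. For each max-player policy $\nu$ there are numbers $p^\nu_{1:}(x)\in[0,1]$ and $\ell^\nu_h(x,a)\in[0,1]$ ($x$ of depth $h$) such that an episode played with min-player policy $\mu$ against $\nu$ produces a random trajectory $(x_1,a_1,\ell_1,\dots,x_H,a_H,\ell_H)$ with $x_h$ of depth $h$, $a_h\in\mathcal A(x_h)$ drawn from $\mu(\cdot|x_h)$ conditionally on the past, $\ell_h\in[0,1]$, and for every $x$ of depth $h$ and $a\in\mathcal A(x)$: $\mathbb P(x_h=x,a_h=a)=p^\nu_{1:}(x)\mu_{1:}(x,a)$ and $\mathbb E[\ell_h\mathbf 1\{x_h=x,a_h=a\}]=p^\nu_{1:}(x)\mu_{1:}(x,a)\ell^\nu_h(x,a)$. Define $\ell^\nu(x,a)=p^\nu_{1:}(x)\ell^\nu_h(x,a)$ (so the expected total loss is $\langle\ell^\nu,\mu_{1:}\rangle$). Fix a positive sampling policy $\mu^s$ and a filtration $(\mathcal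 F^t)_{t=0}^T$. At each round $t=1,\dots,T$, a max-player policy $\nu^t$ and a min-player policy $\mu^t$ are $\mathcal F^{t-1}$-measurable; conditionally on $\mathcal F^{t-1}$, the min-player observes a trajectory $(x^t_h,a^t_h,\ell^t_h)_{h\le H}$ distributed as an episode played with $(\mu^s,\nu^t)$, and this trajectory is $\mathcal F^t$-measurable. Set $\ell^t=\ell^{\nu^t}$ and $\mathcal R^T_{\min}=\max_{\mu^\dagger\in\Pi_{\min}}\sum_{t=1}^T\langle\ell^t,\mu^t_{1:}-\mu^\dagger_{1:}\rangle$. LocalOMD. For each $x$, $\Psi_x$ is a Legendre function on a closed convex set $\overline{\Omega_x}\subset\mathbb R^{|\mathcal A(x)|}_{\ge0}$ containing $\Delta_{\mathcal A(x)}$, with Bregman divergence $D_x(p,q)=\Psi_x(p)-\Psi_x(q)-\langle\nabla\Psi_x(q),p-q\rangle$. Learning rates $\eta^t(x)>0$ ($t=1,\dots,T+1$) are non-increasing in $t$, $\eta^{t+1}(x)$ is $\mathcal F^t$-measurable, and $\eta^{t+1}(x)=\eta^t(x)$ whenever $x\ne x^t_{h(x)}$. Given $\mu^1$ with each $\mu^1(\cdot|x)$ in the interior $\Omega_x$, at round $t$: set $q^t_{H+1}=0$; for $h=H,\dots,1$, with $x=x^t_h$, let $\tilde\ell^t_h\in\mathbb R^{\mathcal A(x)}$, $\tilde\ell^t_h(a)=\mathbf 1\{a=a^t_h\}(\ell^t_h+q^t_{h+1})/\mu^s(a^t_h|x)$, let $h^t_x(p)=\langle\tilde\ell^t_h,p\rangle+\frac1{\eta^t(x)}D_x(p,\mu^t(\cdot|x))+\big(\frac1{\eta^{t+1}(x)}-\frac1{\eta^t(x)}\big)D_x(p,\mu^1(\cdot|x))$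 for $p\in\Delta_{\mathcal A(x)}$, and set $\mu^{t+1}(\cdot|x)=\arg\min_{p\in\Delta_{\mathcal A(x)}}h^t_x(p)$, $q^t_h=\min_{p\in\Delta_{\mathcal A(x)}}h^t_x(p)$; for every $x$ not on the trajectory, $\mu^{t+1}(\cdot|x)=\mu^t(\cdot|x)$. The min-player plays this sequence $(\mu^t)$. *)

theory Defs
  imports "HOL-Probability.Probability"
begin

text \<open>An information-set structure: the set of information sets, their depths,
 their action sets, the horizon H and, encoding perfect recall, the parent map:
 for x of depth h > 1 the pair (x_{h-1}, a_{h-1}) that closes the history of x.\<close>

record ('x, 'a) game =
  Xs  :: "'x set"
  dep :: "'x \<Rightarrow> nat"
  act :: "'x \<Rightarrow> 'a set"
  par :: "'x \<Rightarrow> ('x \<times> 'a) option"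
  hor :: nat

definition valid_game :: "('x, 'a) game \<Rightarrow> bool" where
  "valid_game G \<longleftrightarrow> finite (Xs G) \<and> hor G \<ge> 1 \<and>
     (\<forall>x\<in>Xs G. 1 \<le> dep G x \<and> dep G x \<le> hor G \<and> finite (act G x) \<and> act G x \<noteq> {}) \<and>
     (\<forall>x\<in>Xs G. par G x = None \<longleftrightarrow> dep G x = 1) \<and>
     (\<forall>x\<in>Xs G. \<forall>y b. par G x = Some (y, b) \<longrightarrow>
         y \<in> Xs G \<and> dep G y + 1 = dep G x \<and> b \<in> act G y)"

fun anc :: "('x, 'a) game \<Rightarrow> nat \<Rightarrow> 'x \<Rightarrow> ('x \<times> 'a) list" where
  "anc G 0 x = []"
| "anc G (Suc n) x = (case par G x of None \<Rightarrow> [] | Some (y, b) \<Rightarrow> anc G n y @ [(y, b)])"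

definition hist :: "('x, 'a) game \<Rightarrow> 'x \<Rightarrow> ('x \<times> 'a) list" where
  "hist G x = anc G (dep G x) x"

definition in_hist :: "('x, 'a) game \<Rightarrow> 'x \<Rightarrow> 'x \<Rightarrow> bool" where
  "in_hist G x x' \<longleftrightarrow> x = x' \<or> x \<in> fst ` set (hist G x')"

definition Amax :: "('x, 'a) game \<Rightarrow> nat" where
  "Amax G = Max ((\<lambda>x. card (act G x)) ` Xs G)"

definition A_X :: "('x, 'a) game \<Rightarrow> nat" where
  "A_X G = (\<Sum>x\<in>Xs G. card (act G x))"

definition act_simplex :: "('x, 'a) game \<Rightarrow> 'x \<Rightarrow> ('a \<Rightarrow> real) set" where
  "act_simplex G x = {p. (\<forall>a\<in>act G x. 0 \<le> p a) \<and> (\<forall>a. a \<notin> act G x \<longrightarrow> p a = 0)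
                     \<and> sum p (act G x) = 1}"

definition is_policy :: "('x, 'a) game \<Rightarrow> ('x \<Rightarrow> 'a \<Rightarrow> real) \<Rightarrow> bool" where
  "is_policy G \<mu> \<longleftrightarrow> (\<forall>x\<in>Xs G. \<mu> x \<in> act_simplex G x)"

definition positive_policy :: "('x, 'a) game \<Rightarrow> ('x \<Rightarrow> 'a \<Rightarrow> real) \<Rightarrow> bool" where
  "positive_policy G \<mu> \<longleftrightarrow> is_policy G \<mu> \<and> (\<forall>x\<in>Xs G. \<forall>a\<in>act G x. 0 < \<mu> x a)"

definition uniform_policy :: "('x, 'a) game \<Rightarrow> 'x \<Rightarrow> 'a \<Rightarrow> real" where
  "uniform_policy G x a = (if a \<in> act G x then 1 / real (card (act G x)) else 0)"

definition plan :: "('x, 'a) game \<Rightarrow> ('x \<Rightarrow> 'a \<Rightarrow> real) \<Rightarrow> 'x \<Rightarrow> 'a \<Rightarrow> real" where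
  "plan G \<mu> x a = prod_list (map (\<lambda>(y, b). \<mu> y b) (hist G x)) * \<mu> x a"

definition plan_from :: "('x, 'a) game \<Rightarrow> ('x \<Rightarrow> 'a \<Rightarrow> real) \<Rightarrow> nat \<Rightarrow> 'x \<Rightarrow> 'a \<Rightarrow> real" where
  "plan_from G \<mu> h x a =
     prod_list (map (\<lambda>(y, b). \<mu> y b) (filter (\<lambda>(y, b). h \<le> dep G y) (hist G x))) * \<mu> x a"

definition kappa :: "('x, 'a) game \<Rightarrow> ('x \<Rightarrow> 'a \<Rightarrow> real) \<Rightarrow> real" where
  "kappa G \<mu>s = Sup {(\<Sum>x\<in>Xs G. \<Sum>a\<in>act G x. plan G \<mu> x a / plan G \<mu>s x a) | \<mu>. is_policy G \<mu>}"

definition kappa_at :: "('x, 'a) game \<Rightarrow> ('x \<Rightarrow> 'a \<Rightarrow> real) \<Rightarrow> 'x \<Rightarrow> real" where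
  "kappa_at G \<mu>s x = Sup {(\<Sum>x'\<in>{x'\<in>Xs G. in_hist G x x'}. \<Sum>a'\<in>act G x'.
        plan_from G \<mu> (dep G x) x' a' / plan_from G \<mu>s (dep G x) x' a') | \<mu>. is_policy G \<mu>}"

definition inner :: "('x, 'a) game \<Rightarrow> ('x \<Rightarrow> 'a \<Rightarrow> real) \<Rightarrow> ('x \<Rightarrow> 'a \<Rightarrow> real) \<Rightarrow> real" where
  "inner G f g = (\<Sum>x\<in>Xs G. \<Sum>a\<in>act G x. f x a * g x a)"

definition regret :: "('x, 'a) game \<Rightarrow> (nat \<Rightarrow> 'x \<Rightarrow> 'a \<Rightarrow> real) \<Rightarrow> (nat \<Rightarrow> 'x \<Rightarrow> 'a \<Rightarrow> real)
                       \<Rightarrow> nat \<Rightarrow> real" where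
  "regret G L pols T = Sup {(\<Sum>t\<in>{1..T}. inner G (L t) (\<lambda>x a. plan G (pols t) x a - plan G \<mu>d x a))
                             | \<mu>d. is_policy G \<mu>d}"

definition negent :: "'a set \<Rightarrow> ('a \<Rightarrow> real) \<Rightarrow> real" where
  "negent S p = (\<Sum>a\<in>S. p a * ln (p a))"

text \<open>D(p,q) = Psi(p) - Psi(q) - <grad Psi(q), p - q>, with grad Psi(q)(a) = ln q(a) + 1.\<close>
definition breg :: "'a set \<Rightarrow> ('a \<Rightarrow> real) \<Rightarrow> ('a \<Rightarrow> real) \<Rightarrow> real" where
  "breg S p q = negent S p - negent S q - (\<Sum>a\<in>S. (ln (q a) + 1) * (p a - q a))"

definition omd_obj :: "('x, 'a) game \<Rightarrow> (nat \<Rightarrow> 'x \<Rightarrow> real) \<Rightarrow> ('x \<Rightarrow> 'a \<Rightarrow> real) \<Rightarrow> nat \<Rightarrow> 'x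
      \<Rightarrow> ('x \<Rightarrow> 'a \<Rightarrow> real) \<Rightarrow> ('a \<Rightarrow> real) \<Rightarrow> ('a \<Rightarrow> real) \<Rightarrow> real" where
  "omd_obj G eta \<mu>1 t x \<mu> lt p =
     (\<Sum>a\<in>act G x. lt a * p a) + 1 / eta t x * breg (act G x) p (\<mu> x)
     + (1 / eta (Suc t) x - 1 / eta t x) * breg (act G x) p (\<mu>1 x)"

text \<open>Loss estimate at depth h, given q = q^t_{h+1}; trajectory xs, as, ls indexed by depth.\<close>
definition omd_lt :: "('x \<Rightarrow> 'a \<Rightarrow> real) \<Rightarrow> (nat \<Rightarrow> 'x) \<Rightarrow> (nat \<Rightarrow> 'a) \<Rightarrow> (nat \<Rightarrow> real)
      \<Rightarrow> nat \<Rightarrow> real \<Rightarrow> 'a \<Rightarrow> real" where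
  "omd_lt \<mu>s xs as ls h q = (\<lambda>a. if a = as h then (ls h + q) / \<mu>s (xs h) (as h) else 0)"

text \<open>omd_q ... k = q^t_{H+1-k}  (so q^t_{H+1} = 0 and q^t_h = omd_q ... (H+1-h)).\<close>
fun omd_q :: "('x, 'a) game \<Rightarrow> ('x \<Rightarrow> 'a \<Rightarrow> real) \<Rightarrow> (nat \<Rightarrow> 'x \<Rightarrow> real) \<Rightarrow> ('x \<Rightarrow> 'a \<Rightarrow> real)
      \<Rightarrow> nat \<Rightarrow> ('x \<Rightarrow> 'a \<Rightarrow> real) \<Rightarrow> (nat \<Rightarrow> 'x) \<Rightarrow> (nat \<Rightarrow> 'a) \<Rightarrow> (nat \<Rightarrow> real) \<Rightarrow> nat \<Rightarrow> real" where
  "omd_q G \<mu>s eta \<mu>1 t \<mu> xs as ls 0 = 0"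
| "omd_q G \<mu>s eta \<mu>1 t \<mu> xs as ls (Suc k) =
     Inf ((omd_obj G eta \<mu>1 t (xs (hor G - k)) \<mu>
             (omd_lt \<mu>s xs as ls (hor G - k) (omd_q G \<mu>s eta \<mu>1 t \<mu> xs as ls k)))
          ` act_simplex G (xs (hor G - k)))"

definition omd_next :: "('x, 'a) game \<Rightarrow> ('x \<Rightarrow> 'a \<Rightarrow> real) \<Rightarrow> (nat \<Rightarrow> 'x \<Rightarrow> real) \<Rightarrow> ('x \<Rightarrow> 'a \<Rightarrow> real)
      \<Rightarrow> nat \<Rightarrow> (nat \<Rightarrow> 'x) \<Rightarrow> (nat \<Rightarrow> 'a) \<Rightarrow> (nat \<Rightarrow> real) \<Rightarrow> ('x \<Rightarrow> 'a \<Rightarrow> real) \<Rightarrow> ('x \<Rightarrow> 'a \<Rightarrow> real)" where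
  "omd_next G \<mu>s eta \<mu>1 t xs as ls \<mu> = (\<lambda>x.
     if x \<in> Xs G \<and> xs (dep G x) = x then
       arg_min_on (omd_obj G eta \<mu>1 t x \<mu>
          (omd_lt \<mu>s xs as ls (dep G x) (omd_q G \<mu>s eta \<mu>1 t \<mu> xs as ls (hor G - dep G x))))
        (act_simplex G x)
     else \<mu> x)"

text \<open>localomd ... t = mu^t for t \<ge> 1; XS t h, AS t h, LS t h is the round-t trajectory.\<close>
fun localomd :: "('x, 'a) game \<Rightarrow> ('x \<Rightarrow> 'a \<Rightarrow> real) \<Rightarrow> (nat \<Rightarrow> 'x \<Rightarrow> real) \<Rightarrow> ('x \<Rightarrow> 'a \<Rightarrow> real)
      \<Rightarrow> (nat \<Rightarrow> nat \<Rightarrow> 'x) \<Rightarrow> (nat \<Rightarrow> nat \<Rightarrow> 'a) \<Rightarrow> (nat \<Rightarrow> nat \<Rightarrow> real) \<Rightarrow> nat \<Rightarrow> ('x \<Rightarrow> 'a \<Rightarrow> real)" where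
  "localomd G \<mu>s eta \<mu>1 XS AS LS 0 = \<mu>1"
| "localomd G \<mu>s eta \<mu>1 XS AS LS (Suc t) =
     (if t = 0 then \<mu>1
      else omd_next G \<mu>s eta \<mu>1 t (XS t) (AS t) (LS t) (localomd G \<mu>s eta \<mu>1 XS AS LS t))"

definition past_sigma :: "'w measure \<Rightarrow> 'w measure \<Rightarrow> (nat \<Rightarrow> 'w \<Rightarrow> 'x) \<Rightarrow> (nat \<Rightarrow> 'w \<Rightarrow> 'a)
      \<Rightarrow> (nat \<Rightarrow> 'w \<Rightarrow> real) \<Rightarrow> nat \<Rightarrow> 'w measure" where
  "past_sigma M F0 X A L h = sigma (space M)
     (sets F0 \<union> {X i -` {y} \<inter> space M | i y. 1 \<le> i \<and> i \<le> h}
              \<union> {A i -` {b} \<inter> space M | i b. 1 \<le> i \<and> i < h}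
              \<union> {L i -` U \<inter> space M | i U. 1 \<le> i \<and> i < h \<and> U \<in> sets borel})"

end

theory Submission
  imports Defs
begin

text \<open>
  Let \<open>q\<^sup>t\<close> be the value \<open>q\<^sup>t\<^sub>1\<close> that LocalOMD computes at the root, let \<open>L\<^sup>t\<close> be the
  importance-sampled loss, with entries \<open>\<ell>\<^sup>t\<^sub>h / \<mu>\<^sup>s\<^sub>1\<^sub>:(x, a)\<close> at the visited pairs and 0 elsewhere, and
  split the instantaneous regret against a policy \<open>m\<close> as
  \<open>(\<langle>\<ell>\<^sup>t, \<mu>\<^sup>t\<rangle> - q\<^sup>t) + (q\<^sup>t - \<langle>L\<^sup>t, m\<rangle>) + \<langle>L\<^sup>t - \<ell>\<^sup>t, m\<rangle>\<close>.

  The middle terms telescope: for the entropy the three-point inequality of mirror descent is an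
  equality, and weighting the local updates by \<open>m\<^sub>1\<^sub>:(x) / \<mu>\<^sup>s\<^sub>1\<^sub>:(x)\<close>, which does not depend on \<open>t\<close>, leaves
  divergences to the uniform policy. With \<open>\<eta>(x) = \<eta> / \<kappa>(\<mu>\<^sup>s|x)\<close> they sum to at most
  \<open>log A H \<kappa> / \<eta>\<close>, since at each depth \<open>\<Sum> m\<^sub>1\<^sub>:(x) / \<mu>\<^sup>s\<^sub>1\<^sub>:(x) \<kappa>(\<mu>\<^sup>s|x) \<le> \<kappa>\<close>: glue \<open>m\<close> above that depth to
  near-maximizers of \<open>\<kappa>(\<mu>\<^sup>s|x)\<close> below it.

  In the first terms \<open>q\<^sup>t \<ge> 0\<close>, so its lower tail is controlled through
  \<open>exp (- y) \<le> 1 - y + y\<^sup>2 / 2\<close> by the conditional first and second moments alone. Along a trajectory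
  \<open>\<langle>L\<^sup>t, \<mu>\<^sup>t\<rangle> - q\<^sup>t\<close> and \<open>(q\<^sup>t)\<^sup>2\<close> are dominated by sums of past-measurable weights over the visited
  pairs, whose conditional expectations are at most \<open>\<eta> H\<^sup>2 / 2\<close> and \<open>H \<kappa>\<close>.

  For the last terms \<open>exp y \<le> 1 + y + y\<^sup>2\<close> gives an exponential supermartingale for every pair
  \<open>(x, a)\<close>; a union bound makes the deviation uniform in \<open>m\<close>. The parameter of this supermartingale is
  at most 1 only if \<open>\<iota> \<kappa> \<le> H T\<close>; otherwise the trivial bound \<open>H T\<close> on the regret suffices.
\<close>

subsection \<open>Entropic mirror steps\<close>

text \<open>Closed forms of the minimum over the simplex of
  \<open><l, p> + D(p, \<mu>) / \<eta>\<close> and of its minimizer, the exponential-weights update;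
  \<open>omd_obj_Inf\<close> and \<open>omd_obj_arg_min\<close> identify them with the operations of
  the algorithm.\<close>

definition entropic_value :: "'a set \<Rightarrow> real \<Rightarrow> ('a \<Rightarrow> real) \<Rightarrow> ('a \<Rightarrow> real) \<Rightarrow> real" where
  "entropic_value S \<eta> l \<mu> = - ln (\<Sum>a\<in>S. \<mu> a * exp (- \<eta> * l a)) / \<eta>"

definition entropic_step :: "'a set \<Rightarrow> real \<Rightarrow> ('a \<Rightarrow> real) \<Rightarrow> ('a \<Rightarrow> real) \<Rightarrow> 'a \<Rightarrow> real" where
  "entropic_step S \<eta> l \<mu> = (\<lambda>a. \<mu> a * exp (- \<eta> * l a) / (\<Sum>b\<in>S. \<mu> b * exp (- \<eta> * l b)))"

text \<open>The difference of the two sides vanishes at 0 and has a nonnegative derivative. There is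
  no upper limit on \<open>y\<close>, so importance-weighted losses of any size are covered.\<close>

lemma exp_minus_le_quadratic:
  fixes y :: real
  assumes "0 \<le> y"
  shows "exp (- y) \<le> 1 - y + y\<^sup>2 / 2"
proof -
  let ?g = "\<lambda>y. 1 - y + y\<^sup>2 / 2 - exp (- y) :: real"
  have "?g 0 \<le> ?g y"
  proof (rule DERIV_nonneg_imp_nondecreasing[OF assms])
    fix x :: real
    have "(?g has_real_derivative (- 1 + x + exp (- x))) (at x)"
      by (auto intro!: derivative_eq_intros)
    moreover have "0 \<le> - 1 + x + exp (- x)"
      using exp_ge_add_one_self[of "- x"] by simp
    ultimately show "\<exists>d. (?g has_real_derivative d) (at x) \<and> 0 \<le> d" by blast
  qed
  then show ?thesis by simp
qed

text \<open>The linear terms cancel because both vectors have mass 1; the rest is algebra in the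
  values of \<open>ln\<close>, so zero coordinates are included.\<close>

lemma breg_eq_KL:
  assumes "finite S" "sum p S = 1" "sum q S = 1"
  shows "breg S p q = (\<Sum>a\<in>S. p a * (ln (p a) - ln (q a)))"
proof -
  have "breg S p q = (\<Sum>a\<in>S. p a * ln (p a) - q a * ln (q a) - (ln (q a) + 1) * (p a - q a))"
    by (simp add: breg_def negent_def sum_subtractf)
  also have "\<dots> = (\<Sum>a\<in>S. p a * (ln (p a) - ln (q a)) - p a + q a)"
    by (rule sum.cong) (auto simp: algebra_simps)
  also have "\<dots> = (\<Sum>a\<in>S. p a * (ln (p a) - ln (q a)))"
    using assms by (simp add: sum.distrib sum_subtractf)
  finally show ?thesis .
qed

text \<open>\<open>ln y \<le> y - 1\<close> at \<open>y = q / p\<close>, together with its equality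
  case. Summed over the actions this gives Gibbs' inequality and the definiteness of the
  divergence.\<close>

lemma KL_pointwise:
  fixes p q :: real
  assumes "0 \<le> p" "0 < q"
  shows "p - q \<le> p * (ln p - ln q)"
    and "p * (ln p - ln q) = p - q \<Longrightarrow> p = q"
proof -
  have *: "p - q \<le> p * (ln p - ln q) \<and> (p * (ln p - ln q) = p - q \<longrightarrow> p = q)"
  proof (cases "p = 0")
    case True
    then show ?thesis using assms by auto
  next
    case False
    then have p: "p > 0" using assms by auto
    have ln: "ln p - ln q = - ln (q / p)" using p assms by (simp add: ln_div)
    have 1: "ln (q / p) \<le> q / p - 1" using p assms by (intro ln_le_minus_one) auto
    have "p * ln (q / p) \<le> p * (q / p - 1)" using 1 p by (intro mult_left_mono) auto
    then have a: "p - q \<le> p * (ln p - ln q)"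
      unfolding ln using p by (simp add: algebra_simps)
    have b: "p = q" if "p * (ln p - ln q) = p - q"
    proof -
      have "p * ln (q / p) = p * (q / p - 1)" using that p unfolding ln by (simp add: algebra_simps)
      then have "ln (q / p) = q / p - 1" using p by simp
      then have "q / p = 1" using p assms by (intro ln_eq_minus_one) auto
      then show ?thesis using p by auto
    qed
    show ?thesis using a b by auto
  qed
  show "p - q \<le> p * (ln p - ln q)" using * by auto
  show "p * (ln p - ln q) = p - q \<Longrightarrow> p = q" using * by auto
qed

lemma breg_nonneg:
  assumes "finite S" "sum p S = 1" "sum q S = 1" "\<And>a. a \<in> S \<Longrightarrow> 0 \<le> p a" "\<And>a. a \<in> S \<Longrightarrow> 0 < q a"
  shows "0 \<le> breg S p q"
proof -
  have "0 = (\<Sum>a\<in>S. p a - q a)" using assms by (simp add: sum_subtractf)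
  also have "\<dots> \<le> (\<Sum>a\<in>S. p a * (ln (p a) - ln (q a)))"
    using assms by (intro sum_mono KL_pointwise(1)) auto
  finally show ?thesis using assms by (simp add: breg_eq_KL)
qed

text \<open>Gibbs' inequality holds term by term, so a vanishing sum forces equality in every term.
  This makes the minimizer of a local update unique.\<close>

lemma breg_zero_imp_eq:
  assumes "finite S" "sum p S = 1" "sum q S = 1" "\<And>a. a \<in> S \<Longrightarrow> 0 \<le> p a" "\<And>a. a \<in> S \<Longrightarrow> 0 < q a"
    and "breg S p q = 0" "a \<in> S"
  shows "p a = q a"
proof -
  have "(\<Sum>a\<in>S. p a * (ln (p a) - ln (q a)) - (p a - q a)) = 0"
    using assms breg_eq_KL[of S p q] by (simp add: sum_subtractf)
  then have "p a * (ln (p a) - ln (q a)) - (p a - q a) = 0"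
    using assms KL_pointwise(1) by (subst (asm) sum_nonneg_eq_0_iff) auto
  then show ?thesis using KL_pointwise(2)[of "p a" "q a"] assms by auto
qed

text \<open>Against the uniform vector the divergence is \<open>ln (card S)\<close> plus the
  negative entropy of \<open>p\<close>, which is at most 0.\<close>

lemma breg_uniform_le:
  assumes "finite S" "S \<noteq> {}" "sum p S = 1" "\<And>a. a \<in> S \<Longrightarrow> 0 \<le> p a"
  shows "breg S p (\<lambda>a. if a \<in> S then 1 / real (card S) else 0) \<le> ln (real (card S))"
proof -
  have c: "real (card S) > 0" using assms by (simp add: card_gt_0_iff)
  have p1: "p a \<le> 1" if "a \<in> S" for a
    using assms member_le_sum[of a S p] that by auto
  have "breg S p (\<lambda>a. if a \<in> S then 1 / real (card S) else 0)
      = (\<Sum>a\<in>S. p a * (ln (p a) - ln (if a \<in> S then 1 / real (card S) else 0)))"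
    using assms c by (intro breg_eq_KL) auto
  also have "\<dots> = (\<Sum>a\<in>S. p a * (ln (p a) + ln (real (card S))))"
    using c by (intro sum.cong) (auto simp: ln_div)
  also have "\<dots> \<le> (\<Sum>a\<in>S. p a * ln (real (card S)))"
  proof (rule sum_mono)
    fix a assume a: "a \<in> S"
    have "p a * ln (p a) \<le> 0"
      using p1[OF a] assms(4)[OF a] ln_le_zero_iff[of "p a"]
      by (cases "p a = 0") (auto simp: mult_le_0_iff)
    then show "p a * (ln (p a) + ln (real (card S))) \<le> p a * ln (real (card S))"
      by (simp add: algebra_simps)
  qed
  also have "\<dots> = ln (real (card S))" using assms by (simp add: sum_distrib_right[symmetric])
  finally show ?thesis .
qed

locale entropic =
  fixes S :: "'a set" and \<eta> :: real and l \<mu> :: "'a \<Rightarrow> real"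
  assumes fin: "finite S" and eta: "\<eta> > 0"
    and mu_pos: "\<And>a. a \<in> S \<Longrightarrow> 0 < \<mu> a" and mu_sum: "sum \<mu> S = 1"
begin

lemma ne: "S \<noteq> {}" using mu_sum by auto

lemma partition_pos: "0 < (\<Sum>a\<in>S. \<mu> a * exp (- \<eta> * l a))"
  using fin ne mu_pos by (intro sum_pos) auto

lemma step_pos: "a \<in> S \<Longrightarrow> 0 < entropic_step S \<eta> l \<mu> a"
  using partition_pos mu_pos by (auto simp: entropic_step_def)

lemma step_sum: "sum (entropic_step S \<eta> l \<mu>) S = 1"
  using partition_pos by (simp add: entropic_step_def sum_divide_distrib[symmetric])

lemma ln_step:
  assumes "a \<in> S"
  shows "ln (entropic_step S \<eta> l \<mu> a) = ln (\<mu> a) - \<eta> * l a + \<eta> * entropic_value S \<eta> l \<mu>"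
  using mu_pos[OF assms] partition_pos eta
  by (simp add: entropic_step_def entropic_value_def ln_div ln_mult)

text \<open>By \<open>ln_step\<close> the logarithm of the update is affine in the loss, so
  replacing \<open>\<mu>\<close> by the update changes the divergence by terms linear in
  \<open>p\<close>. Hence equality, for every \<open>p\<close> of mass 1.\<close>

lemma three_point:
  assumes "sum p S = 1"
  shows "(\<Sum>a\<in>S. l a * p a) + 1 / \<eta> * breg S p \<mu>
     = entropic_value S \<eta> l \<mu> + 1 / \<eta> * breg S p (entropic_step S \<eta> l \<mu>)"
proof -
  have "breg S p (entropic_step S \<eta> l \<mu>)
      = (\<Sum>a\<in>S. p a * (ln (p a) - ln (entropic_step S \<eta> l \<mu> a)))"
    using assms fin step_sum by (intro breg_eq_KL) auto
  also have "\<dots> = (\<Sum>a\<in>S. p a * (ln (p a) - ln (\<mu> a)) + \<eta> * (l a * p a)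
                      - \<eta> * entropic_value S \<eta> l \<mu> * p a)"
    by (intro sum.cong) (auto simp: ln_step algebra_simps)
  also have "\<dots> = breg S p \<mu> + \<eta> * (\<Sum>a\<in>S. l a * p a) - \<eta> * entropic_value S \<eta> l \<mu>"
    using assms fin mu_sum
    by (simp add: breg_eq_KL sum.distrib sum_subtractf sum_distrib_left[symmetric])
  finally show ?thesis using eta by (simp add: field_simps)
qed

lemma value_nonneg:
  assumes "\<And>a. a \<in> S \<Longrightarrow> 0 \<le> l a"
  shows "0 \<le> entropic_value S \<eta> l \<mu>"
proof -
  have "(\<Sum>a\<in>S. \<mu> a * exp (- \<eta> * l a)) \<le> (\<Sum>a\<in>S. \<mu> a * 1)"
    using mu_pos eta assms by (intro sum_mono mult_left_mono) (auto simp: less_imp_le)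
  then show ?thesis using partition_pos eta mu_sum
    by (auto simp: entropic_value_def divide_nonpos_pos ln_le_zero_iff)
qed

lemma breg_self: "breg S \<mu> \<mu> = 0"
  by (simp add: breg_def)

text \<open>\<open>three_point\<close> at \<open>p = \<mu>\<close>, where the divergence to
  \<open>\<mu>\<close> vanishes and the one to the update is nonnegative.\<close>

lemma value_le: "entropic_value S \<eta> l \<mu> \<le> (\<Sum>a\<in>S. l a * \<mu> a)"
proof -
  have "0 \<le> breg S \<mu> (entropic_step S \<eta> l \<mu>)"
    using fin mu_sum step_sum mu_pos step_pos by (intro breg_nonneg) (auto simp: less_imp_le)
  then have "0 \<le> 1 / \<eta> * breg S \<mu> (entropic_step S \<eta> l \<mu>)" using eta by simp
  with three_point[OF mu_sum] show ?thesis by (simp add: breg_self)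
qed

text \<open>The quadratic bound on \<open>exp\<close> is inserted into the partition function
  \<open>Z\<close>, followed by \<open>ln Z \<le> Z - 1\<close>; the price is a second moment of the
  loss under \<open>\<mu>\<close>.\<close>

lemma value_ge:
  assumes "\<And>a. a \<in> S \<Longrightarrow> 0 \<le> l a"
  shows "(\<Sum>a\<in>S. l a * \<mu> a) - \<eta> / 2 * (\<Sum>a\<in>S. \<mu> a * (l a)\<^sup>2) \<le> entropic_value S \<eta> l \<mu>"
proof -
  let ?Z = "\<Sum>a\<in>S. \<mu> a * exp (- \<eta> * l a)"
  have "?Z \<le> (\<Sum>a\<in>S. \<mu> a * (1 - \<eta> * l a + (\<eta> * l a)\<^sup>2 / 2))"
  proof (intro sum_mono mult_left_mono)
    fix a assume a: "a \<in> S"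
    show "exp (- \<eta> * l a) \<le> 1 - \<eta> * l a + (\<eta> * l a)\<^sup>2 / 2"
      using exp_minus_le_quadratic[of "\<eta> * l a"] assms[OF a] eta by simp
    show "0 \<le> \<mu> a" using mu_pos[OF a] by simp
  qed
  also have "\<dots> = (\<Sum>a\<in>S. \<mu> a - \<eta> * (l a * \<mu> a) + \<eta>\<^sup>2 / 2 * (\<mu> a * (l a)\<^sup>2))"
    by (intro sum.cong) (auto simp: algebra_simps power2_eq_square)
  also have "\<dots> = 1 - \<eta> * (\<Sum>a\<in>S. l a * \<mu> a) + \<eta>\<^sup>2 / 2 * (\<Sum>a\<in>S. \<mu> a * (l a)\<^sup>2)"
    by (simp only: sum.distrib sum_subtractf sum_distrib_left[symmetric] mu_sum)
  finally have "?Z - 1 \<le> - \<eta> * (\<Sum>a\<in>S. l a * \<mu> a) + \<eta>\<^sup>2 / 2 * (\<Sum>a\<in>S. \<mu> a * (l a)\<^sup>2)" by simp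
  moreover have "ln ?Z \<le> ?Z - 1" using partition_pos by (intro ln_le_minus_one)
  ultimately have "ln ?Z \<le> - \<eta> * (\<Sum>a\<in>S. l a * \<mu> a) + \<eta>\<^sup>2 / 2 * (\<Sum>a\<in>S. \<mu> a * (l a)\<^sup>2)" by simp
  then have "ln ?Z / \<eta> \<le> (- \<eta> * (\<Sum>a\<in>S. l a * \<mu> a) + \<eta>\<^sup>2 / 2 * (\<Sum>a\<in>S. \<mu> a * (l a)\<^sup>2)) / \<eta>"
    using eta by (intro divide_right_mono) auto
  also have "\<dots> = - (\<Sum>a\<in>S. l a * \<mu> a) + \<eta> / 2 * (\<Sum>a\<in>S. \<mu> a * (l a)\<^sup>2)"
    using eta by (simp add: field_simps power2_eq_square)
  finally show ?thesis by (simp add: entropic_value_def)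
qed

end

subsection \<open>Realization plans and the complexity quantities\<close>

text \<open>The realization weight of an information set, i.e. its plan without the factor of the
  action chosen there.\<close>

definition reach :: "('x, 'a) game \<Rightarrow> ('x \<Rightarrow> 'a \<Rightarrow> real) \<Rightarrow> 'x \<Rightarrow> real" where
  "reach G \<mu> x = prod_list (map (\<lambda>(y, b). \<mu> y b) (hist G x))"

lemma plan_eq: "plan G \<mu> x a = reach G \<mu> x * \<mu> x a"
  by (simp add: plan_def reach_def)

locale game_tree =
  fixes G :: "('x, 'a) game"
  assumes game: "valid_game G"
begin

abbreviation "H \<equiv> hor G"

lemma finite_Xs [simp, intro]: "finite (Xs G)"
  and hor_pos: "1 \<le> hor G"
  using game by (auto simp: valid_game_def)

lemma dep_bounds: "x \<in> Xs G \<Longrightarrow> 1 \<le> dep G x" "x \<in> Xs G \<Longrightarrow> dep G x \<le> hor G"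
  and finite_act [simp]: "x \<in> Xs G \<Longrightarrow> finite (act G x)"
  and act_nonempty: "x \<in> Xs G \<Longrightarrow> act G x \<noteq> {}"
  and par_None: "x \<in> Xs G \<Longrightarrow> par G x = None \<longleftrightarrow> dep G x = 1"
  using game by (auto simp: valid_game_def)

lemma par_Some:
  assumes "x \<in> Xs G" "par G x = Some (y, b)"
  shows "y \<in> Xs G" "dep G x = Suc (dep G y)" "b \<in> act G y"
  using game assms by (auto simp: valid_game_def)

text \<open>Well-founded because the depth of a parent is smaller by one; products and lists along a
  history become one-step recursions.\<close>

lemma tree_induct [consumes 1, case_names root child]:
  assumes "x \<in> Xs G"
    and "\<And>x. x \<in> Xs G \<Longrightarrow> par G x = None \<Longrightarrow> Q x"
    and "\<And>x y b. x \<in> Xs G \<Longrightarrow> par G x = Some (y, b) \<Longrightarrow> y \<in> Xs G \<Longrightarrow> b \<in> act G y \<Longrightarrow>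
           dep G x = Suc (dep G y) \<Longrightarrow> Q y \<Longrightarrow> Q x"
  shows "Q x"
  using assms(1)
proof (induction "dep G x" arbitrary: x rule: less_induct)
  case less
  show ?case
  proof (cases "par G x")
    case None
    then show ?thesis using less assms(2) by auto
  next
    case (Some yb)
    obtain y b where yb: "yb = (y, b)" by force
    note * = par_Some[OF less.prems Some[unfolded yb]]
    show ?thesis
      by (rule assms(3)[OF less.prems Some[unfolded yb] *(1) *(3) *(2)], rule less.hyps) (use * in auto)
  qed
qed

lemma hist_root: "x \<in> Xs G \<Longrightarrow> par G x = None \<Longrightarrow> hist G x = []"
  by (cases "dep G x") (auto simp: hist_def)

lemma hist_child:
  "x \<in> Xs G \<Longrightarrow> par G x = Some (y, b) \<Longrightarrow> hist G x = hist G y @ [(y, b)]"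
  using par_Some[of x y b] by (simp add: hist_def)

lemma hist_mem:
  assumes "x \<in> Xs G" "(y, b) \<in> set (hist G x)"
  shows "y \<in> Xs G" "b \<in> act G y" "dep G y < dep G x"
proof -
  have "y \<in> Xs G \<and> b \<in> act G y \<and> dep G y < dep G x"
    using assms
  proof (induction x rule: tree_induct)
    case (root x)
    then show ?case by (simp add: hist_root)
  next
    case (child x z c)
    then show ?case by (auto simp: hist_child)
  qed
  then show "y \<in> Xs G" "b \<in> act G y" "dep G y < dep G x" by auto
qed

lemma in_hist_root: "x \<in> Xs G \<Longrightarrow> par G x = None \<Longrightarrow> in_hist G z x \<longleftrightarrow> z = x"
  by (auto simp: in_hist_def hist_root)

lemma in_hist_child:
  "x \<in> Xs G \<Longrightarrow> par G x = Some (y, b) \<Longrightarrow> in_hist G z x \<longleftrightarrow> z = x \<or> in_hist G z y"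
  by (auto simp: in_hist_def hist_child)

lemma in_hist_refl [simp]: "in_hist G x x"
  by (simp add: in_hist_def)

lemma in_hist_Xs_dep:
  assumes "x \<in> Xs G" "in_hist G z x"
  shows "z \<in> Xs G \<and> (z = x \<or> dep G z < dep G x)"
proof (cases "z = x")
  case False
  then obtain b where "(z, b) \<in> set (hist G x)" using assms(2) by (auto simp: in_hist_def)
  then show ?thesis using hist_mem[OF assms(1)] by blast
qed (use assms in auto)

lemmas in_hist_Xs = in_hist_Xs_dep[THEN conjunct1]
  and in_hist_dep = in_hist_Xs_dep[THEN conjunct2]

text \<open>Depth strictly increases along a history. With \<open>ancestor_exists\<close>, every
  information set has exactly one ancestor at each depth up to its own.\<close>

lemma in_hist_unique:
  assumes "x \<in> Xs G" "in_hist G z x" "in_hist G z' x" "dep G z = dep G z'"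
  shows "z = z'"
  using assms
proof (induction x rule: tree_induct)
  case (root x)
  then show ?case by (auto simp: in_hist_root)
next
  case (child x y b)
  then show ?case
    using in_hist_dep[of y z] in_hist_dep[of y z'] by (auto simp: in_hist_child)
qed

lemma ancestor_exists:
  assumes "x \<in> Xs G" "1 \<le> h" "h \<le> dep G x"
  shows "\<exists>z\<in>Xs G. dep G z = h \<and> in_hist G z x"
  using assms
proof (induction x rule: tree_induct)
  case (root x)
  then show ?case using par_None[of x] by auto
next
  case (child x y b)
  show ?case
  proof (cases "h = dep G x")
    case True
    then show ?thesis using child by auto
  next
    case False
    then show ?thesis using child by (auto simp: in_hist_child)
  qed
qed

lemma reach_root: "x \<in> Xs G \<Longrightarrow> par G x = None \<Longrightarrow> reach G \<mu> x = 1"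
  by (simp add: reach_def hist_root)

lemma reach_child: "x \<in> Xs G \<Longrightarrow> par G x = Some (y, b) \<Longrightarrow> reach G \<mu> x = plan G \<mu> y b"
  by (simp add: plan_def reach_def hist_child)

lemma plan_from_base:
  assumes "x \<in> Xs G" "dep G x \<le> h"
  shows "plan_from G \<mu> h x a = \<mu> x a"
proof -
  have "filter (\<lambda>(y, b). h \<le> dep G y) (hist G x) = []"
    using hist_mem[OF assms(1)] assms(2) by (fastforce simp: filter_empty_conv)
  then show ?thesis by (simp add: plan_from_def)
qed

lemma plan_from_child:
  "x \<in> Xs G \<Longrightarrow> par G x = Some (y, b) \<Longrightarrow> h \<le> dep G y \<Longrightarrow>
     plan_from G \<mu> h x a = plan_from G \<mu> h y b * \<mu> x a"
  by (simp add: plan_from_def hist_child)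

text \<open>By perfect recall the factors of depth below that of \<open>z\<close> are exactly those
  along the history of \<open>z\<close>.\<close>

lemma plan_split:
  assumes "x \<in> Xs G" "in_hist G z x"
  shows "plan G \<mu> x a = reach G \<mu> z * plan_from G \<mu> (dep G z) x a"
  using assms
proof (induction x arbitrary: a rule: tree_induct)
  case (root x)
  then show ?case by (auto simp: in_hist_root plan_eq plan_from_base)
next
  case (child x y b)
  show ?case
  proof (cases "z = x")
    case True
    then show ?thesis using child by (auto simp: plan_eq plan_from_base)
  next
    case False
    then have z: "in_hist G z y" using child by (auto simp: in_hist_child)
    then have "dep G z \<le> dep G y" using in_hist_dep[of y z] child by auto
    then show ?thesis using child z False
      by (simp add: plan_from_child plan_eq[of G \<mu> x] reach_child)
  qed
qed

lemma policy_nonneg: "is_policy G \<mu> \<Longrightarrow> x \<in> Xs G \<Longrightarrow> 0 \<le> \<mu> x a"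
  by (cases "a \<in> act G x") (auto simp: is_policy_def act_simplex_def)

lemma policy_sum: "is_policy G \<mu> \<Longrightarrow> x \<in> Xs G \<Longrightarrow> sum (\<mu> x) (act G x) = 1"
  by (auto simp: is_policy_def act_simplex_def)

lemma policy_le_1:
  assumes "is_policy G \<mu>" "x \<in> Xs G"
  shows "\<mu> x a \<le> 1"
proof (cases "a \<in> act G x")
  case True
  then show ?thesis
    using member_le_sum[of a "act G x" "\<mu> x"] policy_nonneg[OF assms] policy_sum[OF assms] assms by auto
next
  case False
  then show ?thesis using assms by (auto simp: is_policy_def act_simplex_def)
qed

lemma reach_bounds:
  assumes "is_policy G \<mu>" "x \<in> Xs G"
  shows "0 \<le> reach G \<mu> x" "reach G \<mu> x \<le> 1"
proof -
  have "0 \<le> reach G \<mu> x \<and> reach G \<mu> x \<le> 1"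
    using assms(2)
    by (induction x rule: tree_induct)
      (auto simp: reach_root reach_child plan_eq policy_nonneg policy_le_1 assms(1) intro!: mult_le_one)
  then show "0 \<le> reach G \<mu> x" "reach G \<mu> x \<le> 1" by auto
qed

lemma plan_bounds:
  assumes "is_policy G \<mu>" "x \<in> Xs G"
  shows "0 \<le> plan G \<mu> x a" "plan G \<mu> x a \<le> 1"
  using reach_bounds[OF assms] policy_nonneg[OF assms] policy_le_1[OF assms]
  by (auto simp: plan_eq intro!: mult_le_one)

lemma plan_from_bounds:
  assumes "is_policy G \<mu>" "x \<in> Xs G"
  shows "0 \<le> plan_from G \<mu> h x a" "plan_from G \<mu> h x a \<le> 1"
proof -
  have "0 \<le> plan_from G \<mu> h x a \<and> plan_from G \<mu> h x a \<le> 1"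
    using assms(2)
  proof (induction x arbitrary: a rule: tree_induct)
    case (root x)
    then show ?case
      by (simp add: plan_from_def hist_root policy_nonneg policy_le_1 assms(1))
  next
    case (child x y b)
    then show ?case
      using policy_nonneg[OF assms(1), of x a] policy_le_1[OF assms(1), of x a]
      by (cases "h \<le> dep G y")
         (auto simp: plan_from_child plan_from_base intro!: mult_le_one)
  qed
  then show "0 \<le> plan_from G \<mu> h x a" "plan_from G \<mu> h x a \<le> 1" by auto
qed

lemma positive_policyD:
  assumes "positive_policy G \<mu>"
  shows "is_policy G \<mu>" "\<And>x a. x \<in> Xs G \<Longrightarrow> a \<in> act G x \<Longrightarrow> 0 < \<mu> x a"
  using assms by (auto simp: positive_policy_def)

lemma reach_pos:
  assumes "positive_policy G \<mu>" "x \<in> Xs G"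
  shows "0 < reach G \<mu> x"
  using assms(2)
  by (induction x rule: tree_induct)
     (auto simp: reach_root reach_child plan_eq positive_policyD(2)[OF assms(1)])

lemma plan_pos:
  assumes "positive_policy G \<mu>" "x \<in> Xs G" "a \<in> act G x"
  shows "0 < plan G \<mu> x a"
  using reach_pos[OF assms(1,2)] positive_policyD(2)[OF assms] by (simp add: plan_eq)

lemma plan_from_pos:
  assumes "positive_policy G \<mu>" "x \<in> Xs G" "a \<in> act G x"
  shows "0 < plan_from G \<mu> h x a"
  using assms(2,3)
proof (induction x arbitrary: a rule: tree_induct)
  case (root x)
  then show ?case by (simp add: plan_from_def hist_root positive_policyD(2)[OF assms(1)])
next
  case (child x y b)
  then show ?case
    using positive_policyD(2)[OF assms(1), of x a]
    by (cases "h \<le> dep G y") (auto simp: plan_from_child plan_from_base)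
qed

text \<open>Satisfied almost surely by the visiting weights \<open>p\<close> of the opponent (see \<open>AE_flow\<close>).\<close>
definition flow :: "('x \<Rightarrow> real) \<Rightarrow> bool" where
  "flow p \<longleftrightarrow> (\<forall>x\<in>Xs G. 0 \<le> p x) \<and> (\<Sum>x\<in>{x\<in>Xs G. par G x = None}. p x) \<le> 1 \<and>
     (\<forall>y\<in>Xs G. \<forall>b\<in>act G y. (\<Sum>x\<in>{x\<in>Xs G. par G x = Some (y, b)}. p x) \<le> p y)"

lemma flow_mono:
  assumes "flow p" "x \<in> Xs G" "in_hist G z x"
  shows "p x \<le> p z"
  using assms(2,3)
proof (induction x rule: tree_induct)
  case (root x)
  then show ?case by (auto simp: in_hist_root)
next
  case (child x y b)
  have "p x \<le> (\<Sum>x\<in>{x\<in>Xs G. par G x = Some (y, b)}. p x)"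
    using child assms(1) by (intro member_le_sum) (auto simp: flow_def)
  also have "\<dots> \<le> p y" using child assms(1) by (auto simp: flow_def)
  finally show ?case using child by (auto simp: in_hist_child)
qed

text \<open>Induction on the depth: when the information sets of the next depth are grouped by
  parent pair, the flow inequality bounds each group by the weight of that pair, and the action
  probabilities of \<open>\<mu>\<close> sum to 1.\<close>

lemma flow_depth_sum:
  assumes "flow p" "is_policy G \<mu>"
  shows "(\<Sum>x\<in>{x\<in>Xs G. dep G x = Suc h}. p x * reach G \<mu> x) \<le> 1"
proof (induction h)
  case 0
  have "{x\<in>Xs G. dep G x = Suc 0} = {x\<in>Xs G. par G x = None}" using par_None by auto
  then show ?case using assms(1) by (simp add: flow_def reach_root)
next
  case (Suc h)
  let ?T = "SIGMA y:{y\<in>Xs G. dep G y = Suc h}. act G y"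
  let ?S = "{x\<in>Xs G. dep G x = Suc (Suc h)}"
  have sub: "(\<lambda>x. the (par G x)) ` ?S \<subseteq> ?T"
  proof
    fix z assume "z \<in> (\<lambda>x. the (par G x)) ` ?S"
    then obtain x where x: "x \<in> Xs G" "dep G x = Suc (Suc h)" "z = the (par G x)" by auto
    then obtain y b where "par G x = Some (y, b)" using par_None[of x] by force
    then show "z \<in> ?T" using x par_Some[of x y b] by auto
  qed
  have "(\<Sum>x\<in>?S. p x * reach G \<mu> x)
     = (\<Sum>yb\<in>?T. \<Sum>x\<in>{x\<in>?S. the (par G x) = yb}. p x * reach G \<mu> x)"
    using sub by (intro sum.group[symmetric]) auto
  also have "\<dots> \<le> (\<Sum>yb\<in>?T. p (fst yb) * plan G \<mu> (fst yb) (snd yb))"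
  proof (rule sum_mono)
    fix yb assume yb: "yb \<in> ?T"
    obtain y b where [simp]: "yb = (y, b)" by force
    have y: "y \<in> Xs G" "b \<in> act G y" "dep G y = Suc h" using yb by auto
    have eq: "{x\<in>?S. the (par G x) = yb} = {x\<in>Xs G. par G x = Some (y, b)}"
    proof (intro set_eqI iffI)
      fix x assume "x \<in> {x\<in>?S. the (par G x) = yb}"
      then show "x \<in> {x\<in>Xs G. par G x = Some (y, b)}" using par_None[of x] by auto
    next
      fix x assume "x \<in> {x\<in>Xs G. par G x = Some (y, b)}"
      then show "x \<in> {x\<in>?S. the (par G x) = yb}" using par_Some[of x y b] y by auto
    qed
    have "(\<Sum>x\<in>{x\<in>?S. the (par G x) = yb}. p x * reach G \<mu> x)
       = (\<Sum>x\<in>{x\<in>Xs G. par G x = Some (y, b)}. p x) * plan G \<mu> y b"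
      unfolding eq by (auto simp: reach_child sum_distrib_right intro!: sum.cong)
    also have "\<dots> \<le> p y * plan G \<mu> y b"
      using assms y plan_bounds[OF assms(2) y(1)] by (intro mult_right_mono) (auto simp: flow_def)
    finally show "(\<Sum>x\<in>{x\<in>?S. the (par G x) = yb}. p x * reach G \<mu> x)
        \<le> p (fst yb) * plan G \<mu> (fst yb) (snd yb)" by simp
  qed
  also have "\<dots> = (\<Sum>y\<in>{y\<in>Xs G. dep G y = Suc h}. \<Sum>b\<in>act G y. p y * plan G \<mu> y b)"
    by (subst sum.Sigma) (auto simp: case_prod_beta)
  also have "\<dots> = (\<Sum>y\<in>{y\<in>Xs G. dep G y = Suc h}. p y * reach G \<mu> y)"
    by (intro sum.cong)
       (auto simp: plan_eq sum_distrib_left[symmetric] policy_sum[OF assms(2)])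
  finally show ?case using Suc by simp
qed

lemma sum_by_depth:
  "(\<Sum>x\<in>Xs G. f x) = (\<Sum>h\<in>{1..hor G}. \<Sum>x\<in>{x\<in>Xs G. dep G x = h}. f x)"
  using dep_bounds by (intro sum.group[symmetric]) auto

lemma flow_reach_sum:
  assumes "flow p" "is_policy G \<mu>"
  shows "(\<Sum>x\<in>Xs G. p x * reach G \<mu> x) \<le> real (hor G)"
proof -
  have "(\<Sum>x\<in>Xs G. p x * reach G \<mu> x) \<le> (\<Sum>h\<in>{1..hor G}. 1)"
    unfolding sum_by_depth
  proof (rule sum_mono)
    fix h assume "h \<in> {1..hor G}"
    then show "(\<Sum>x\<in>{x\<in>Xs G. dep G x = h}. p x * reach G \<mu> x) \<le> 1"
      using flow_depth_sum[OF assms, of "h - 1"] by simp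
  qed
  then show ?thesis by simp
qed

lemma flow_plan_sum:
  assumes "flow p" "is_policy G \<mu>"
  shows "(\<Sum>x\<in>Xs G. \<Sum>a\<in>act G x. p x * plan G \<mu> x a) \<le> real (hor G)"
proof -
  have "(\<Sum>x\<in>Xs G. \<Sum>a\<in>act G x. p x * plan G \<mu> x a) = (\<Sum>x\<in>Xs G. p x * reach G \<mu> x)"
    by (intro sum.cong)
       (auto simp: plan_eq sum_distrib_left[symmetric] policy_sum[OF assms(2)])
  then show ?thesis using flow_reach_sum[OF assms] by simp
qed

end

section \<open>Complexity quantities of the sampling policy\<close>

locale sampled_game = game_tree G for G :: "('x, 'a) game" +
  fixes \<mu>s :: "'x \<Rightarrow> 'a \<Rightarrow> real"
  assumes pos: "positive_policy G \<mu>s"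
begin

lemma policy_mus: "is_policy G \<mu>s" using pos by (simp add: positive_policy_def)

definition kappa_fun :: "('x \<Rightarrow> 'a \<Rightarrow> real) \<Rightarrow> real" where
  "kappa_fun \<mu> = (\<Sum>x\<in>Xs G. \<Sum>a\<in>act G x. plan G \<mu> x a / plan G \<mu>s x a)"

definition kappa_at_fun :: "'x \<Rightarrow> ('x \<Rightarrow> 'a \<Rightarrow> real) \<Rightarrow> real" where
  "kappa_at_fun x \<mu> = (\<Sum>x'\<in>{x'\<in>Xs G. in_hist G x x'}. \<Sum>a'\<in>act G x'.
        plan_from G \<mu> (dep G x) x' a' / plan_from G \<mu>s (dep G x) x' a')"

lemma kappa_eq: "kappa G \<mu>s = Sup (kappa_fun ` Collect (is_policy G))"
  unfolding kappa_def kappa_fun_def by (rule arg_cong[of _ _ Sup]) auto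

lemma kappa_at_eq: "kappa_at G \<mu>s x = Sup (kappa_at_fun x ` Collect (is_policy G))"
  unfolding kappa_at_def kappa_at_fun_def by (rule arg_cong[of _ _ Sup]) auto

lemma kappa_fun_le: "is_policy G \<mu> \<Longrightarrow> kappa_fun \<mu> \<le> kappa G \<mu>s"
  unfolding kappa_eq
proof (rule cSup_upper)
  show "bdd_above (kappa_fun ` Collect (is_policy G))"
    unfolding kappa_fun_def
    by (intro bdd_aboveI2[of _ _ "\<Sum>x\<in>Xs G. \<Sum>a\<in>act G x. 1 / plan G \<mu>s x a"] sum_mono divide_right_mono)
       (auto simp: plan_bounds plan_pos[OF pos] less_imp_le)
qed auto

lemma kappa_at_fun_le: "is_policy G \<mu> \<Longrightarrow> kappa_at_fun x \<mu> \<le> kappa_at G \<mu>s x"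
  unfolding kappa_at_eq
proof (rule cSup_upper)
  show "bdd_above (kappa_at_fun x ` Collect (is_policy G))"
    unfolding kappa_at_fun_def
    by (intro bdd_aboveI2[of _ _ "\<Sum>x'\<in>{x'\<in>Xs G. in_hist G x x'}. \<Sum>a'\<in>act G x'.
          1 / plan_from G \<mu>s (dep G x) x' a'"] sum_mono divide_right_mono)
       (auto simp: plan_from_bounds plan_from_pos[OF pos] less_imp_le)
qed auto

lemma kappa_pos:
  assumes "Xs G \<noteq> {}"
  shows "0 < kappa G \<mu>s"
proof -
  have "0 < kappa_fun \<mu>s"
    unfolding kappa_fun_def using assms
    by (intro sum_pos divide_pos_pos) (auto simp: act_nonempty plan_pos[OF pos])
  then show ?thesis using kappa_fun_le[OF policy_mus] by simp
qed

lemma kappa_at_pos: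
  assumes "x \<in> Xs G"
  shows "0 < kappa_at G \<mu>s x"
proof -
  have "0 < kappa_at_fun x \<mu>s"
    unfolding kappa_at_fun_def using assms
    by (intro sum_pos divide_pos_pos) (auto simp: act_nonempty plan_from_pos[OF pos])
  then show ?thesis using kappa_at_fun_le[OF policy_mus] by (smt (verit))
qed

text \<open>An \<epsilon>-maximizer takes the place of a maximizer, which avoids a compactness
  argument; the slack is removed in \<open>kappa_at_depth_sum\<close>.\<close>

lemma kappa_at_approx:
  assumes "\<epsilon> > 0"
  shows "\<exists>\<mu>. is_policy G \<mu> \<and> kappa_at G \<mu>s x - \<epsilon> \<le> kappa_at_fun x \<mu>"
proof -
  have "kappa_at G \<mu>s x - \<epsilon> < Sup (kappa_at_fun x ` Collect (is_policy G))"
    using assms by (simp add: kappa_at_eq)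
  then obtain y where "y \<in> kappa_at_fun x ` Collect (is_policy G)" "kappa_at G \<mu>s x - \<epsilon> < y"
    using less_cSupD policy_mus by (metis (no_types, lifting) empty_iff image_is_empty mem_Collect_eq)
  then show ?thesis by (auto intro: less_imp_le)
qed

text \<open>The continuation \<open>m z\<close> depends on the ancestor \<open>z\<close> at depth
  \<open>h\<close>, which exists and is unique from depth \<open>h\<close> on by
  \<open>ancestor_exists\<close> and \<open>in_hist_unique\<close>. Policies chosen separately for
  each subtree are thus combined into one.\<close>

definition glue :: "nat \<Rightarrow> ('x \<Rightarrow> 'a \<Rightarrow> real) \<Rightarrow> ('x \<Rightarrow> 'x \<Rightarrow> 'a \<Rightarrow> real) \<Rightarrow> 'x \<Rightarrow> 'a \<Rightarrow> real" where
  "glue h \<mu> m = (\<lambda>y. if dep G y < h then \<mu> y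
      else m (THE z. z \<in> Xs G \<and> dep G z = h \<and> in_hist G z y) y)"

lemma glue_below:
  assumes "y \<in> Xs G" "in_hist G z y" "dep G z = h"
  shows "glue h \<mu> m y = m z y"
proof -
  have "(THE z. z \<in> Xs G \<and> dep G z = h \<and> in_hist G z y) = z"
    using assms in_hist_Xs in_hist_unique by (intro the_equality) auto
  then show ?thesis using assms in_hist_dep[of y z] by (auto simp: glue_def)
qed

lemma glue_policy:
  assumes "1 \<le> h" "is_policy G \<mu>" "\<And>x. is_policy G (m x)"
  shows "is_policy G (glue h \<mu> m)"
  unfolding is_policy_def
proof
  fix y assume y: "y \<in> Xs G"
  show "glue h \<mu> m y \<in> act_simplex G y"
  proof (cases "dep G y < h")
    case True
    then show ?thesis using assms y by (auto simp: glue_def is_policy_def)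
  next
    case False
    then obtain z where "dep G z = h" "in_hist G z y" using ancestor_exists[OF y assms(1)] by auto
    then show ?thesis using assms y by (auto simp: glue_below is_policy_def)
  qed
qed

lemma reach_glue:
  assumes "x \<in> Xs G" "dep G x \<le> h"
  shows "reach G (glue h \<mu> m) x = reach G \<mu> x"
  using assms
  by (induction x rule: tree_induct) (auto simp: reach_root reach_child plan_eq glue_def)

lemma plan_from_glue:
  assumes "x \<in> Xs G" "in_hist G z x"
  shows "plan_from G (glue (dep G z) \<mu> m) (dep G z) x a = plan_from G (m z) (dep G z) x a"
  using assms
proof (induction x arbitrary: a rule: tree_induct)
  case (root x)
  then show ?case by (auto simp: in_hist_root plan_from_base glue_below)
next
  case (child x y b)
  show ?case
  proof (cases "z = x")
    case True
    have "glue (dep G x) \<mu> m x = m x x" using child.hyps(1) by (rule glue_below) auto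
    then show ?thesis using child.hyps(1) True by (simp add: plan_from_base)
  next
    case False
    then have z: "in_hist G z y" using child by (auto simp: in_hist_child)
    then have "dep G z \<le> dep G y" using in_hist_dep[of y z] child by auto
    then show ?thesis using child z by (simp add: plan_from_child glue_below)
  qed
qed

text \<open>For the glued policy \<open>plan_split\<close> turns the summands of the weighted
  \<open>kappa_at_fun\<close> into ratios of full plans. The subtrees rooted at depth
  \<open>h\<close> are disjoint, so together they form a part of \<open>kappa_fun\<close> of a
  single policy.\<close>

lemma kappa_at_depth_sum:
  assumes "1 \<le> h" "is_policy G \<mu>"
  shows "(\<Sum>x\<in>{x\<in>Xs G. dep G x = h}. reach G \<mu> x / reach G \<mu>s x * kappa_at G \<mu>s x) \<le> kappa G \<mu>s"
proof -
  let ?X = "{x\<in>Xs G. dep G x = h}"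
  let ?r = "\<lambda>x. reach G \<mu> x / reach G \<mu>s x"
  have r0: "0 \<le> ?r x" if "x \<in> Xs G" for x
    using reach_bounds[OF assms(2) that] reach_pos[OF pos that] by auto
  have approx: "(\<Sum>x\<in>?X. ?r x * (kappa_at G \<mu>s x - \<epsilon>)) \<le> kappa G \<mu>s" if eps: "\<epsilon> > 0" for \<epsilon>
  proof -
    obtain m where m: "\<And>x. is_policy G (m x)" "\<And>x. kappa_at G \<mu>s x - \<epsilon> \<le> kappa_at_fun x (m x)"
      using kappa_at_approx[OF eps] by metis
    let ?g = "glue h \<mu> m"
    have g: "is_policy G ?g" using glue_policy assms m by auto
    let ?f = "\<lambda>x'. \<Sum>a'\<in>act G x'. plan G ?g x' a' / plan G \<mu>s x' a'"
    have f0: "0 \<le> ?f x'" if "x' \<in> Xs G" for x'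
      using plan_bounds[OF g that] plan_bounds[OF policy_mus that] by (intro sum_nonneg) auto
    have "(\<Sum>x\<in>?X. ?r x * (kappa_at G \<mu>s x - \<epsilon>)) \<le> (\<Sum>x\<in>?X. ?r x * kappa_at_fun x (m x))"
      using m r0 by (intro sum_mono mult_left_mono) auto
    also have "\<dots> = (\<Sum>x\<in>?X. \<Sum>x'\<in>{x'\<in>Xs G. in_hist G x x'}. ?f x')"
    proof (rule sum.cong)
      fix x assume x: "x \<in> ?X"
      show "?r x * kappa_at_fun x (m x) = (\<Sum>x'\<in>{x'\<in>Xs G. in_hist G x x'}. ?f x')"
        unfolding kappa_at_fun_def sum_distrib_left
      proof (intro sum.cong refl)
        fix x' a' assume x': "x' \<in> {x'\<in>Xs G. in_hist G x x'}" and a': "a' \<in> act G x'"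
        have "plan G ?g x' a' = reach G \<mu> x * plan_from G (m x) (dep G x) x' a'"
          using plan_split[of x' x ?g a'] plan_from_glue[of x' x \<mu> m a'] reach_glue[of x h \<mu> m] x x' by auto
        moreover have "plan G \<mu>s x' a' = reach G \<mu>s x * plan_from G \<mu>s (dep G x) x' a'"
          using plan_split x' by auto
        ultimately show "?r x * (plan_from G (m x) (dep G x) x' a' / plan_from G \<mu>s (dep G x) x' a')
           = plan G ?g x' a' / plan G \<mu>s x' a'" by simp
      qed
    qed simp
    also have "\<dots> = (\<Sum>x'\<in>(\<Union>x\<in>?X. {x'\<in>Xs G. in_hist G x x'}). ?f x')"
      using in_hist_unique by (intro sum.UNION_disjoint[symmetric]) auto
    also have "\<dots> \<le> (\<Sum>x'\<in>Xs G. ?f x')"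
      using f0 by (intro sum_mono2) auto
    also have "\<dots> \<le> kappa G \<mu>s" using kappa_fun_le[OF g] by (simp add: kappa_fun_def)
    finally show ?thesis .
  qed
  define R where "R = (\<Sum>x\<in>?X. ?r x)"
  have R0: "0 \<le> R" unfolding R_def using r0 by (intro sum_nonneg) auto
  show ?thesis
  proof (rule field_le_epsilon)
    fix e :: real assume e: "e > 0"
    \<comment> \<open>Slack \<open>e / (R + 1)\<close> per unit of weight costs
      \<open>e / (R + 1) * R \<le> e\<close> in total; the added 1 covers
      \<open>R = 0\<close>.\<close>
    have "(\<Sum>x\<in>?X. ?r x * kappa_at G \<mu>s x) - e / (R + 1) * R \<le> kappa G \<mu>s"
      using approx[of "e / (R + 1)"] e R0
      by (simp add: R_def right_diff_distrib sum_subtractf sum_distrib_left sum_divide_distrib mult.commute)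
    moreover have "e / (R + 1) * R \<le> e" using e R0 by (simp add: field_simps)
    ultimately show "(\<Sum>x\<in>?X. ?r x * kappa_at G \<mu>s x) \<le> kappa G \<mu>s + e" by simp
  qed
qed

lemma kappa_at_sum:
  assumes "is_policy G \<mu>"
  shows "(\<Sum>x\<in>Xs G. reach G \<mu> x / reach G \<mu>s x * kappa_at G \<mu>s x) \<le> real (hor G) * kappa G \<mu>s"
proof -
  have "(\<Sum>x\<in>Xs G. reach G \<mu> x / reach G \<mu>s x * kappa_at G \<mu>s x) \<le> (\<Sum>h\<in>{1..hor G}. kappa G \<mu>s)"
    unfolding sum_by_depth using kappa_at_depth_sum[OF _ assms] by (intro sum_mono) auto
  then show ?thesis by simp
qed

end

subsection \<open>LocalOMD along one trajectory\<close>

lemma sum_squared_le: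
  fixes f :: "'b \<Rightarrow> real"
  assumes "finite I"
  shows "(\<Sum>i\<in>I. f i)\<^sup>2 \<le> real (card I) * (\<Sum>i\<in>I. (f i)\<^sup>2)"
  using Cauchy_Schwarz_ineq_sum[of "\<lambda>_. 1" f I] by simp

context sampled_game begin

text \<open>Each visit of \<open>(x', a')\<close> is charged the second-order error that it causes in the local updates at
  all information sets \<open>x\<close> of its history.\<close>
definition estimation_cost :: "('x \<Rightarrow> real) \<Rightarrow> ('x \<Rightarrow> 'a \<Rightarrow> real) \<Rightarrow> 'x \<Rightarrow> 'a \<Rightarrow> real" where
  "estimation_cost e \<mu> x' a' = (\<Sum>x\<in>{x\<in>Xs G. in_hist G x x'}. reach G \<mu> x / reach G \<mu>s x *
     (e x * real (hor G) / 2 * (plan_from G \<mu> (dep G x) x' a' / (plan_from G \<mu>s (dep G x) x' a')\<^sup>2)))"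

end

section \<open>Closed form of the local update\<close>

locale omd_policy = sampled_game G \<mu>s for G :: "('x, 'a) game" and \<mu>s +
  fixes e :: "'x \<Rightarrow> real" and \<mu> :: "'x \<Rightarrow> 'a \<Rightarrow> real"
  assumes e_pos: "\<And>x. x \<in> Xs G \<Longrightarrow> 0 < e x" and mu: "positive_policy G \<mu>"
begin

lemma policy_mu: "is_policy G \<mu>" using mu by (simp add: positive_policy_def)

lemma entropic: "x \<in> Xs G \<Longrightarrow> entropic (act G x) (e x) (\<mu> x)"
  using positive_policyD[OF mu] policy_sum[OF policy_mu] e_pos
  by unfold_locales auto

lemma entropic_step_simplex: "x \<in> Xs G \<Longrightarrow> entropic_step (act G x) (e x) l (\<mu> x) \<in> act_simplex G x"
  using entropic.step_sum[OF entropic, of x l] entropic.step_pos[OF entropic, of x _ l] policy_mu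
  by (auto simp: act_simplex_def less_imp_le is_policy_def entropic_step_def)

text \<open>The rates do not change with \<open>t\<close>, so the coefficient of the divergence to
  \<open>\<mu>1\<close> is 0; \<open>three_point\<close> rewrites the rest.\<close>

lemma omd_obj_eq:
  assumes "x \<in> Xs G" "p \<in> act_simplex G x"
  shows "omd_obj G (\<lambda>t. e) \<mu>1 t x \<mu> l p = entropic_value (act G x) (e x) l (\<mu> x)
       + 1 / e x * breg (act G x) p (entropic_step (act G x) (e x) l (\<mu> x))"
  using entropic.three_point[OF entropic[OF assms(1)], of p l] assms(2)
  by (simp add: omd_obj_def act_simplex_def)

text \<open>The remaining divergence is nonnegative and vanishes only at the exponential-weights
  update. Outside \<open>act G x\<close> both functions are 0, so they are equal as
  functions.\<close>

lemma omd_obj_ge: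
  assumes "x \<in> Xs G" "p \<in> act_simplex G x"
  shows "entropic_value (act G x) (e x) l (\<mu> x) \<le> omd_obj G (\<lambda>t. e) \<mu>1 t x \<mu> l p"
    and "omd_obj G (\<lambda>t. e) \<mu>1 t x \<mu> l p = entropic_value (act G x) (e x) l (\<mu> x)
       \<longleftrightarrow> p = entropic_step (act G x) (e x) l (\<mu> x)"
proof -
  let ?s = "entropic_step (act G x) (e x) l (\<mu> x)"
  note s = entropic.step_sum[OF entropic[OF assms(1)], of l] entropic.step_pos[OF entropic[OF assms(1)], of _ l]
  have "0 \<le> breg (act G x) p ?s"
    using assms s by (intro breg_nonneg) (auto simp: act_simplex_def)
  then show "entropic_value (act G x) (e x) l (\<mu> x) \<le> omd_obj G (\<lambda>t. e) \<mu>1 t x \<mu> l p"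
    using omd_obj_eq[OF assms] e_pos[OF assms(1)] by simp
  have "p = ?s" if 0: "breg (act G x) p ?s = 0"
  proof
    fix a
    show "p a = ?s a"
    proof (cases "a \<in> act G x")
      case True
      show ?thesis
        by (rule breg_zero_imp_eq[OF _ _ _ _ _ 0 True]) (use assms s in \<open>auto simp: act_simplex_def\<close>)
    next
      case False
      then show ?thesis using assms entropic_step_simplex[OF assms(1), of l] by (auto simp: act_simplex_def)
    qed
  qed
  moreover have "breg (act G x) ?s ?s = 0" by (simp add: breg_def)
  ultimately have "breg (act G x) p ?s = 0 \<longleftrightarrow> p = ?s" by metis
  moreover have "omd_obj G (\<lambda>t. e) \<mu>1 t x \<mu> l p = entropic_value (act G x) (e x) l (\<mu> x)
      \<longleftrightarrow> breg (act G x) p ?s = 0"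
    using omd_obj_eq[OF assms, of \<mu>1 t l] e_pos[OF assms(1)] by simp
  ultimately show "omd_obj G (\<lambda>t. e) \<mu>1 t x \<mu> l p = entropic_value (act G x) (e x) l (\<mu> x) \<longleftrightarrow> p = ?s"
    by simp
qed

lemma omd_obj_step:
  assumes "x \<in> Xs G"
  shows "omd_obj G (\<lambda>t. e) \<mu>1 t x \<mu> l (entropic_step (act G x) (e x) l (\<mu> x))
     = entropic_value (act G x) (e x) l (\<mu> x)"
  using omd_obj_ge(2)[OF assms entropic_step_simplex[OF assms]] by simp

lemma omd_obj_Inf:
  assumes "x \<in> Xs G"
  shows "Inf (omd_obj G (\<lambda>t. e) \<mu>1 t x \<mu> l ` act_simplex G x) = entropic_value (act G x) (e x) l (\<mu> x)"
proof (rule cInf_eq_minimum)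
  show "entropic_value (act G x) (e x) l (\<mu> x) \<in> omd_obj G (\<lambda>t. e) \<mu>1 t x \<mu> l ` act_simplex G x"
    using omd_obj_step[OF assms, symmetric] entropic_step_simplex[OF assms] by (rule image_eqI)
qed (use omd_obj_ge(1)[OF assms] in auto)

text \<open>\<open>arg_min_on\<close> chooses some minimizer; the equality case of
  \<open>omd_obj_ge\<close> leaves only one.\<close>

lemma omd_obj_arg_min:
  assumes "x \<in> Xs G"
  shows "arg_min_on (omd_obj G (\<lambda>t. e) \<mu>1 t x \<mu> l) (act_simplex G x) = entropic_step (act G x) (e x) l (\<mu> x)"
  unfolding arg_min_on_def arg_min_def
proof (rule some_equality)
  show "is_arg_min (omd_obj G (\<lambda>t. e) \<mu>1 t x \<mu> l) (\<lambda>x'. x' \<in> act_simplex G x)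
      (entropic_step (act G x) (e x) l (\<mu> x))"
    using omd_obj_step[OF assms] entropic_step_simplex[OF assms] omd_obj_ge(1)[OF assms]
    by (auto simp: is_arg_min_def not_less)
next
  fix p assume p: "is_arg_min (omd_obj G (\<lambda>t. e) \<mu>1 t x \<mu> l) (\<lambda>x'. x' \<in> act_simplex G x) p"
  then have px: "p \<in> act_simplex G x" by (simp add: is_arg_min_def)
  have "omd_obj G (\<lambda>t. e) \<mu>1 t x \<mu> l p \<le> entropic_value (act G x) (e x) l (\<mu> x)"
    using p omd_obj_step[OF assms] entropic_step_simplex[OF assms] by (metis is_arg_min_def not_less)
  then show "p = entropic_step (act G x) (e x) l (\<mu> x)"
    using omd_obj_ge[OF assms px] by (metis order_antisym)
qed

abbreviation "cost \<equiv> estimation_cost e \<mu>"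

end

section \<open>Pathwise analysis of one round on a fixed trajectory\<close>

locale episode = omd_policy G \<mu>s e \<mu> for G :: "('x, 'a) game" and \<mu>s e \<mu> +
  fixes xs :: "nat \<Rightarrow> 'x" and as :: "nat \<Rightarrow> 'a" and ls :: "nat \<Rightarrow> real"
    and t :: nat and \<mu>1 :: "'x \<Rightarrow> 'a \<Rightarrow> real"
  assumes traj: "\<And>h. h \<in> {1..hor G} \<Longrightarrow> xs h \<in> Xs G \<and> dep G (xs h) = h \<and> as h \<in> act G (xs h)
                   \<and> 0 \<le> ls h \<and> ls h \<le> 1"
    and traj_follow: "\<And>h. 1 \<le> h \<Longrightarrow> h < hor G \<Longrightarrow> par G (xs (Suc h)) = Some (xs h, as h)"
begin

lemma traj_simps [simp]:
  assumes "1 \<le> h" "h \<le> H"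
  shows "xs h \<in> Xs G" "dep G (xs h) = h" "as h \<in> act G (xs h)" "0 \<le> ls h" "ls h \<le> 1"
  using traj[of h] assms by auto

lemma par_first: "par G (xs 1) = None"
  using par_None[of "xs 1"] hor_pos by simp

text \<open>\<open>omd_q\<close> counts levels backwards from the end of the episode; reindexed by
  depth, \<open>q h\<close> is the value at depth \<open>h\<close> and
  \<open>q (Suc H) = 0\<close>.\<close>

definition q :: "nat \<Rightarrow> real" where
  "q h = omd_q G \<mu>s (\<lambda>t. e) \<mu>1 t \<mu> xs as ls (Suc H - h)"

definition lt :: "nat \<Rightarrow> 'a \<Rightarrow> real" where
  "lt h = omd_lt \<mu>s xs as ls h (q (Suc h))"

definition next_mu :: "'x \<Rightarrow> 'a \<Rightarrow> real" where
  "next_mu = omd_next G \<mu>s (\<lambda>t. e) \<mu>1 t xs as ls \<mu>"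

lemma q_end: "q (Suc H) = 0"
  by (simp add: q_def)

lemma q_eq:
  assumes "1 \<le> h" "h \<le> H"
  shows "q h = entropic_value (act G (xs h)) (e (xs h)) (lt h) (\<mu> (xs h))"
proof -
  have 1: "Suc H - h = Suc (H - h)" using assms by auto
  have 2: "H - (H - h) = h" using assms by auto
  show ?thesis unfolding q_def 1 omd_q.simps 2 using assms
    by (simp add: omd_obj_Inf lt_def q_def del: omd_q.simps)
qed

lemma next_mu_eq:
  "next_mu x = (if x \<in> Xs G \<and> xs (dep G x) = x
     then entropic_step (act G x) (e x) (lt (dep G x)) (\<mu> x) else \<mu> x)"
  by (simp add: next_mu_def omd_next_def omd_obj_arg_min lt_def q_def)

lemma next_mu_positive: "positive_policy G next_mu"
  unfolding positive_policy_def is_policy_def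
  using entropic_step_simplex entropic.step_pos[OF entropic] positive_policyD[OF mu] policy_mu
  by (auto simp: next_mu_eq is_policy_def)

lemma sum_lt:
  assumes "1 \<le> h" "h \<le> H"
  shows "(\<Sum>a\<in>act G (xs h). lt h a * f a) = (ls h + q (Suc h)) / \<mu>s (xs h) (as h) * f (as h)"
proof -
  have "(\<Sum>a\<in>act G (xs h). lt h a * f a)
     = (\<Sum>a\<in>act G (xs h). if a = as h then (ls h + q (Suc h)) / \<mu>s (xs h) (as h) * f a else 0)"
    by (intro sum.cong) (auto simp: lt_def omd_lt_def)
  then show ?thesis using assms by simp
qed

lemma mus_pos: "1 \<le> h \<Longrightarrow> h \<le> H \<Longrightarrow> 0 < \<mu>s (xs h) (as h)"
  and mu_pos: "1 \<le> h \<Longrightarrow> h \<le> H \<Longrightarrow> 0 < \<mu> (xs h) (as h)"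
  using positive_policyD(2)[OF pos] positive_policyD(2)[OF mu] by simp_all

lemma q_nonneg:
  assumes "1 \<le> h" "h \<le> Suc H"
  shows "0 \<le> q h"
  using assms(2,1)
proof (induction h rule: inc_induct)
  case base
  then show ?case by (simp add: q_end)
next
  case (step h)
  then have h: "1 \<le> h" "h \<le> H" by auto
  have "0 \<le> lt h a" for a
    using h step mus_pos[OF h] by (auto simp: lt_def omd_lt_def)
  then show ?case using entropic.value_nonneg[OF entropic[of "xs h"]] h by (simp add: q_eq)
qed

lemma lt_nonneg:
  assumes "1 \<le> h" "h \<le> H"
  shows "0 \<le> lt h a"
  using q_nonneg[of "Suc h"] assms mus_pos[OF assms] by (auto simp: lt_def omd_lt_def)

definition w :: "('x \<Rightarrow> 'a \<Rightarrow> real) \<Rightarrow> nat \<Rightarrow> real" where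
  "w m h = reach G m (xs h) / reach G \<mu>s (xs h)"

definition rat :: "('x \<Rightarrow> 'a \<Rightarrow> real) \<Rightarrow> nat \<Rightarrow> real" where
  "rat m h = plan G m (xs h) (as h) / plan G \<mu>s (xs h) (as h)"

lemma rat_eq: "rat m h = w m h * (m (xs h) (as h) / \<mu>s (xs h) (as h))"
  by (simp add: rat_def w_def plan_eq)

lemma w_first: "w m 1 = 1"
proof -
  have "xs 1 \<in> Xs G" using hor_pos by simp
  note reach_root[OF this par_first]
  then show ?thesis by (simp add: w_def)
qed

lemma w_Suc: "1 \<le> h \<Longrightarrow> h < H \<Longrightarrow> w m (Suc h) = rat m h"
  using reach_child[OF _ traj_follow, of h] by (simp add: w_def rat_def)

text \<open>Reaching the next information set means playing the current pair, so the two weights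
  agree below depth \<open>H\<close>. At \<open>h = H\<close> the point \<open>xs (Suc H)\<close> is
  arbitrary, and both sides are 0 because \<open>q (Suc H) = 0\<close>.\<close>

lemma rat_q: "1 \<le> h \<Longrightarrow> h \<le> H \<Longrightarrow> rat m h * q (Suc h) = w m (Suc h) * q (Suc h)"
  by (cases "h = H") (auto simp: q_end w_Suc)

text \<open>The decrease, over one update, of the divergence from the comparator, divided by the
  rate; it is 0 at information sets off the trajectory and telescopes over rounds.\<close>

definition drift :: "('x \<Rightarrow> 'a \<Rightarrow> real) \<Rightarrow> 'x \<Rightarrow> real" where
  "drift m x = 1 / e x * (breg (act G x) (m x) (\<mu> x) - breg (act G x) (m x) (next_mu x))"

text \<open>Backward induction on the depth: the three-point equality at \<open>xs h\<close>
  expresses \<open>q h\<close> through \<open>q (Suc h)\<close>, and multiplication by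
  \<open>w m h\<close> turns the factor \<open>m / \<mu>s\<close> of the sampled action into the
  weight of the next depth.\<close>

lemma q_comparator:
  assumes m: "is_policy G m" and h: "1 \<le> h" "h \<le> Suc H"
  shows "w m h * q h = (\<Sum>i=h..H. rat m i * ls i + w m i * drift m (xs i))"
  using h(2,1)
proof (induction h rule: inc_induct)
  case base
  then show ?case by (simp add: q_end)
next
  case (step h)
  then have h: "1 \<le> h" "h \<le> H" by auto
  have "(\<Sum>a\<in>act G (xs h). lt h a * m (xs h) a) + 1 / e (xs h) * breg (act G (xs h)) (m (xs h)) (\<mu> (xs h))
    = q h + 1 / e (xs h) * breg (act G (xs h)) (m (xs h)) (next_mu (xs h))"
    using entropic.three_point[OF entropic[of "xs h"], of "m (xs h)" "lt h"] h policy_sum[OF m]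
    by (simp add: q_eq next_mu_eq)
  then have "q h = (ls h + q (Suc h)) / \<mu>s (xs h) (as h) * m (xs h) (as h) + drift m (xs h)"
    by (simp add: sum_lt[OF h] drift_def right_diff_distrib)
  then have "w m h * q h = rat m h * ls h + w m h * drift m (xs h) + rat m h * q (Suc h)"
    by (simp add: rat_eq algebra_simps add_divide_distrib)
  also have "rat m h * q (Suc h) = (\<Sum>i=Suc h..H. rat m i * ls i + w m i * drift m (xs i))"
    unfolding rat_q[OF h] using step.IH by simp
  finally show ?case using h by (simp add: sum.atLeast_Suc_atMost)
qed

text \<open>The second-order term of \<open>value_ge\<close> at depth \<open>h\<close>; the loss
  estimate is supported on the sampled action, so one summand remains.\<close>

definition err :: "nat \<Rightarrow> real" where
  "err h = e (xs h) / 2 * (\<mu> (xs h) (as h) * ((ls h + q (Suc h)) / \<mu>s (xs h) (as h))\<^sup>2)"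

lemma q_step_bounds:
  assumes h: "1 \<le> h" "h \<le> H"
  shows "q h \<le> (ls h + q (Suc h)) / \<mu>s (xs h) (as h) * \<mu> (xs h) (as h)"
    and "(ls h + q (Suc h)) / \<mu>s (xs h) (as h) * \<mu> (xs h) (as h) - err h \<le> q h"
proof -
  show "q h \<le> (ls h + q (Suc h)) / \<mu>s (xs h) (as h) * \<mu> (xs h) (as h)"
    using entropic.value_le[OF entropic[of "xs h"], of "lt h"] h by (simp add: q_eq sum_lt)
  have "(\<Sum>a\<in>act G (xs h). \<mu> (xs h) a * (lt h a)\<^sup>2) = (\<Sum>a\<in>act G (xs h). lt h a * (lt h a * \<mu> (xs h) a))"
    by (intro sum.cong) (auto simp: power2_eq_square)
  also have "\<dots> = \<mu> (xs h) (as h) * ((ls h + q (Suc h)) / \<mu>s (xs h) (as h))\<^sup>2"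
    unfolding sum_lt[OF h] by (simp add: lt_def omd_lt_def power2_eq_square)
  finally have "e (xs h) / 2 * (\<Sum>a\<in>act G (xs h). \<mu> (xs h) a * (lt h a)\<^sup>2) = err h"
    by (simp add: err_def)
  then show "(ls h + q (Suc h)) / \<mu>s (xs h) (as h) * \<mu> (xs h) (as h) - err h \<le> q h"
    using entropic.value_ge[OF entropic[of "xs h"], of "lt h"] h lt_nonneg[OF h]
    by (simp add: q_eq sum_lt)
qed

lemma w_nonneg:
  assumes "is_policy G m" "1 \<le> h" "h \<le> H"
  shows "0 \<le> w m h"
  using reach_bounds[OF assms(1), of "xs h"] reach_pos[OF pos, of "xs h"] assms by (simp add: w_def)

text \<open>The recursion of \<open>q_comparator\<close> for \<open>m = \<mu>\<close>, with the
  lower bound of \<open>q_step_bounds\<close> in place of the three-point equality; each depth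
  leaves its \<open>err\<close>.\<close>

lemma q_lower:
  assumes h: "1 \<le> h" "h \<le> Suc H"
  shows "(\<Sum>i=h..H. rat \<mu> i * ls i - w \<mu> i * err i) \<le> w \<mu> h * q h"
  using h(2,1)
proof (induction h rule: inc_induct)
  case base
  then show ?case by (simp add: q_end)
next
  case (step h)
  then have h: "1 \<le> h" "h \<le> H" by auto
  have "(\<Sum>i=h..H. rat \<mu> i * ls i - w \<mu> i * err i)
      = rat \<mu> h * ls h - w \<mu> h * err h + (\<Sum>i=Suc h..H. rat \<mu> i * ls i - w \<mu> i * err i)"
    using h by (simp add: sum.atLeast_Suc_atMost)
  also have "\<dots> \<le> rat \<mu> h * ls h - w \<mu> h * err h + rat \<mu> h * q (Suc h)"
    unfolding rat_q[OF h] using step.IH by simp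
  also have "\<dots> = w \<mu> h * ((ls h + q (Suc h)) / \<mu>s (xs h) (as h) * \<mu> (xs h) (as h) - err h)"
    by (simp add: rat_eq algebra_simps add_divide_distrib)
  also have "\<dots> \<le> w \<mu> h * q h"
    using q_step_bounds(2)[OF h] w_nonneg[OF policy_mu h] by (intro mult_left_mono) auto
  finally show ?case .
qed

lemma plan_from_traj:
  assumes "1 \<le> h" "h \<le> i" "i \<le> H"
  shows "plan_from G m h (xs i) (as i) = (\<Prod>j=h..i. m (xs j) (as j))"
  using assms(2,3)
proof (induction i rule: dec_induct)
  case base
  then show ?case using assms(1) by (simp add: plan_from_base)
next
  case (step i)
  then show ?case using assms(1)
    by (simp add: plan_from_child[OF _ traj_follow[of i]])
qed

text \<open>The importance weight of the actions taken at depths \<open>h\<close> to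
  \<open>i\<close>.\<close>

definition pfr :: "nat \<Rightarrow> nat \<Rightarrow> real" where
  "pfr h i = plan_from G \<mu> h (xs i) (as i) / plan_from G \<mu>s h (xs i) (as i)"

lemma pfr_step:
  assumes "1 \<le> h" "h < i" "i \<le> H"
  shows "pfr h i = \<mu> (xs h) (as h) / \<mu>s (xs h) (as h) * pfr (Suc h) i"
  using assms by (simp add: pfr_def plan_from_traj prod.atLeast_Suc_atMost)

lemma pfr_refl: "1 \<le> h \<Longrightarrow> h \<le> H \<Longrightarrow> pfr h h = \<mu> (xs h) (as h) / \<mu>s (xs h) (as h)"
  by (simp add: pfr_def plan_from_traj)

lemma sum_pfr:
  assumes "1 \<le> h" "h \<le> H"
  shows "(\<Sum>i=h..H. pfr h i) = \<mu> (xs h) (as h) / \<mu>s (xs h) (as h) * (1 + (\<Sum>i=Suc h..H. pfr (Suc h) i))"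
proof -
  have "(\<Sum>i=h..H. pfr h i) = pfr h h + (\<Sum>i=Suc h..H. pfr h i)"
    using assms by (simp add: sum.atLeast_Suc_atMost)
  also have "(\<Sum>i=Suc h..H. pfr h i) = (\<Sum>i=Suc h..H. \<mu> (xs h) (as h) / \<mu>s (xs h) (as h) * pfr (Suc h) i)"
    using assms by (intro sum.cong) (auto simp: pfr_step)
  finally show ?thesis using assms
    by (simp add: pfr_refl distrib_left sum_distrib_left)
qed

text \<open>The upper bound of \<open>q_step_bounds\<close> unrolled to the end of the episode, with
  losses at most 1; \<open>sum_pfr\<close> is the matching recursion.\<close>

lemma q_upper:
  assumes h: "1 \<le> h" "h \<le> Suc H"
  shows "q h \<le> (\<Sum>i=h..H. pfr h i)"
  using h(2,1)
proof (induction h rule: inc_induct)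
  case base
  then show ?case by (simp add: q_end)
next
  case (step h)
  then have h: "1 \<le> h" "h \<le> H" by auto
  have "q h \<le> \<mu> (xs h) (as h) / \<mu>s (xs h) (as h) * (ls h + q (Suc h))"
    using q_step_bounds(1)[OF h] by (simp add: mult.commute)
  also have "\<dots> \<le> \<mu> (xs h) (as h) / \<mu>s (xs h) (as h) * (1 + (\<Sum>i=Suc h..H. pfr (Suc h) i))"
    using step h mus_pos[OF h] mu_pos[OF h] by (intro mult_left_mono add_mono) auto
  finally show ?case by (simp add: sum_pfr[OF h])
qed

lemma rat_mu_eq: "1 \<le> i \<Longrightarrow> i \<le> H \<Longrightarrow> rat \<mu> i = pfr 1 i"
proof -
  assume i: "1 \<le> i" "i \<le> H"
  have 1: "in_hist G (xs 1) (xs i)"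
    using i
  proof (induction i rule: dec_induct)
    case (step i)
    then show ?case using in_hist_child[OF _ traj_follow[of i]] by simp
  qed simp
  have d: "dep G (xs 1) = 1" "xs 1 \<in> Xs G" using hor_pos by simp_all
  have "plan G m (xs i) (as i) = plan_from G m 1 (xs i) (as i)" for m
    using plan_split[OF _ 1, of m "as i"] i reach_root[OF d(2) par_first] d(1) by simp
  then show ?thesis by (simp add: rat_def pfr_def)
qed

text \<open>\<open>q_upper\<close> at depth 1 and Cauchy-Schwarz over the \<open>H\<close> depths.
  The result is a sum over visited pairs, so its conditional mean can be computed pair by
  pair.\<close>

lemma q_square: "(q 1)\<^sup>2 \<le> (\<Sum>i=1..H. real H * (rat \<mu> i)\<^sup>2)"
proof -
  have "q 1 \<le> (\<Sum>i=1..H. rat \<mu> i)"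
    using q_upper[of 1] by (simp add: rat_mu_eq)
  then have "(q 1)\<^sup>2 \<le> (\<Sum>i=1..H. rat \<mu> i)\<^sup>2"
    using q_nonneg[of 1] by (intro power_mono) auto
  also have "\<dots> \<le> real H * (\<Sum>i=1..H. (rat \<mu> i)\<^sup>2)"
    using sum_squared_le[of "{1..H}" "rat \<mu>"] by simp
  finally show ?thesis by (simp add: sum_distrib_left)
qed

text \<open>\<open>q_upper\<close> and \<open>sum_pfr\<close> bound the loss estimate by a sum of
  weights \<open>pfr h i\<close>, and Cauchy-Schwarz separates the depths \<open>i\<close> at the
  cost of a factor \<open>H\<close>.\<close>

lemma err_le:
  assumes h: "1 \<le> h" "h \<le> H"
  shows "err h \<le> (\<Sum>i=h..H. e (xs h) * real H / 2 *
     (plan_from G \<mu> h (xs i) (as i) / (plan_from G \<mu>s h (xs i) (as i))\<^sup>2))"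
proof -
  let ?m = "\<mu> (xs h) (as h)" and ?s = "\<mu>s (xs h) (as h)"
  note p = mu_pos[OF h] mus_pos[OF h]
  have e: "0 \<le> e (xs h)" using e_pos[of "xs h"] h by simp
  have "ls h + q (Suc h) \<le> 1 + (\<Sum>i=Suc h..H. pfr (Suc h) i)"
    using q_upper[of "Suc h"] h by (intro add_mono) auto
  then have "(ls h + q (Suc h)) / ?s \<le> (1 + (\<Sum>i=Suc h..H. pfr (Suc h) i)) / ?s"
    using p by (intro divide_right_mono) auto
  also have "\<dots> = (\<Sum>i=h..H. pfr h i) / ?m"
    using p by (simp add: sum_pfr[OF h])
  finally have "((ls h + q (Suc h)) / ?s)\<^sup>2 \<le> ((\<Sum>i=h..H. pfr h i) / ?m)\<^sup>2"
    using p h q_nonneg[of "Suc h"] by (intro power_mono) auto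
  then have "?m * ((ls h + q (Suc h)) / ?s)\<^sup>2 \<le> ?m * ((\<Sum>i=h..H. pfr h i) / ?m)\<^sup>2"
    using p by (intro mult_left_mono) auto
  also have "\<dots> = (\<Sum>i=h..H. pfr h i)\<^sup>2 / ?m"
    using p by (simp add: power2_eq_square)
  also have "\<dots> \<le> (real H * (\<Sum>i=h..H. (pfr h i)\<^sup>2)) / ?m"
  proof (rule divide_right_mono)
    have "(\<Sum>i=h..H. pfr h i)\<^sup>2 \<le> real (card {h..H}) * (\<Sum>i=h..H. (pfr h i)\<^sup>2)"
      by (rule sum_squared_le) simp
    also have "\<dots> \<le> real H * (\<Sum>i=h..H. (pfr h i)\<^sup>2)"
      using h by (intro mult_right_mono sum_nonneg) auto
    finally show "(\<Sum>i=h..H. pfr h i)\<^sup>2 \<le> real H * (\<Sum>i=h..H. (pfr h i)\<^sup>2)" .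
  qed (use p in auto)
  also have "\<dots> = real H * (\<Sum>i=h..H. (pfr h i)\<^sup>2 / ?m)"
    by (simp add: sum_divide_distrib[symmetric])
  also have "\<dots> \<le> real H * (\<Sum>i=h..H. plan_from G \<mu> h (xs i) (as i) / (plan_from G \<mu>s h (xs i) (as i))\<^sup>2)"
  proof (intro mult_left_mono sum_mono)
    fix i assume i: "i \<in> {h..H}"
    let ?p = "plan_from G \<mu> h (xs i) (as i)" and ?ps = "plan_from G \<mu>s h (xs i) (as i)"
    \<comment> \<open>The factors beyond depth \<open>h\<close> are at most 1, so
      \<open>?p \<le> ?m\<close>: the division by \<open>?m\<close> absorbs one of the two factors
      \<open>?p\<close> in the square.\<close>
    have "?p = ?m * (\<Prod>j=Suc h..i. \<mu> (xs j) (as j))"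
      using i h by (simp add: plan_from_traj prod.atLeast_Suc_atMost)
    also have "\<dots> \<le> ?m * 1"
      using p i h policy_nonneg[OF policy_mu] policy_le_1[OF policy_mu]
      by (intro mult_left_mono prod_le_1) auto
    finally have 1: "?p / ?m \<le> 1" using p by simp
    have 2: "0 \<le> ?p" using plan_from_bounds[OF policy_mu, of "xs i"] i h by auto
    have "(pfr h i)\<^sup>2 / ?m = ?p / ?ps\<^sup>2 * (?p / ?m)"
      by (simp add: pfr_def power2_eq_square)
    also have "\<dots> \<le> ?p / ?ps\<^sup>2 * 1" using 1 2 by (intro mult_left_mono) auto
    finally show "(pfr h i)\<^sup>2 / ?m \<le> ?p / ?ps\<^sup>2" by simp
  qed simp
  finally have "err h \<le> e (xs h) / 2 * (real H * (\<Sum>i=h..H. plan_from G \<mu> h (xs i) (as i) / (plan_from G \<mu>s h (xs i) (as i))\<^sup>2))"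
    unfolding err_def using e by (intro mult_left_mono) auto
  also have "\<dots> = (\<Sum>i=h..H. e (xs h) * real H / 2 *
     (plan_from G \<mu> h (xs i) (as i) / (plan_from G \<mu>s h (xs i) (as i))\<^sup>2))"
    by (simp add: sum_distrib_left mult.assoc)
  finally show ?thesis .
qed

lemma inj_xs: "inj_on xs {1..H}"
  by (rule inj_onI) (metis atLeastAtMost_iff traj_simps(2))

lemma in_hist_traj:
  assumes "1 \<le> i" "i \<le> H"
  shows "in_hist G z (xs i) \<longleftrightarrow> z \<in> xs ` {1..i}"
  using assms
proof (induction i rule: dec_induct)
  case base
  then show ?case using in_hist_root[OF _ par_first] by simp
next
  case (step i)
  have "{1..Suc i} = insert (Suc i) {1..i}" by auto
  then show ?case using step in_hist_child[OF _ traj_follow[of i]] by auto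
qed

lemma sum_visited:
  fixes f :: "'x \<Rightarrow> real"
  assumes "\<And>x. x \<in> Xs G \<Longrightarrow> xs (dep G x) \<noteq> x \<Longrightarrow> f x = 0"
  shows "(\<Sum>x\<in>Xs G. f x) = (\<Sum>h=1..H. f (xs h))"
proof -
  have "(\<Sum>x\<in>Xs G. f x) = (\<Sum>x\<in>xs ` {1..H}. f x)"
  proof (rule sum.mono_neutral_right)
    show "\<forall>x\<in>Xs G - xs ` {1..H}. f x = 0"
    proof
      fix x assume x: "x \<in> Xs G - xs ` {1..H}"
      then have "xs (dep G x) \<noteq> x" using dep_bounds[of x] by (metis DiffE atLeastAtMost_iff image_eqI)
      then show "f x = 0" using assms x by auto
    qed
  qed auto
  then show ?thesis using sum.reindex[OF inj_xs, of f] by simp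
qed

lemma sum_visited_actions:
  fixes f :: "'x \<Rightarrow> 'a \<Rightarrow> real"
  shows "(\<Sum>x\<in>Xs G. \<Sum>a\<in>act G x. f x a * of_bool (xs (dep G x) = x \<and> as (dep G x) = a))
     = (\<Sum>h=1..H. f (xs h) (as h))"
proof (subst sum_visited)
  show "(\<Sum>h = 1..H. \<Sum>a\<in>act G (xs h). f (xs h) a * of_bool (xs (dep G (xs h)) = xs h \<and> as (dep G (xs h)) = a))
     = (\<Sum>h=1..H. f (xs h) (as h))"
  proof (rule sum.cong[OF refl])
    fix h assume h: "h \<in> {1..H}"
    have "(\<Sum>a\<in>act G (xs h). f (xs h) a * of_bool (xs (dep G (xs h)) = xs h \<and> as (dep G (xs h)) = a))
       = (\<Sum>a\<in>act G (xs h). if a = as h then f (xs h) a else 0)"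
      using h by (intro sum.cong) auto
    then show "(\<Sum>a\<in>act G (xs h). f (xs h) a * of_bool (xs (dep G (xs h)) = xs h \<and> as (dep G (xs h)) = a))
       = f (xs h) (as h)" using h by simp
  qed
qed simp

text \<open>\<open>q_comparator\<close> at the root, where the weight is 1. Unvisited information
  sets have zero drift, so the sum may range over all of \<open>Xs G\<close>, the form that
  telescopes over rounds.\<close>

theorem comparator_bound:
  assumes m: "is_policy G m"
  shows "q 1 = (\<Sum>i=1..H. rat m i * ls i) + (\<Sum>x\<in>Xs G. reach G m x / reach G \<mu>s x * drift m x)"
proof -
  have "(\<Sum>x\<in>Xs G. reach G m x / reach G \<mu>s x * drift m x) = (\<Sum>i=1..H. w m i * drift m (xs i))"
    unfolding w_def by (rule sum_visited) (simp add: drift_def next_mu_eq)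
  then show ?thesis using q_comparator[OF m, of 1] w_first[of m] by (simp add: sum.distrib)
qed

text \<open>\<open>q_lower\<close> and \<open>err_le\<close>; exchanging the two sums over depths
  collects all errors charged to the pair visited at depth \<open>i\<close>. Its history consists of
  \<open>xs 1\<close> to \<open>xs i\<close>, which is the index set in
  \<open>estimation_cost\<close>.\<close>

theorem lower_bound:
  "(\<Sum>i=1..H. rat \<mu> i * ls i) - (\<Sum>i=1..H. cost (xs i) (as i)) \<le> q 1"
proof -
  let ?g = "\<lambda>h i. w \<mu> h * (e (xs h) * real H / 2 *
     (plan_from G \<mu> h (xs i) (as i) / (plan_from G \<mu>s h (xs i) (as i))\<^sup>2))"
  have "(\<Sum>h=1..H. w \<mu> h * err h) \<le> (\<Sum>h=1..H. w \<mu> h * (\<Sum>i=h..H. e (xs h) * real H / 2 *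
     (plan_from G \<mu> h (xs i) (as i) / (plan_from G \<mu>s h (xs i) (as i))\<^sup>2)))"
    using err_le w_nonneg[OF policy_mu] by (intro sum_mono mult_left_mono) auto
  also have "\<dots> = (\<Sum>h\<in>{1..H}. \<Sum>i\<in>{i. i \<in> {1..H} \<and> h \<le> i}. ?g h i)"
  proof (rule sum.cong[OF refl])
    fix h assume h: "h \<in> {1..H}"
    have "{h..H} = {i. i \<in> {1..H} \<and> h \<le> i}" using h by auto
    then show "w \<mu> h * (\<Sum>i=h..H. e (xs h) * real H / 2 *
     (plan_from G \<mu> h (xs i) (as i) / (plan_from G \<mu>s h (xs i) (as i))\<^sup>2)) = (\<Sum>i\<in>{i. i \<in> {1..H} \<and> h \<le> i}. ?g h i)"
      by (simp add: sum_distrib_left)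
  qed
  also have "\<dots> = (\<Sum>i\<in>{1..H}. \<Sum>h\<in>{h. h \<in> {1..H} \<and> h \<le> i}. ?g h i)"
    by (rule sum.swap_restrict) auto
  also have "\<dots> = (\<Sum>i=1..H. cost (xs i) (as i))"
  proof (rule sum.cong[OF refl])
    fix i assume i: "i \<in> {1..H}"
    have 1: "{h. h \<in> {1..H} \<and> h \<le> i} = {1..i}" using i by auto
    have 2: "{x\<in>Xs G. in_hist G x (xs i)} = xs ` {1..i}"
      using i by (auto simp: in_hist_traj)
    have 3: "inj_on xs {1..i}" by (rule inj_on_subset[OF inj_xs]) (use i in auto)
    show "(\<Sum>h\<in>{h. h \<in> {1..H} \<and> h \<le> i}. ?g h i) = cost (xs i) (as i)"
      unfolding estimation_cost_def 1 2 sum.reindex[OF 3] o_def using i by (intro sum.cong) (auto simp: w_def)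
  qed
  finally have "(\<Sum>h=1..H. w \<mu> h * err h) \<le> (\<Sum>i=1..H. cost (xs i) (as i))" .
  then show ?thesis using q_lower[of 1] w_first[of \<mu>] by (simp add: sum_subtractf)
qed

end

section \<open>Second-order terms averaged over the visiting weights\<close>

context omd_policy begin

text \<open>One of the two plan ratios is kept and sums to \<open>kappa_fun\<close>; the other
  cancels \<open>plan G \<mu>s x a\<close>, leaving
  \<open>p x * plan G \<mu> x a \<le> 1\<close>.\<close>

lemma plan_square_flow:
  assumes "flow p" "\<And>x. x \<in> Xs G \<Longrightarrow> p x \<le> 1"
  shows "(\<Sum>x\<in>Xs G. \<Sum>a\<in>act G x. p x * plan G \<mu>s x a * (real (hor G) * (plan G \<mu> x a / plan G \<mu>s x a)\<^sup>2))
     \<le> real (hor G) * kappa G \<mu>s"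
proof -
  have "(\<Sum>x\<in>Xs G. \<Sum>a\<in>act G x. p x * plan G \<mu>s x a * (real (hor G) * (plan G \<mu> x a / plan G \<mu>s x a)\<^sup>2))
     \<le> (\<Sum>x\<in>Xs G. \<Sum>a\<in>act G x. real (hor G) * (plan G \<mu> x a / plan G \<mu>s x a))"
  proof (intro sum_mono)
    fix x a assume x: "x \<in> Xs G" "a \<in> act G x"
    note b = plan_bounds[OF policy_mu x(1), of a] plan_pos[OF pos x]
    have "p x * plan G \<mu>s x a * (real (hor G) * (plan G \<mu> x a / plan G \<mu>s x a)\<^sup>2)
      = real (hor G) * (plan G \<mu> x a / plan G \<mu>s x a) * (p x * plan G \<mu> x a)"
      using b by (simp add: power2_eq_square field_simps)
    also have "\<dots> \<le> real (hor G) * (plan G \<mu> x a / plan G \<mu>s x a) * 1"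
      using b assms x by (intro mult_left_mono mult_le_one) auto
    finally show "p x * plan G \<mu>s x a * (real (hor G) * (plan G \<mu> x a / plan G \<mu>s x a)\<^sup>2)
      \<le> real (hor G) * (plan G \<mu> x a / plan G \<mu>s x a)" by simp
  qed
  also have "\<dots> = real (hor G) * kappa_fun \<mu>" by (simp add: kappa_fun_def sum_distrib_left)
  also have "\<dots> \<le> real (hor G) * kappa G \<mu>s"
    using kappa_fun_le[OF policy_mu] by (intro mult_left_mono) auto
  finally show ?thesis .
qed

text \<open>\<open>plan_split\<close> cancels one factor of the squared sampling plan. Visiting
  weights decrease along histories, so the weight of \<open>x'\<close> may be replaced by that of
  its ancestor \<open>x\<close>; the sum over the subtree of \<open>x\<close> is then at most
  \<open>kappa_at\<close>, which the rate cancels, and \<open>flow_reach_sum\<close> supplies the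
  second factor \<open>H\<close>.\<close>

lemma cost_flow:
  assumes "flow p" and e: "\<And>x. x \<in> Xs G \<Longrightarrow> e x = \<eta> / kappa_at G \<mu>s x" and eta: "0 \<le> \<eta>"
  shows "(\<Sum>x\<in>Xs G. \<Sum>a\<in>act G x. p x * plan G \<mu>s x a * cost x a) \<le> \<eta> * (real (hor G))\<^sup>2 / 2"
proof -
  have p0: "0 \<le> p x" if "x \<in> Xs G" for x using assms(1) that by (auto simp: flow_def)
  let ?K = "\<lambda>x x'. \<Sum>a'\<in>act G x'. plan_from G \<mu> (dep G x) x' a' / plan_from G \<mu>s (dep G x) x' a'"
  let ?c = "\<lambda>x. reach G \<mu> x * (e x * real (hor G) / 2)"
  have c0: "0 \<le> ?c x" if "x \<in> Xs G" for x
    using reach_bounds[OF policy_mu that] e_pos[OF that] by simp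
  have K0: "0 \<le> ?K x x'" if "x' \<in> Xs G" for x x'
    using plan_from_bounds[OF policy_mu that] plan_from_bounds[OF policy_mus that] by (intro sum_nonneg) auto
  have "(\<Sum>x'\<in>Xs G. \<Sum>a'\<in>act G x'. p x' * plan G \<mu>s x' a' * cost x' a')
     = (\<Sum>x'\<in>Xs G. \<Sum>x\<in>{x\<in>Xs G. in_hist G x x'}. p x' * (?c x * ?K x x'))"
  proof (rule sum.cong[OF refl])
    fix x' assume x': "x' \<in> Xs G"
    have "(\<Sum>a'\<in>act G x'. p x' * plan G \<mu>s x' a' * cost x' a')
       = (\<Sum>a'\<in>act G x'. \<Sum>x\<in>{x\<in>Xs G. in_hist G x x'}.
            p x' * (?c x * (plan_from G \<mu> (dep G x) x' a' / plan_from G \<mu>s (dep G x) x' a')))"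
      unfolding estimation_cost_def sum_distrib_left
    proof (intro sum.cong refl)
      fix a' x assume a': "a' \<in> act G x'" and x: "x \<in> {x\<in>Xs G. in_hist G x x'}"
      have "plan G \<mu>s x' a' = reach G \<mu>s x * plan_from G \<mu>s (dep G x) x' a'"
        using plan_split x' x by auto
      moreover have "0 < reach G \<mu>s x" using reach_pos[OF pos] x by auto
      moreover have "0 < plan_from G \<mu>s (dep G x) x' a'" using plan_from_pos[OF pos] x' a' by auto
      ultimately show "p x' * plan G \<mu>s x' a' * (reach G \<mu> x / reach G \<mu>s x *
        (e x * real (hor G) / 2 * (plan_from G \<mu> (dep G x) x' a' / (plan_from G \<mu>s (dep G x) x' a')\<^sup>2)))
        = p x' * (?c x * (plan_from G \<mu> (dep G x) x' a' / plan_from G \<mu>s (dep G x) x' a'))"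
        by (simp add: power2_eq_square)
    qed
    also have "\<dots> = (\<Sum>x\<in>{x\<in>Xs G. in_hist G x x'}. p x' * (?c x * ?K x x'))"
      by (subst sum.swap) (simp add: sum_distrib_left)
    finally show "(\<Sum>a'\<in>act G x'. p x' * plan G \<mu>s x' a' * cost x' a')
       = (\<Sum>x\<in>{x\<in>Xs G. in_hist G x x'}. p x' * (?c x * ?K x x'))" .
  qed
  also have "\<dots> \<le> (\<Sum>x'\<in>Xs G. \<Sum>x\<in>{x\<in>Xs G. in_hist G x x'}. p x * (?c x * ?K x x'))"
  proof (intro sum_mono mult_right_mono)
    fix x' x assume x': "x' \<in> Xs G" and x: "x \<in> {x\<in>Xs G. in_hist G x x'}"
    show "p x' \<le> p x" using flow_mono[OF assms(1) x'] x by simp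
    show "0 \<le> ?c x * ?K x x'" using x x' by (intro mult_nonneg_nonneg[OF c0 K0]) auto
  qed
  also have "\<dots> = (\<Sum>x\<in>Xs G. \<Sum>x'\<in>{x'\<in>Xs G. in_hist G x x'}. p x * (?c x * ?K x x'))"
    by (rule sum.swap_restrict) auto
  also have "\<dots> = (\<Sum>x\<in>Xs G. p x * (?c x * kappa_at_fun x \<mu>))"
    by (simp add: kappa_at_fun_def sum_distrib_left)
  also have "\<dots> \<le> (\<Sum>x\<in>Xs G. p x * (?c x * kappa_at G \<mu>s x))"
    using kappa_at_fun_le[OF policy_mu] c0 p0 by (intro sum_mono mult_left_mono) auto
  also have "\<dots> = (\<Sum>x\<in>Xs G. \<eta> * real (hor G) / 2 * (p x * reach G \<mu> x))"
  proof (rule sum.cong[OF refl])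
    fix x assume x: "x \<in> Xs G"
    show "p x * (?c x * kappa_at G \<mu>s x) = \<eta> * real (hor G) / 2 * (p x * reach G \<mu> x)"
      using kappa_at_pos[OF x] by (simp add: e[OF x])
  qed
  also have "\<dots> = \<eta> * real (hor G) / 2 * (\<Sum>x\<in>Xs G. p x * reach G \<mu> x)"
    by (simp add: sum_distrib_left)
  also have "\<dots> \<le> \<eta> * real (hor G) / 2 * real (hor G)"
    using flow_reach_sum[OF assms(1) policy_mu] eta by (intro mult_left_mono) auto
  finally show ?thesis by (simp add: power2_eq_square)
qed

end

subsection \<open>Bounded conditional expectations and an exponential supermartingale\<close>

definition bmeas :: "'w measure \<Rightarrow> ('w \<Rightarrow> real) \<Rightarrow> bool" where
  "bmeas M f \<longleftrightarrow> f \<in> borel_measurable M \<and> (\<exists>B. \<forall>x\<in>space M. \<bar>f x\<bar> \<le> B)"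

lemma bmeasI: "f \<in> borel_measurable M \<Longrightarrow> (\<And>x. x \<in> space M \<Longrightarrow> \<bar>f x\<bar> \<le> B) \<Longrightarrow> bmeas M f"
  by (auto simp: bmeas_def)

lemma bmeas_measurable: "bmeas M f \<Longrightarrow> f \<in> borel_measurable M"
  by (simp add: bmeas_def)

lemma bmeas_const [intro]: "bmeas M (\<lambda>x. c)"
  by (rule bmeasI[where B = "\<bar>c\<bar>"]) auto

lemma bmeas_add [intro]:
  assumes "bmeas M f" "bmeas M g"
  shows "bmeas M (\<lambda>x. f x + g x)"
proof -
  obtain A B where AB: "\<And>x. x \<in> space M \<Longrightarrow> \<bar>f x\<bar> \<le> A" "\<And>x. x \<in> space M \<Longrightarrow> \<bar>g x\<bar> \<le> B"
    using assms by (auto simp: bmeas_def)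
  note [measurable] = assms[THEN bmeas_measurable]
  show ?thesis
  proof (rule bmeasI[where B = "A + B"])
    show "\<bar>f x + g x\<bar> \<le> A + B" if "x \<in> space M" for x
      using AB[OF that] by linarith
  qed measurable
qed

lemma bmeas_mult [intro]:
  assumes "bmeas M f" "bmeas M g"
  shows "bmeas M (\<lambda>x. f x * g x)"
proof -
  obtain A B where AB: "\<And>x. x \<in> space M \<Longrightarrow> \<bar>f x\<bar> \<le> A" "\<And>x. x \<in> space M \<Longrightarrow> \<bar>g x\<bar> \<le> B"
    using assms by (auto simp: bmeas_def)
  note [measurable] = assms[THEN bmeas_measurable]
  show ?thesis
  proof (rule bmeasI[where B = "A * B"])
    show "\<bar>f x * g x\<bar> \<le> A * B" if "x \<in> space M" for x
      unfolding abs_mult using AB[OF that] by (intro mult_mono) (auto intro: order_trans[OF abs_ge_zero])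
  qed measurable
qed

lemma bmeas_uminus [intro]: "bmeas M f \<Longrightarrow> bmeas M (\<lambda>x. - f x)"
  using bmeas_mult[OF bmeas_const[of M "- 1"]] by simp

lemma bmeas_diff [intro]: "bmeas M f \<Longrightarrow> bmeas M g \<Longrightarrow> bmeas M (\<lambda>x. f x - g x)"
  using bmeas_add[OF _ bmeas_uminus] by simp

lemma bmeas_divide_const [intro]: "bmeas M f \<Longrightarrow> bmeas M (\<lambda>x. f x / c)"
  using bmeas_mult[OF _ bmeas_const[of M "1 / c"]] by simp

lemma bmeas_power [intro]: "bmeas M f \<Longrightarrow> bmeas M (\<lambda>x. f x ^ n)"
  by (induction n) auto

lemma bmeas_sum [intro]: "(\<And>i. i \<in> I \<Longrightarrow> bmeas M (f i)) \<Longrightarrow> bmeas M (\<lambda>x. \<Sum>i\<in>I. f i x)"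
  by (induction I rule: infinite_finite_induct) auto

lemma bmeas_prod [intro]: "(\<And>i. i \<in> I \<Longrightarrow> bmeas M (f i)) \<Longrightarrow> bmeas M (\<lambda>x. \<Prod>i\<in>I. f i x)"
  by (induction I rule: infinite_finite_induct) auto

lemma bmeas_exp [intro]:
  assumes "bmeas M f"
  shows "bmeas M (\<lambda>x. exp (f x))"
proof -
  obtain A where A: "\<And>x. x \<in> space M \<Longrightarrow> \<bar>f x\<bar> \<le> A" using assms by (auto simp: bmeas_def)
  note [measurable] = assms[THEN bmeas_measurable]
  show ?thesis
  proof (rule bmeasI[where B = "exp A"])
    show "\<bar>exp (f x)\<bar> \<le> exp A" if "x \<in> space M" for x
      using A[OF that] by simp
  qed measurable
qed

lemma bmeas_mono:
  assumes "bmeas N f" "space N = space M" "sets N \<subseteq> sets M"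
  shows "bmeas M f"
proof -
  have "borel_measurable N \<subseteq> (borel_measurable M :: ('a \<Rightarrow> real) set)"
    using assms by (intro measurable_mono) auto
  then show ?thesis using assms by (auto simp: bmeas_def)
qed

lemma bmeas_subalgebra: "bmeas N f \<Longrightarrow> subalgebra M N \<Longrightarrow> bmeas M f"
  using bmeas_mono[of N f M] by (simp add: subalgebra_def)

lemma (in finite_measure) bmeas_integrable:
  assumes "bmeas M f"
  shows "integrable M f"
proof -
  obtain B where "\<And>x. x \<in> space M \<Longrightarrow> \<bar>f x\<bar> \<le> B" using assms by (auto simp: bmeas_def)
  then show ?thesis using assms bmeas_measurable by (intro integrable_const_bound[where B = B]) auto
qed

text \<open>\<open>g\<close> is a bounded version of the conditional expectation of \<open>V\<close> given \<open>N\<close>.\<close>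
definition cond_rep :: "'w measure \<Rightarrow> 'w measure \<Rightarrow> ('w \<Rightarrow> real) \<Rightarrow> ('w \<Rightarrow> real) \<Rightarrow> bool" where
  "cond_rep M N V g \<longleftrightarrow> bmeas M V \<and> bmeas N g \<and> (AE x in M. real_cond_exp M N V x = g x)"

context finite_measure_subalgebra
begin

lemma cond_repI:
  assumes "bmeas M V" "bmeas F g"
    and "\<And>B. B \<in> sets F \<Longrightarrow> (\<integral>x. indicator B x * V x \<partial>M) = (\<integral>x. indicator B x * g x \<partial>M)"
  shows "cond_rep M F V g"
  unfolding cond_rep_def
proof (intro conjI)
  show "AE x in M. real_cond_exp M F V x = g x"
    using assms bmeas_integrable[OF assms(1)] bmeas_integrable[OF bmeas_subalgebra[OF assms(2) subalg]]
    by (intro real_cond_exp_charact) (auto simp: set_lebesgue_integral_def bmeas_measurable)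
qed (use assms in auto)

lemma cond_rep_self: "bmeas F f \<Longrightarrow> cond_rep M F f f"
  using bmeas_subalgebra[OF _ subalg] by (intro cond_repI) auto

lemma cond_rep_add:
  assumes "cond_rep M F V g" "cond_rep M F V' g'"
  shows "cond_rep M F (\<lambda>x. V x + V' x) (\<lambda>x. g x + g' x)"
proof -
  have "AE x in M. real_cond_exp M F (\<lambda>x. V x + V' x) x = real_cond_exp M F V x + real_cond_exp M F V' x"
    using assms by (intro real_cond_exp_add) (auto simp: cond_rep_def bmeas_integrable)
  then have "AE x in M. real_cond_exp M F (\<lambda>x. V x + V' x) x = g x + g' x"
    using assms unfolding cond_rep_def by (elim conjE) (auto elim: AE_mp)
  then show ?thesis using assms by (auto simp: cond_rep_def)
qed

lemma cond_rep_mult: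
  assumes "bmeas F f" "cond_rep M F V g"
  shows "cond_rep M F (\<lambda>x. f x * V x) (\<lambda>x. f x * g x)"
proof -
  have fV: "bmeas M (\<lambda>x. f x * V x)"
    using assms bmeas_subalgebra[OF _ subalg] by (auto simp: cond_rep_def)
  have "AE x in M. real_cond_exp M F (\<lambda>x. f x * V x) x = f x * real_cond_exp M F V x"
    using assms bmeas_integrable[OF fV]
    by (intro real_cond_exp_mult) (auto simp: cond_rep_def bmeas_measurable bmeas_integrable)
  then have "AE x in M. real_cond_exp M F (\<lambda>x. f x * V x) x = f x * g x"
    using assms unfolding cond_rep_def by (elim conjE) (auto elim: AE_mp)
  then show ?thesis using assms fV by (auto simp: cond_rep_def)
qed

lemma cond_rep_sum:
  assumes "\<And>i. i \<in> I \<Longrightarrow> cond_rep M F (V i) (g i)"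
  shows "cond_rep M F (\<lambda>x. \<Sum>i\<in>I. V i x) (\<lambda>x. \<Sum>i\<in>I. g i x)"
  using assms
  by (induction I rule: infinite_finite_induct) (auto intro: cond_rep_self cond_rep_add)

lemma cond_rep_mono:
  assumes "cond_rep M F V g" "cond_rep M F V' g'" "\<And>x. x \<in> space M \<Longrightarrow> V x \<le> V' x"
  shows "AE x in M. g x \<le> g' x"
proof -
  have "AE x in M. real_cond_exp M F V x \<le> real_cond_exp M F V' x"
    using assms by (intro real_cond_exp_mono) (auto simp: cond_rep_def bmeas_integrable)
  then show ?thesis using assms(1,2) unfolding cond_rep_def by (elim conjE) (auto elim: AE_mp)
qed

lemma cond_rep_integral:
  assumes "cond_rep M F V g"
  shows "(\<integral>x. V x \<partial>M) = (\<integral>x. g x \<partial>M)"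
proof -
  have "(\<integral>x. V x \<partial>M) = (\<integral>x. real_cond_exp M F V x \<partial>M)"
    using assms by (intro real_cond_exp_int(2)[symmetric]) (auto simp: cond_rep_def bmeas_integrable)
  also have "\<dots> = (\<integral>x. g x \<partial>M)"
    using assms measurable_from_subalg[OF subalg bmeas_measurable[of F g]]
    by (intro integral_cong_AE) (auto simp: cond_rep_def)
  finally show ?thesis .
qed

text \<open>The one-step supermartingale inequality with past-measurable \<open>W\<close>. The
  majorant \<open>V\<close> stands in for \<open>Z\<close>, so only conditional means of
  \<open>V\<close> have to be known.\<close>

lemma cond_rep_le_one_integral:
  assumes W: "bmeas F W" "\<And>x. x \<in> space M \<Longrightarrow> 0 \<le> W x"
    and Z: "bmeas M Z" and ZV: "\<And>x. x \<in> space M \<Longrightarrow> Z x \<le> V x"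
    and V: "cond_rep M F V g" and g: "AE x in M. g x \<le> 1"
  shows "(\<integral>x. W x * Z x \<partial>M) \<le> (\<integral>x. W x \<partial>M)"
proof -
  note WM = bmeas_subalgebra[OF W(1) subalg]
  have VM: "bmeas M V" and gF: "bmeas F g" using V by (auto simp: cond_rep_def)
  note gM = bmeas_subalgebra[OF gF subalg]
  have "(\<integral>x. W x * Z x \<partial>M) \<le> (\<integral>x. W x * V x \<partial>M)"
    using W ZV WM Z VM by (intro integral_mono bmeas_integrable mult_left_mono) auto
  also have "\<dots> = (\<integral>x. W x * g x \<partial>M)"
    by (rule cond_rep_integral[OF cond_rep_mult[OF W(1) V]])
  also have "\<dots> \<le> (\<integral>x. W x \<partial>M)"
  proof (rule integral_mono_AE)
    show "AE x in M. W x * g x \<le> W x"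
      using g AE_space
    proof eventually_elim
      case (elim x)
      then show ?case using mult_left_mono[of "g x" 1 "W x"] W(2)[of x] by simp
    qed
  qed (use WM gM in \<open>auto intro: bmeas_integrable\<close>)
  finally show ?thesis .
qed

end

text \<open>The products of the factors \<open>exp (Y t \<omega>)\<close> have mean at most 1 by
  induction on the number of rounds; Markov's inequality at level \<open>exp s\<close> gives the
  tail.\<close>

lemma (in prob_space) exp_supermartingale_tail:
  fixes F :: "nat \<Rightarrow> 'a measure" and Y :: "nat \<Rightarrow> 'a \<Rightarrow> real"
  assumes sub: "\<And>t. subalgebra M (F t)"
    and mono: "\<And>s t. s \<le> t \<Longrightarrow> sets (F s) \<subseteq> sets (F t)"
    and Y: "\<And>t. t \<in> {1..n} \<Longrightarrow> bmeas (F t) (\<lambda>\<omega>. exp (Y t \<omega>))"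
    and cond: "\<And>t. t \<in> {1..n} \<Longrightarrow> \<exists>V g. cond_rep M (F (t - 1)) V g \<and>
        (\<forall>\<omega>\<in>space M. exp (Y t \<omega>) \<le> V \<omega>) \<and> (AE \<omega> in M. g \<omega> \<le> 1)"
  shows "{\<omega> \<in> space M. s \<le> (\<Sum>t=1..n. Y t \<omega>)} \<in> sets M \<and>
    prob {\<omega> \<in> space M. s \<le> (\<Sum>t=1..n. Y t \<omega>)} \<le> exp (- s)"
proof -
  let ?W = "\<lambda>k \<omega>. \<Prod>t=1..k. exp (Y t \<omega>)"
  have sp: "space (F t) = space M" for t using sub[of t] by (simp add: subalgebra_def)
  have W: "bmeas (F k) (?W k)" if "k \<le> n" for k
  proof (rule bmeas_prod)
    fix t assume t: "t \<in> {1..k}"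
    show "bmeas (F k) (\<lambda>\<omega>. exp (Y t \<omega>))"
      by (rule bmeas_mono[OF Y]) (use t that sp mono in auto)
  qed
  have E: "(\<integral>\<omega>. ?W k \<omega> \<partial>M) \<le> 1" if "k \<le> n" for k
    using that
  proof (induction k)
    case 0
    then show ?case by (simp add: prob_space)
  next
    case (Suc k)
    then have k: "Suc k \<in> {1..n}" by auto
    obtain V g where V: "cond_rep M (F k) V g" "\<And>\<omega>. \<omega> \<in> space M \<Longrightarrow> exp (Y (Suc k) \<omega>) \<le> V \<omega>"
        "AE \<omega> in M. g \<omega> \<le> 1" using cond[OF k] by auto
    interpret finite_measure_subalgebra M "F k"
      by unfold_locales (rule sub)
    have "(\<integral>\<omega>. ?W k \<omega> * exp (Y (Suc k) \<omega>) \<partial>M) \<le> (\<integral>\<omega>. ?W k \<omega> \<partial>M)"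
      using W[of k] Suc.prems V bmeas_subalgebra[OF Y[OF k] sub]
      by (intro cond_rep_le_one_integral[where V = V and g = g] prod_nonneg) auto
    then show ?case using Suc by simp
  qed
  have WM: "bmeas M (?W n)" using bmeas_subalgebra[OF W sub] by simp
  have eq: "{\<omega> \<in> space M. s \<le> (\<Sum>t=1..n. Y t \<omega>)} = {\<omega> \<in> space M. exp s \<le> ?W n \<omega>}"
    by (auto simp: exp_sum[symmetric])
  have [measurable]: "?W n \<in> borel_measurable M" using bmeas_measurable[OF WM] .
  have mem: "{\<omega> \<in> space M. s \<le> (\<Sum>t=1..n. Y t \<omega>)} \<in> sets M" unfolding eq by measurable
  have "prob {\<omega> \<in> space M. exp s \<le> ?W n \<omega>} \<le> (\<integral>\<omega>. ?W n \<omega> \<partial>M) / exp s"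
    using bmeas_integrable[OF WM]
    by (intro integral_Markov_inequality_measure[where A = "space M"]) (auto intro!: prod_nonneg)
  also have "\<dots> \<le> 1 / exp s" using E[of n] by (intro divide_right_mono) auto
  finally have "prob {\<omega> \<in> space M. s \<le> (\<Sum>t=1..n. Y t \<omega>)} \<le> exp (- s)"
    unfolding eq by (simp add: exp_minus inverse_eq_divide)
  with mem show ?thesis by blast
qed

subsection \<open>The learning protocol\<close>

text \<open>The parameter \<eta> is an arbitrary positive number here; its tuned value enters in
  \<open>high_probability_regret\<close>.\<close>

locale learning = sampled_game G \<mu>s + prob_space M
  for G :: "('x, 'a) game" and \<mu>s :: "'x \<Rightarrow> 'a \<Rightarrow> real" and M :: "'w measure" +
  fixes F :: "nat \<Rightarrow> 'w measure" and T :: nat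
    and XR :: "nat \<Rightarrow> nat \<Rightarrow> 'w \<Rightarrow> 'x" and AR :: "nat \<Rightarrow> nat \<Rightarrow> 'w \<Rightarrow> 'a"
    and LR :: "nat \<Rightarrow> nat \<Rightarrow> 'w \<Rightarrow> real"
    and P :: "nat \<Rightarrow> 'w \<Rightarrow> 'x \<Rightarrow> real" and Lh :: "nat \<Rightarrow> 'w \<Rightarrow> 'x \<Rightarrow> 'a \<Rightarrow> real"
    and \<eta> :: real
  assumes eta_pos: "0 < \<eta>"
    and filt_sub: "\<And>t. subalgebra M (F t)"
    and filt_mono: "\<And>s t. s \<le> t \<Longrightarrow> sets (F s) \<subseteq> sets (F t)"
    and P_meas: "\<And>t x. t \<in> {1..T} \<Longrightarrow> x \<in> Xs G \<Longrightarrow> (\<lambda>\<omega>. P t \<omega> x) \<in> borel_measurable (F (t - 1))"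
    and Lh_meas: "\<And>t x a. t \<in> {1..T} \<Longrightarrow> x \<in> Xs G \<Longrightarrow> a \<in> act G x \<Longrightarrow>
                    (\<lambda>\<omega>. Lh t \<omega> x a) \<in> borel_measurable (F (t - 1))"
    and P_range: "\<And>t \<omega> x. t \<in> {1..T} \<Longrightarrow> \<omega> \<in> space M \<Longrightarrow> x \<in> Xs G \<Longrightarrow> 0 \<le> P t \<omega> x \<and> P t \<omega> x \<le> 1"
    and Lh_range: "\<And>t \<omega> x a. t \<in> {1..T} \<Longrightarrow> \<omega> \<in> space M \<Longrightarrow> x \<in> Xs G \<Longrightarrow> a \<in> act G x \<Longrightarrow>
                    0 \<le> Lh t \<omega> x a \<and> Lh t \<omega> x a \<le> 1"
    and XR_meas: "\<And>t h. t \<in> {1..T} \<Longrightarrow> h \<in> {1..hor G} \<Longrightarrow> XR t h \<in> measurable (F t) (count_space UNIV)"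
    and AR_meas: "\<And>t h. t \<in> {1..T} \<Longrightarrow> h \<in> {1..hor G} \<Longrightarrow> AR t h \<in> measurable (F t) (count_space UNIV)"
    and LR_meas: "\<And>t h. t \<in> {1..T} \<Longrightarrow> h \<in> {1..hor G} \<Longrightarrow> LR t h \<in> borel_measurable (F t)"
    and traj: "\<And>t h \<omega>. t \<in> {1..T} \<Longrightarrow> h \<in> {1..hor G} \<Longrightarrow> \<omega> \<in> space M \<Longrightarrow>
                 XR t h \<omega> \<in> Xs G \<and> dep G (XR t h \<omega>) = h \<and> AR t h \<omega> \<in> act G (XR t h \<omega>)
                 \<and> 0 \<le> LR t h \<omega> \<and> LR t h \<omega> \<le> 1"
    and traj_follow: "\<And>t h \<omega>. t \<in> {1..T} \<Longrightarrow> 1 \<le> h \<Longrightarrow> h < hor G \<Longrightarrow> \<omega> \<in> space M \<Longrightarrow>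
                 par G (XR t (Suc h) \<omega>) = Some (XR t h \<omega>, AR t h \<omega>)"
    and visit: "\<And>t B x a. t \<in> {1..T} \<Longrightarrow> B \<in> sets (F (t - 1)) \<Longrightarrow> x \<in> Xs G \<Longrightarrow> a \<in> act G x \<Longrightarrow>
                 measure M (B \<inter> {\<omega> \<in> space M. XR t (dep G x) \<omega> = x \<and> AR t (dep G x) \<omega> = a})
                   = (\<integral>\<omega>. indicator B \<omega> * (P t \<omega> x * plan G \<mu>s x a) \<partial>M)"
    and loss: "\<And>t B x a. t \<in> {1..T} \<Longrightarrow> B \<in> sets (F (t - 1)) \<Longrightarrow> x \<in> Xs G \<Longrightarrow> a \<in> act G x \<Longrightarrow>
                 (\<integral>\<omega>. indicator B \<omega> * (LR t (dep G x) \<omega> *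
                       indicator {\<omega>. XR t (dep G x) \<omega> = x \<and> AR t (dep G x) \<omega> = a} \<omega>) \<partial>M)
                   = (\<integral>\<omega>. indicator B \<omega> * (P t \<omega> x * plan G \<mu>s x a * Lh t \<omega> x a) \<partial>M)"
begin

definition rate :: "'x \<Rightarrow> real" where
  "rate x = \<eta> / kappa_at G \<mu>s x"

definition pol :: "nat \<Rightarrow> 'w \<Rightarrow> 'x \<Rightarrow> 'a \<Rightarrow> real" where
  "pol t \<omega> = localomd G \<mu>s (\<lambda>t. rate) (uniform_policy G)
     (\<lambda>t h. XR t h \<omega>) (\<lambda>t h. AR t h \<omega>) (\<lambda>t h. LR t h \<omega>) t"

definition vis :: "nat \<Rightarrow> 'x \<Rightarrow> 'a \<Rightarrow> 'w \<Rightarrow> real" where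
  "vis t x a \<omega> = of_bool (XR t (dep G x) \<omega> = x \<and> AR t (dep G x) \<omega> = a)"

definition qt :: "nat \<Rightarrow> 'w \<Rightarrow> nat \<Rightarrow> real" where
  "qt t \<omega> h = omd_q G \<mu>s (\<lambda>t. rate) (uniform_policy G) t (pol t \<omega>)
     (\<lambda>h. XR t h \<omega>) (\<lambda>h. AR t h \<omega>) (\<lambda>h. LR t h \<omega>) (Suc H - h)"

lemma space_F [simp]: "space (F t) = space M"
  using filt_sub[of t] by (simp add: subalgebra_def)

lemma rate_pos: "x \<in> Xs G \<Longrightarrow> 0 < rate x"
  using kappa_at_pos eta_pos by (simp add: rate_def)

lemma uniform_positive: "positive_policy G (uniform_policy G)"
proof -
  have "0 < card (act G x)" if "x \<in> Xs G" for x
    using that act_nonempty by (simp add: card_gt_0_iff)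
  then show ?thesis
    by (auto simp: positive_policy_def is_policy_def act_simplex_def uniform_policy_def act_nonempty)
qed

lemma pol_1: "pol (Suc 0) \<omega> = uniform_policy G"
  by (simp add: pol_def)

lemma pol_Suc:
  "1 \<le> t \<Longrightarrow> pol (Suc t) \<omega> = omd_next G \<mu>s (\<lambda>t. rate) (uniform_policy G) t
     (\<lambda>h. XR t h \<omega>) (\<lambda>h. AR t h \<omega>) (\<lambda>h. LR t h \<omega>) (pol t \<omega>)"
  by (simp add: pol_def)

lemma episodeI:
  assumes "positive_policy G (pol t \<omega>)" "t \<in> {1..T}" "\<omega> \<in> space M"
  shows "episode G \<mu>s rate (pol t \<omega>) (\<lambda>h. XR t h \<omega>) (\<lambda>h. AR t h \<omega>) (\<lambda>h. LR t h \<omega>)"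
  using assms rate_pos traj traj_follow by unfold_locales auto

lemma pol_positive:
  assumes "1 \<le> t" "t \<le> Suc T" "\<omega> \<in> space M"
  shows "positive_policy G (pol t \<omega>)"
  using assms(1,2)
proof (induction t rule: dec_induct)
  case base
  then show ?case using uniform_positive by (simp add: pol_1)
next
  case (step t)
  then have t: "t \<in> {1..T}" by auto
  interpret episode G \<mu>s rate "pol t \<omega>" "\<lambda>h. XR t h \<omega>" "\<lambda>h. AR t h \<omega>" "\<lambda>h. LR t h \<omega>" t "uniform_policy G"
    using step t assms(3) by (intro episodeI) auto
  show ?case using next_mu_positive step by (simp add: next_mu_def pol_Suc)
qed

lemma episode:
  assumes "t \<in> {1..T}" "\<omega> \<in> space M"
  shows "episode G \<mu>s rate (pol t \<omega>) (\<lambda>h. XR t h \<omega>) (\<lambda>h. AR t h \<omega>) (\<lambda>h. LR t h \<omega>)"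
  using assms pol_positive by (intro episodeI) auto

lemma qt_end: "qt t \<omega> (Suc H) = 0"
  by (simp add: qt_def)

text \<open>The same function as \<open>lt\<close> of the episode. With the argument
  \<open>a\<close> in place of the sampled action in the denominator, each coordinate is visibly
  measurable in \<omega>.\<close>

definition ltw :: "nat \<Rightarrow> 'w \<Rightarrow> nat \<Rightarrow> 'a \<Rightarrow> real" where
  "ltw t \<omega> h a = (if AR t h \<omega> = a then (LR t h \<omega> + qt t \<omega> (Suc h)) / \<mu>s (XR t h \<omega>) a else 0)"

lemma qt_eq:
  assumes "t \<in> {1..T}" "\<omega> \<in> space M" "1 \<le> h" "h \<le> H"
  shows "qt t \<omega> h = entropic_value (act G (XR t h \<omega>)) (rate (XR t h \<omega>)) (ltw t \<omega> h) (pol t \<omega> (XR t h \<omega>))"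
proof -
  interpret episode G \<mu>s rate "pol t \<omega>" "\<lambda>h. XR t h \<omega>" "\<lambda>h. AR t h \<omega>" "\<lambda>h. LR t h \<omega>" t "uniform_policy G"
    by (rule episode[OF assms(1,2)])
  have "lt h = ltw t \<omega> h"
    by (auto simp: lt_def omd_lt_def ltw_def q_def qt_def)
  then show ?thesis using q_eq[OF assms(3,4)] by (simp add: q_def qt_def)
qed

lemma pol_Suc_eq:
  assumes "t \<in> {1..T}" "\<omega> \<in> space M" "x \<in> Xs G"
  shows "pol (Suc t) \<omega> x a = (if XR t (dep G x) \<omega> = x
     then entropic_step (act G x) (rate x) (ltw t \<omega> (dep G x)) (pol t \<omega> x) a else pol t \<omega> x a)"
proof -
  interpret episode G \<mu>s rate "pol t \<omega>" "\<lambda>h. XR t h \<omega>" "\<lambda>h. AR t h \<omega>" "\<lambda>h. LR t h \<omega>" t "uniform_policy G"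
    by (rule episode[OF assms(1,2)])
  have "lt h = ltw t \<omega> h" for h
    by (auto simp: lt_def omd_lt_def ltw_def q_def qt_def)
  then show ?thesis using next_mu_eq[of x] assms by (auto simp: next_mu_def pol_Suc)
qed

section \<open>Measurability and predictability of the iterates\<close>

lemma measurable_Suc_F:
  assumes "f \<in> borel_measurable (F (t - 1))"
  shows "f \<in> borel_measurable (F t)"
proof -
  have "borel_measurable (F (t - 1)) \<subseteq> borel_measurable (F t)"
    using filt_mono[of "t - 1" t] by (intro measurable_mono) auto
  then show ?thesis using assms by auto
qed

lemma XR_meas_Xs:
  assumes "t \<in> {1..T}" "h \<in> {1..H}"
  shows "XR t h \<in> measurable (F t) (count_space (Xs G))"
proof (rule measurableI)
  fix A
  have "XR t h -` A \<inter> space (F t) \<in> sets (F t)"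
    by (rule measurable_sets[OF XR_meas[OF assms]]) simp
  then show "XR t h -` A \<inter> space (F t) \<in> sets (F t)" .
qed (use traj[OF assms] in auto)

text \<open>Backward induction on the depth. The closed form depends on the random information set
  \<open>XR t h \<omega>\<close>, which takes finitely many values, so measurability is checked for
  each fixed \<open>x\<close>.\<close>

lemma qt_measurable:
  assumes t: "t \<in> {1..T}" and h: "1 \<le> h" "h \<le> Suc H"
    and pol: "\<And>x a. x \<in> Xs G \<Longrightarrow> (\<lambda>\<omega>. pol t \<omega> x a) \<in> borel_measurable (F t)"
  shows "(\<lambda>\<omega>. qt t \<omega> h) \<in> borel_measurable (F t) \<and> (h \<le> H \<longrightarrow> (\<lambda>\<omega>. ltw t \<omega> h a) \<in> borel_measurable (F t))"
  using h(2,1)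
proof (induction h arbitrary: a rule: inc_induct)
  case base
  then show ?case by (simp add: qt_end)
next
  case (step h)
  then have h: "h \<in> {1..H}" by auto
  note [measurable] = LR_meas[OF t h] XR_meas[OF t h] AR_meas[OF t h]
  have [measurable]: "(\<lambda>\<omega>. qt t \<omega> (Suc h)) \<in> borel_measurable (F t)" using step by auto
  have [measurable]: "(\<lambda>\<omega>. \<mu>s (XR t h \<omega>) a) \<in> borel_measurable (F t)" for a
    by (rule measurable_compose[OF XR_meas[OF t h]]) simp
  have lt: "(\<lambda>\<omega>. ltw t \<omega> h a) \<in> borel_measurable (F t)" for a
    unfolding ltw_def by measurable
  have "(\<lambda>\<omega>. entropic_value (act G (XR t h \<omega>)) (rate (XR t h \<omega>)) (ltw t \<omega> h) (pol t \<omega> (XR t h \<omega>)))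
      \<in> borel_measurable (F t)"
  proof (rule measurable_compose_countable'[OF _ XR_meas_Xs[OF t h]])
    fix x assume x: "x \<in> Xs G"
    note [measurable] = lt pol[OF x]
    show "(\<lambda>\<omega>. entropic_value (act G x) (rate x) (ltw t \<omega> h) (pol t \<omega> x)) \<in> borel_measurable (F t)"
      unfolding entropic_value_def by measurable
  qed (simp add: countable_finite)
  then have "(\<lambda>\<omega>. qt t \<omega> h) \<in> borel_measurable (F t)"
    by (subst measurable_cong[OF qt_eq]) (use t h in auto)
  then show ?case using lt by auto
qed

text \<open>Predictability: the policy of a round is built from earlier trajectories only. Induction
  over rounds with the closed form \<open>pol_Suc_eq\<close>; the first policy is
  deterministic.\<close>

lemma pol_measurable:
  assumes "1 \<le> t" "t \<le> Suc T" "x \<in> Xs G"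
  shows "(\<lambda>\<omega>. pol t \<omega> x a) \<in> borel_measurable (F (t - 1))"
  using assms
proof (induction t arbitrary: x a rule: dec_induct)
  case base
  then show ?case by (simp add: pol_1)
next
  case (step t)
  then have t: "t \<in> {1..T}" by auto
  have x: "dep G x \<in> {1..H}" using dep_bounds step by auto
  have pol: "(\<lambda>\<omega>. pol t \<omega> x a) \<in> borel_measurable (F t)" if "x \<in> Xs G" for x a
    by (rule measurable_Suc_F, rule step.IH) (use step.prems that in auto)
  note [measurable] = pol[OF step.prems(2)] XR_meas[OF t x]
  have [measurable]: "(\<lambda>\<omega>. ltw t \<omega> (dep G x) a) \<in> borel_measurable (F t)" for a
    using qt_measurable[OF t _ _ pol, of "dep G x"] x by auto
  have "(\<lambda>\<omega>. if XR t (dep G x) \<omega> = x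
     then entropic_step (act G x) (rate x) (ltw t \<omega> (dep G x)) (pol t \<omega> x) a else pol t \<omega> x a)
     \<in> borel_measurable (F t)"
    unfolding entropic_step_def by measurable
  then have "(\<lambda>\<omega>. pol (Suc t) \<omega> x a) \<in> borel_measurable (F t)"
    by (subst measurable_cong[OF pol_Suc_eq]) (use t step in auto)
  then show ?case by simp
qed

lemma qt1_measurable:
  assumes "t \<in> {1..T}"
  shows "(\<lambda>\<omega>. qt t \<omega> 1) \<in> borel_measurable (F t)"
  using qt_measurable[OF assms, of 1] pol_measurable[THEN measurable_Suc_F, of t] assms hor_pos by auto

lemma pol_policy: "t \<in> {1..T} \<Longrightarrow> \<omega> \<in> space M \<Longrightarrow> is_policy G (pol t \<omega>)"
  using pol_positive[of t \<omega>] by (auto simp: positive_policy_def)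

lemma pol_bmeas:
  assumes "t \<in> {1..T}" "x \<in> Xs G"
  shows "bmeas (F (t - 1)) (\<lambda>\<omega>. pol t \<omega> x a)"
  using assms pol_measurable[of t x a] policy_nonneg[OF pol_policy] policy_le_1[OF pol_policy]
  by (intro bmeasI[where B = 1]) auto

lemma reach_bmeas:
  assumes "t \<in> {1..T}" "x \<in> Xs G"
  shows "bmeas (F (t - 1)) (\<lambda>\<omega>. reach G (pol t \<omega>) x)"
  using assms(2)
  by (induction x rule: tree_induct)
     (auto simp: reach_root reach_child plan_eq simp del: One_nat_def intro!: pol_bmeas[OF assms(1)])

lemma plan_bmeas:
  assumes "t \<in> {1..T}" "x \<in> Xs G"
  shows "bmeas (F (t - 1)) (\<lambda>\<omega>. plan G (pol t \<omega>) x a)"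
  unfolding plan_eq using reach_bmeas[OF assms] pol_bmeas[OF assms] by auto

lemma plan_from_bmeas:
  assumes "t \<in> {1..T}" "x \<in> Xs G"
  shows "bmeas (F (t - 1)) (\<lambda>\<omega>. plan_from G (pol t \<omega>) h x a)"
  using assms(2)
proof (induction x arbitrary: a rule: tree_induct)
  case (root x)
  then show ?case by (simp add: plan_from_def hist_root pol_bmeas[OF assms(1)] del: One_nat_def)
next
  case (child x y b)
  then show ?case
    by (cases "h \<le> dep G y")
       (auto simp: plan_from_child plan_from_base simp del: One_nat_def intro!: pol_bmeas[OF assms(1)])
qed

lemma P_bmeas: "t \<in> {1..T} \<Longrightarrow> x \<in> Xs G \<Longrightarrow> bmeas (F (t - 1)) (\<lambda>\<omega>. P t \<omega> x)"
  using P_meas P_range by (intro bmeasI[where B = 1]) auto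

lemma Lh_bmeas: "t \<in> {1..T} \<Longrightarrow> x \<in> Xs G \<Longrightarrow> a \<in> act G x \<Longrightarrow> bmeas (F (t - 1)) (\<lambda>\<omega>. Lh t \<omega> x a)"
  using Lh_meas Lh_range by (intro bmeasI[where B = 1]) auto

lemma vis_bmeas:
  assumes "t \<in> {1..T}" "x \<in> Xs G"
  shows "bmeas (F t) (vis t x a)"
proof -
  have h: "dep G x \<in> {1..H}" using dep_bounds assms by auto
  note [measurable] = XR_meas[OF assms(1) h] AR_meas[OF assms(1) h]
  have "vis t x a \<in> borel_measurable (F t)" unfolding vis_def by measurable
  then show ?thesis by (rule bmeasI[where B = 1]) (simp add: vis_def)
qed

lemma LR_bmeas:
  assumes "t \<in> {1..T}" "x \<in> Xs G"
  shows "bmeas (F t) (LR t (dep G x))"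
proof -
  have h: "dep G x \<in> {1..H}" using dep_bounds assms by auto
  show ?thesis using LR_meas[OF assms(1) h] traj[OF assms(1) h] by (intro bmeasI[where B = 1]) auto
qed

section \<open>Conditional means of visits and losses\<close>

lemma subalg_interp: "finite_measure_subalgebra M (F t)"
  by unfold_locales (rule filt_sub)

lemma cond_visit:
  assumes t: "t \<in> {1..T}" and x: "x \<in> Xs G" "a \<in> act G x"
  shows "cond_rep M (F (t - 1)) (vis t x a) (\<lambda>\<omega>. P t \<omega> x * plan G \<mu>s x a)"
proof (rule finite_measure_subalgebra.cond_repI[OF subalg_interp])
  show "bmeas M (vis t x a)" using bmeas_subalgebra[OF vis_bmeas[OF t x(1)] filt_sub] .
  show "bmeas (F (t - 1)) (\<lambda>\<omega>. P t \<omega> x * plan G \<mu>s x a)" using P_bmeas[OF t x(1)] by auto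
  fix B assume B: "B \<in> sets (F (t - 1))"
  have BM: "B \<in> sets M" using B filt_sub by (auto simp: subalgebra_def)
  have h: "dep G x \<in> {1..H}" using dep_bounds x by auto
  let ?S = "{\<omega> \<in> space M. XR t (dep G x) \<omega> = x \<and> AR t (dep G x) \<omega> = a}"
  have "?S \<in> sets (F t)"
  proof -
    note [measurable] = XR_meas[OF t h] AR_meas[OF t h]
    have "{\<omega> \<in> space (F t). XR t (dep G x) \<omega> = x \<and> AR t (dep G x) \<omega> = a} \<in> sets (F t)" by measurable
    then show ?thesis by simp
  qed
  then have S: "?S \<in> sets M" using filt_sub by (auto simp: subalgebra_def)
  have "(\<integral>\<omega>. indicator B \<omega> * vis t x a \<omega> \<partial>M) = (\<integral>\<omega>. indicator (B \<inter> ?S) \<omega> \<partial>M)"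
    by (rule Bochner_Integration.integral_cong) (auto simp: vis_def indicator_def)
  also have "\<dots> = measure M (B \<inter> ?S)"
    using BM S by (simp add: Int_absorb2 sets.sets_into_space)
  finally show "(\<integral>\<omega>. indicator B \<omega> * vis t x a \<omega> \<partial>M) = (\<integral>\<omega>. indicator B \<omega> * (P t \<omega> x * plan G \<mu>s x a) \<partial>M)"
    using visit[OF t B x] by simp
qed

lemma cond_loss:
  assumes t: "t \<in> {1..T}" and x: "x \<in> Xs G" "a \<in> act G x"
  shows "cond_rep M (F (t - 1)) (\<lambda>\<omega>. LR t (dep G x) \<omega> * vis t x a \<omega>)
           (\<lambda>\<omega>. P t \<omega> x * plan G \<mu>s x a * Lh t \<omega> x a)"
proof (rule finite_measure_subalgebra.cond_repI[OF subalg_interp])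
  have "bmeas (F t) (\<lambda>\<omega>. LR t (dep G x) \<omega> * vis t x a \<omega>)"
    using vis_bmeas[OF t x(1)] LR_bmeas[OF t x(1)] by auto
  then show "bmeas M (\<lambda>\<omega>. LR t (dep G x) \<omega> * vis t x a \<omega>)" using bmeas_subalgebra filt_sub by blast
  show "bmeas (F (t - 1)) (\<lambda>\<omega>. P t \<omega> x * plan G \<mu>s x a * Lh t \<omega> x a)"
    by (intro bmeas_mult bmeas_const P_bmeas[OF t x(1)] Lh_bmeas[OF t x])
  fix B assume B: "B \<in> sets (F (t - 1))"
  have "vis t x a = indicator {\<omega>. XR t (dep G x) \<omega> = x \<and> AR t (dep G x) \<omega> = a}"
    by (auto simp: vis_def indicator_def)
  then show "(\<integral>\<omega>. indicator B \<omega> * (LR t (dep G x) \<omega> * vis t x a \<omega>) \<partial>M)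
     = (\<integral>\<omega>. indicator B \<omega> * (P t \<omega> x * plan G \<mu>s x a * Lh t \<omega> x a) \<partial>M)"
    using loss[OF t B x] by simp
qed

text \<open>Monotonicity of conditional expectation turns a pathwise bound on visit counts into an
  almost sure bound on the weights \<open>P\<close>.\<close>

lemma AE_visit_sum_le:
  assumes t: "t \<in> {1..T}" and S: "S \<subseteq> Xs G" and V: "cond_rep M (F (t - 1)) V g"
    and le: "\<And>\<omega>. \<omega> \<in> space M \<Longrightarrow> (\<Sum>x\<in>S. \<Sum>a\<in>act G x. vis t x a \<omega>) \<le> V \<omega>"
  shows "AE \<omega> in M. (\<Sum>x\<in>S. P t \<omega> x * reach G \<mu>s x) \<le> g \<omega>"
proof -
  interpret finite_measure_subalgebra M "F (t - 1)" by (rule subalg_interp)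
  have "cond_rep M (F (t - 1)) (\<lambda>\<omega>. \<Sum>x\<in>S. \<Sum>a\<in>act G x. vis t x a \<omega>)
      (\<lambda>\<omega>. \<Sum>x\<in>S. \<Sum>a\<in>act G x. P t \<omega> x * plan G \<mu>s x a)"
    using S by (intro cond_rep_sum cond_visit[OF t]) auto
  from cond_rep_mono[OF this V le]
  have "AE \<omega> in M. (\<Sum>x\<in>S. \<Sum>a\<in>act G x. P t \<omega> x * plan G \<mu>s x a) \<le> g \<omega>" by auto
  moreover have "(\<Sum>x\<in>S. \<Sum>a\<in>act G x. P t \<omega> x * plan G \<mu>s x a) = (\<Sum>x\<in>S. P t \<omega> x * reach G \<mu>s x)" for \<omega>
    using S by (intro sum.cong)
       (auto simp: plan_eq sum_distrib_left[symmetric] policy_sum[OF policy_mus])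
  ultimately show ?thesis by simp
qed

lemma visit_sum:
  assumes t: "t \<in> {1..T}" and w: "\<omega> \<in> space M" and x: "x \<in> Xs G"
  shows "(\<Sum>a\<in>act G x. vis t x a \<omega>) = of_bool (XR t (dep G x) \<omega> = x)"
proof (cases "XR t (dep G x) \<omega> = x")
  case True
  have "dep G x \<in> {1..H}" using dep_bounds x by auto
  from traj[OF t this w] have "AR t (dep G x) \<omega> \<in> act G x" using True by simp
  moreover have "(\<Sum>a\<in>act G x. vis t x a \<omega>) = (\<Sum>a\<in>act G x. if a = AR t (dep G x) \<omega> then 1 else 0)"
    by (intro sum.cong) (auto simp: vis_def True)
  ultimately show ?thesis using x True by simp
qed (simp add: vis_def)

text \<open>Conservation is derived from the law of the trajectories. At most one root is visited,
  and visiting a child of \<open>(y, b)\<close> entails visiting \<open>(y, b)\<close>; conditional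
  means preserve these inequalities, and the positive factor \<open>plan G \<mu>s y b\<close>
  cancels.\<close>

lemma AE_flow:
  assumes t: "t \<in> {1..T}"
  shows "AE \<omega> in M. flow (P t \<omega>)"
proof -
  interpret finite_measure_subalgebra M "F (t - 1)" by (rule subalg_interp)
  have single: "(\<Sum>x\<in>S. of_bool (z = x)) \<le> (of_bool (z \<in> S) :: real)" if "finite S" for S and z :: 'x
    using that by (simp add: of_bool_def)
  have root: "AE \<omega> in M. (\<Sum>x\<in>{x\<in>Xs G. par G x = None}. P t \<omega> x * reach G \<mu>s x) \<le> 1"
  proof (rule AE_visit_sum_le[OF t _ cond_rep_self[OF bmeas_const]])
    fix \<omega> assume w: "\<omega> \<in> space M"
    let ?S = "{x\<in>Xs G. par G x = None}"
    have "(\<Sum>x\<in>?S. \<Sum>a\<in>act G x. vis t x a \<omega>) = (\<Sum>x\<in>?S. of_bool (XR t 1 \<omega> = x))"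
      using par_None by (intro sum.cong) (auto simp: visit_sum[OF t w])
    also have "\<dots> \<le> of_bool (XR t 1 \<omega> \<in> ?S)" by (rule single) simp
    finally show "(\<Sum>x\<in>?S. \<Sum>a\<in>act G x. vis t x a \<omega>) \<le> 1"
      by (rule order_trans) simp
  qed auto
  have child: "AE \<omega> in M. (\<Sum>x\<in>{x\<in>Xs G. par G x = Some (y, b)}. P t \<omega> x * reach G \<mu>s x) \<le> P t \<omega> y * plan G \<mu>s y b"
    if y: "y \<in> Xs G" "b \<in> act G y" for y b
  proof (rule AE_visit_sum_le[OF t _ cond_visit[OF t y]])
    fix \<omega> assume w: "\<omega> \<in> space M"
    let ?S = "{x\<in>Xs G. par G x = Some (y, b)}"
    let ?h = "dep G y"
    have "(\<Sum>x\<in>?S. \<Sum>a\<in>act G x. vis t x a \<omega>) = (\<Sum>x\<in>?S. of_bool (XR t (Suc ?h) \<omega> = x))"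
      using par_Some by (intro sum.cong) (auto simp: visit_sum[OF t w])
    also have "\<dots> \<le> of_bool (XR t (Suc ?h) \<omega> \<in> ?S)" by (rule single) simp
    also have "\<dots> \<le> vis t y b \<omega>"
    proof (cases "XR t (Suc ?h) \<omega> \<in> ?S")
      case True
      then have p: "XR t (Suc ?h) \<omega> \<in> Xs G" "par G (XR t (Suc ?h) \<omega>) = Some (y, b)" by auto
      have "Suc ?h \<le> H" using par_Some(2)[OF p] dep_bounds[OF p(1)] by simp
      then have "par G (XR t (Suc ?h) \<omega>) = Some (XR t ?h \<omega>, AR t ?h \<omega>)"
        using dep_bounds[OF y(1)] by (intro traj_follow[OF t _ _ w]) auto
      then show ?thesis using p by (simp add: vis_def)
    next
      case False
      have "0 \<le> vis t y b \<omega>" by (simp add: vis_def)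
      with of_bool_eq_0_iff[THEN iffD2, OF False] show ?thesis by (rule ord_eq_le_trans)
    qed
    finally show "(\<Sum>x\<in>?S. \<Sum>a\<in>act G x. vis t x a \<omega>) \<le> vis t y b \<omega>" .
  qed auto
  have "AE \<omega> in M. \<forall>y\<in>Xs G. \<forall>b\<in>act G y.
      (\<Sum>x\<in>{x\<in>Xs G. par G x = Some (y, b)}. P t \<omega> x * reach G \<mu>s x) \<le> P t \<omega> y * plan G \<mu>s y b"
    using child by (intro AE_finite_allI) auto
  with root AE_space show ?thesis
  proof eventually_elim
    case (elim \<omega>)
    have 1: "(\<Sum>x\<in>{x\<in>Xs G. par G x = None}. P t \<omega> x) \<le> 1"
      using elim by (simp add: reach_root)
    have 2: "(\<Sum>x\<in>{x\<in>Xs G. par G x = Some (y, b)}. P t \<omega> x) \<le> P t \<omega> y" if y: "y \<in> Xs G" "b \<in> act G y" for y b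
    proof -
      have "(\<Sum>x\<in>{x\<in>Xs G. par G x = Some (y, b)}. P t \<omega> x) * plan G \<mu>s y b
          = (\<Sum>x\<in>{x\<in>Xs G. par G x = Some (y, b)}. P t \<omega> x * reach G \<mu>s x)"
        by (auto simp: reach_child sum_distrib_right intro!: sum.cong)
      also have "\<dots> \<le> P t \<omega> y * plan G \<mu>s y b" using elim y by auto
      finally show ?thesis using plan_pos[OF pos y] by simp
    qed
    show ?case using 1 2 P_range[OF t] elim by (auto simp: flow_def)
  qed
qed

subsection \<open>Deviation bounds and the regret\<close>

definition ratio :: "nat \<Rightarrow> 'w \<Rightarrow> 'x \<Rightarrow> 'a \<Rightarrow> real" where
  "ratio t \<omega> x a = plan G (pol t \<omega>) x a / plan G \<mu>s x a"

text \<open>The expected loss of the learner in round \<open>t\<close>, the first inner product in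
  the regret.\<close>

definition ell :: "nat \<Rightarrow> 'w \<Rightarrow> real" where
  "ell t \<omega> = (\<Sum>x\<in>Xs G. \<Sum>a\<in>act G x. P t \<omega> x * Lh t \<omega> x a * plan G (pol t \<omega>) x a)"

text \<open>The pathwise bounds rewritten as sums over all pairs with visit indicators, so that
  past-measurable coefficients can be pulled out of conditional means.\<close>

lemma qt_facts:
  assumes t: "t \<in> {1..T}" and w: "\<omega> \<in> space M"
  shows qt_nonneg: "0 \<le> qt t \<omega> 1"
    and qt_lower: "(\<Sum>x\<in>Xs G. \<Sum>a\<in>act G x. ratio t \<omega> x a * (LR t (dep G x) \<omega> * vis t x a \<omega>))
       - (\<Sum>x\<in>Xs G. \<Sum>a\<in>act G x. estimation_cost rate (pol t \<omega>) x a * vis t x a \<omega>) \<le> qt t \<omega> 1"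
    and qt_square: "(qt t \<omega> 1)\<^sup>2 \<le> (\<Sum>x\<in>Xs G. \<Sum>a\<in>act G x. real H * (ratio t \<omega> x a)\<^sup>2 * vis t x a \<omega>)"
    and qt_comparator: "is_policy G m \<Longrightarrow> qt t \<omega> 1 =
        (\<Sum>x\<in>Xs G. \<Sum>a\<in>act G x. plan G m x a / plan G \<mu>s x a * (LR t (dep G x) \<omega> * vis t x a \<omega>))
      + (\<Sum>x\<in>Xs G. reach G m x / reach G \<mu>s x * (1 / rate x *
           (breg (act G x) (m x) (pol t \<omega> x) - breg (act G x) (m x) (pol (Suc t) \<omega> x))))"
proof -
  interpret ep: episode G \<mu>s rate "pol t \<omega>" "\<lambda>h. XR t h \<omega>" "\<lambda>h. AR t h \<omega>" "\<lambda>h. LR t h \<omega>" t "uniform_policy G"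
    by (rule episode[OF t w])
  have q: "ep.q 1 = qt t \<omega> 1" by (simp add: ep.q_def qt_def)
  have nxt: "ep.next_mu = pol (Suc t) \<omega>" using t by (simp add: ep.next_mu_def pol_Suc)
  have L: "(\<Sum>i=1..H. ep.rat m i * LR t i \<omega>)
     = (\<Sum>x\<in>Xs G. \<Sum>a\<in>act G x. plan G m x a / plan G \<mu>s x a * (LR t (dep G x) \<omega> * vis t x a \<omega>))" for m
    using ep.sum_visited_actions[of "\<lambda>x a. plan G m x a / plan G \<mu>s x a * LR t (dep G x) \<omega>"] traj[OF t _ w]
    by (simp add: vis_def ep.rat_def mult.assoc)
  show "0 \<le> qt t \<omega> 1" using ep.q_nonneg[of 1] q by simp
  show "(\<Sum>x\<in>Xs G. \<Sum>a\<in>act G x. ratio t \<omega> x a * (LR t (dep G x) \<omega> * vis t x a \<omega>))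
       - (\<Sum>x\<in>Xs G. \<Sum>a\<in>act G x. estimation_cost rate (pol t \<omega>) x a * vis t x a \<omega>) \<le> qt t \<omega> 1"
    using ep.lower_bound L[of "pol t \<omega>"] q ep.sum_visited_actions[of ep.cost]
    by (simp add: vis_def ratio_def)
  show "(qt t \<omega> 1)\<^sup>2 \<le> (\<Sum>x\<in>Xs G. \<Sum>a\<in>act G x. real H * (ratio t \<omega> x a)\<^sup>2 * vis t x a \<omega>)"
    using ep.q_square q ep.sum_visited_actions[of "\<lambda>x a. real H * (ratio t \<omega> x a)\<^sup>2"]
    by (simp add: vis_def ratio_def ep.rat_def)
  show "qt t \<omega> 1 =
        (\<Sum>x\<in>Xs G. \<Sum>a\<in>act G x. plan G m x a / plan G \<mu>s x a * (LR t (dep G x) \<omega> * vis t x a \<omega>))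
      + (\<Sum>x\<in>Xs G. reach G m x / reach G \<mu>s x * (1 / rate x *
           (breg (act G x) (m x) (pol t \<omega> x) - breg (act G x) (m x) (pol (Suc t) \<omega> x))))"
    if m: "is_policy G m"
    using ep.comparator_bound[OF m] L[of m] q by (simp add: ep.drift_def nxt)
qed

lemma estimation_cost_bmeas:
  assumes "t \<in> {1..T}" "x \<in> Xs G"
  shows "bmeas (F (t - 1)) (\<lambda>\<omega>. estimation_cost rate (pol t \<omega>) x a)"
  unfolding estimation_cost_def
  by (intro bmeas_sum bmeas_mult bmeas_divide_const bmeas_const reach_bmeas plan_from_bmeas)
     (use assms in auto)

lemma ratio_bmeas:
  assumes "t \<in> {1..T}" "x \<in> Xs G"
  shows "bmeas (F (t - 1)) (\<lambda>\<omega>. ratio t \<omega> x a)"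
  unfolding ratio_def by (intro bmeas_divide_const plan_bmeas assms)

lemma ell_bmeas:
  assumes "t \<in> {1..T}"
  shows "bmeas (F (t - 1)) (ell t)"
  unfolding ell_def by (intro bmeas_sum bmeas_mult P_bmeas Lh_bmeas plan_bmeas assms)

lemma bmeas_Suc_F: "bmeas (F (t - 1)) f \<Longrightarrow> bmeas (F t) f"
  by (erule bmeas_mono) (use filt_mono[of "t - 1" t] in auto)

text \<open>The subtracted compensator dominates the logarithm of the conditional moment generating
  function of the sampled loss.\<close>

definition loss_dev :: "real \<Rightarrow> 'x \<Rightarrow> 'a \<Rightarrow> nat \<Rightarrow> 'w \<Rightarrow> real" where
  "loss_dev lam x a t \<omega> = lam * (LR t (dep G x) \<omega> * vis t x a \<omega>)
     - (lam * (P t \<omega> x * plan G \<mu>s x a * Lh t \<omega> x a) + lam\<^sup>2 * (P t \<omega> x * plan G \<mu>s x a))"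

text \<open>The exponent \<open>lam\<close> times the sampled loss lies in \<open>[0, 1]\<close>,
  the range where \<open>exp y \<le> 1 + y + y\<^sup>2\<close>; the squared loss is at most the
  visit indicator, whose conditional mean is known.\<close>

lemma loss_dev_tail:
  assumes x: "x \<in> Xs G" "a \<in> act G x" and lam: "0 \<le> lam" "lam \<le> 1"
  shows "{\<omega> \<in> space M. s \<le> (\<Sum>t=1..T. loss_dev lam x a t \<omega>)} \<in> sets M \<and>
     prob {\<omega> \<in> space M. s \<le> (\<Sum>t=1..T. loss_dev lam x a t \<omega>)} \<le> exp (- s)"
proof (rule exp_supermartingale_tail[OF filt_sub filt_mono])
  fix t assume t: "t \<in> {1..T}"
  let ?l = "\<lambda>\<omega>. LR t (dep G x) \<omega> * vis t x a \<omega>"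
  let ?c = "\<lambda>\<omega>. lam * (P t \<omega> x * plan G \<mu>s x a * Lh t \<omega> x a) + lam\<^sup>2 * (P t \<omega> x * plan G \<mu>s x a)"
  have c: "bmeas (F (t - 1)) ?c"
    by (intro bmeas_add bmeas_mult bmeas_const P_bmeas[OF t x(1)] Lh_bmeas[OF t x])
  have "bmeas (F t) ?l" by (intro bmeas_mult LR_bmeas[OF t x(1)] vis_bmeas[OF t x(1)])
  then show "bmeas (F t) (\<lambda>\<omega>. exp (loss_dev lam x a t \<omega>))"
    unfolding loss_dev_def by (intro bmeas_exp bmeas_diff bmeas_mult[OF bmeas_const] bmeas_Suc_F[OF c])
  interpret finite_measure_subalgebra M "F (t - 1)" by (rule subalg_interp)
  show "\<exists>V g. cond_rep M (F (t - 1)) V g \<and>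
        (\<forall>\<omega>\<in>space M. exp (loss_dev lam x a t \<omega>) \<le> V \<omega>) \<and> (AE \<omega> in M. g \<omega> \<le> 1)"
  proof (intro exI conjI)
    show "cond_rep M (F (t - 1))
        (\<lambda>\<omega>. exp (- ?c \<omega>) * (1 + (lam * ?l \<omega> + lam\<^sup>2 * vis t x a \<omega>)))
        (\<lambda>\<omega>. exp (- ?c \<omega>) * (1 + ?c \<omega>))"
      by (intro cond_rep_mult[OF bmeas_exp[OF bmeas_uminus[OF c]]] cond_rep_add cond_rep_self
           cond_rep_mult[OF bmeas_const] bmeas_const cond_loss[OF t x] cond_visit[OF t x])
    show "AE \<omega> in M. exp (- ?c \<omega>) * (1 + ?c \<omega>) \<le> 1"
    proof (rule AE_I2)
      fix \<omega>
      have "exp (- ?c \<omega>) * (1 + ?c \<omega>) \<le> exp (- ?c \<omega>) * exp (?c \<omega>)"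
        by (intro mult_left_mono exp_ge_add_one_self) auto
      then show "exp (- ?c \<omega>) * (1 + ?c \<omega>) \<le> 1" by (simp only: exp_minus_inverse mult.commute)
    qed
    show "\<forall>\<omega>\<in>space M. exp (loss_dev lam x a t \<omega>) \<le> exp (- ?c \<omega>) * (1 + (lam * ?l \<omega> + lam\<^sup>2 * vis t x a \<omega>))"
    proof
      fix \<omega> assume w: "\<omega> \<in> space M"
      have h: "dep G x \<in> {1..H}" using dep_bounds x by auto
      from traj[OF t h w] have L: "0 \<le> LR t (dep G x) \<omega>" "LR t (dep G x) \<omega> \<le> 1" by auto
      have v: "vis t x a \<omega> = 0 \<or> vis t x a \<omega> = 1" by (auto simp: vis_def)
      have l: "0 \<le> ?l \<omega>" "?l \<omega> \<le> 1" using L v by auto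
      have "(?l \<omega>)\<^sup>2 \<le> vis t x a \<omega>" using v L by (auto simp: power_le_one)
      then have "(lam * ?l \<omega>)\<^sup>2 \<le> lam\<^sup>2 * vis t x a \<omega>"
        unfolding power_mult_distrib by (intro mult_left_mono) auto
      moreover have "exp (lam * ?l \<omega>) \<le> 1 + lam * ?l \<omega> + (lam * ?l \<omega>)\<^sup>2"
        by (rule exp_bound[OF mult_nonneg_nonneg[OF lam(1) l(1)] mult_le_one[OF lam(2) l(1) l(2)]])
      ultimately have "exp (lam * ?l \<omega>) \<le> 1 + (lam * ?l \<omega> + lam\<^sup>2 * vis t x a \<omega>)" by simp
      then have "exp (- ?c \<omega>) * exp (lam * ?l \<omega>) \<le> exp (- ?c \<omega>) * (1 + (lam * ?l \<omega> + lam\<^sup>2 * vis t x a \<omega>))"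
        by (intro mult_left_mono) auto
      moreover have "exp (loss_dev lam x a t \<omega>) = exp (- ?c \<omega>) * exp (lam * ?l \<omega>)"
        unfolding loss_dev_def exp_add[symmetric] by (rule arg_cong[of _ _ exp]) simp
      ultimately show "exp (loss_dev lam x a t \<omega>) \<le> exp (- ?c \<omega>) * (1 + (lam * ?l \<omega> + lam\<^sup>2 * vis t x a \<omega>))"
        by simp
    qed
  qed
qed

text \<open>The compensator consists of the bounds of \<open>cost_flow\<close> and
  \<open>plan_square_flow\<close>.\<close>

definition value_dev :: "real \<Rightarrow> nat \<Rightarrow> 'w \<Rightarrow> real" where
  "value_dev lam t \<omega> = lam * (ell t \<omega> - qt t \<omega> 1)
     - (lam * (\<eta> * (real H)\<^sup>2 / 2) + lam\<^sup>2 / 2 * (real H * kappa G \<mu>s))"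

text \<open>In the quadratic bound on \<open>exp (- (lam * q))\<close>, \<open>qt_lower\<close> is
  inserted into the linear term and \<open>qt_square\<close> into the quadratic one. The majorant is
  then linear in visits and sampled losses, and its conditional mean is at most
  \<open>1 + c - lam * ell t \<omega>\<close>.\<close>

lemma value_dev_tail:
  assumes lam: "0 \<le> lam"
  shows "{\<omega> \<in> space M. s \<le> (\<Sum>t=1..T. value_dev lam t \<omega>)} \<in> sets M \<and>
     prob {\<omega> \<in> space M. s \<le> (\<Sum>t=1..T. value_dev lam t \<omega>)} \<le> exp (- s)"
proof (rule exp_supermartingale_tail[OF filt_sub filt_mono])
  fix t assume t: "t \<in> {1..T}"
  define c where "c = lam * (\<eta> * (real H)\<^sup>2 / 2) + lam\<^sup>2 / 2 * (real H * kappa G \<mu>s)"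
  let ?l = "\<lambda>x a \<omega>. LR t (dep G x) \<omega> * vis t x a \<omega>"
  let ?k = "\<lambda>x a \<omega>. estimation_cost rate (pol t \<omega>) x a"
  let ?z = "\<lambda>\<omega>. lam * ell t \<omega> - c"
  \<comment> \<open>\<open>?V\<close> and \<open>?g\<close> share their past-measurable
    coefficients; \<open>?g\<close> has the conditional means in place of sampled losses and
    visits.\<close>
  let ?V = "\<lambda>\<omega>. \<Sum>x\<in>Xs G. \<Sum>a\<in>act G x. (- lam * ratio t \<omega> x a) * ?l x a \<omega>
     + (lam * ?k x a \<omega> + lam\<^sup>2 / 2 * (real H * (ratio t \<omega> x a)\<^sup>2)) * vis t x a \<omega>"
  let ?g = "\<lambda>\<omega>. \<Sum>x\<in>Xs G. \<Sum>a\<in>act G x. (- lam * ratio t \<omega> x a) * (P t \<omega> x * plan G \<mu>s x a * Lh t \<omega> x a)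
     + (lam * ?k x a \<omega> + lam\<^sup>2 / 2 * (real H * (ratio t \<omega> x a)\<^sup>2)) * (P t \<omega> x * plan G \<mu>s x a)"
  have z: "bmeas (F (t - 1)) ?z" by (intro bmeas_diff bmeas_mult bmeas_const ell_bmeas[OF t])
  have eq: "exp (value_dev lam t \<omega>) = exp (?z \<omega>) * exp (- (lam * qt t \<omega> 1))" for \<omega>
    unfolding value_dev_def c_def exp_add[symmetric]
    by (rule arg_cong[of _ _ exp]) (simp add: algebra_simps)
  have "bmeas (F t) (\<lambda>\<omega>. exp (- (lam * qt t \<omega> 1)))"
    using qt1_measurable[OF t] qt_nonneg[OF t] lam by (intro bmeasI[where B = 1]) auto
  then show "bmeas (F t) (\<lambda>\<omega>. exp (value_dev lam t \<omega>))"
    unfolding eq by (rule bmeas_mult[OF bmeas_exp[OF bmeas_Suc_F[OF z]]])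
  interpret finite_measure_subalgebra M "F (t - 1)" by (rule subalg_interp)
  show "\<exists>V g. cond_rep M (F (t - 1)) V g \<and>
        (\<forall>\<omega>\<in>space M. exp (value_dev lam t \<omega>) \<le> V \<omega>) \<and> (AE \<omega> in M. g \<omega> \<le> 1)"
  proof (intro exI conjI)
    show "cond_rep M (F (t - 1)) (\<lambda>\<omega>. exp (?z \<omega>) * (1 + ?V \<omega>)) (\<lambda>\<omega>. exp (?z \<omega>) * (1 + ?g \<omega>))"
    proof (intro cond_rep_mult[OF bmeas_exp[OF z]] cond_rep_add[OF cond_rep_self[OF bmeas_const]]
        cond_rep_sum cond_rep_add)
      fix x a assume x: "x \<in> Xs G" "a \<in> act G x"
      show "cond_rep M (F (t - 1)) (\<lambda>\<omega>. (- lam * ratio t \<omega> x a) * ?l x a \<omega>)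
          (\<lambda>\<omega>. (- lam * ratio t \<omega> x a) * (P t \<omega> x * plan G \<mu>s x a * Lh t \<omega> x a))"
        by (intro cond_rep_mult cond_loss[OF t x] bmeas_mult bmeas_const ratio_bmeas[OF t x(1)])
      show "cond_rep M (F (t - 1))
          (\<lambda>\<omega>. (lam * ?k x a \<omega> + lam\<^sup>2 / 2 * (real H * (ratio t \<omega> x a)\<^sup>2)) * vis t x a \<omega>)
          (\<lambda>\<omega>. (lam * ?k x a \<omega> + lam\<^sup>2 / 2 * (real H * (ratio t \<omega> x a)\<^sup>2)) * (P t \<omega> x * plan G \<mu>s x a))"
        by (intro cond_rep_mult cond_visit[OF t x] bmeas_add bmeas_mult bmeas_power bmeas_const
            ratio_bmeas[OF t x(1)] estimation_cost_bmeas[OF t x(1)])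
    qed
    show "AE \<omega> in M. exp (?z \<omega>) * (1 + ?g \<omega>) \<le> 1"
      using AE_flow[OF t] AE_space
    proof eventually_elim
      case (elim \<omega>)
      interpret ep: episode G \<mu>s rate "pol t \<omega>" "\<lambda>h. XR t h \<omega>" "\<lambda>h. AR t h \<omega>" "\<lambda>h. LR t h \<omega>" t "uniform_policy G"
        by (rule episode[OF t elim(2)])
      \<comment> \<open>The factor \<open>plan G \<mu>s x a\<close> cancels the denominator of
        \<open>ratio\<close>; this isolates \<open>ell\<close> and the two sums bounded by
        \<open>cost_flow\<close> and \<open>plan_square_flow\<close>.\<close>
      have "?g \<omega> = (\<Sum>x\<in>Xs G. \<Sum>a\<in>act G x. - lam * (P t \<omega> x * Lh t \<omega> x a * plan G (pol t \<omega>) x a)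
         + (lam * (P t \<omega> x * plan G \<mu>s x a * ?k x a \<omega>)
         + lam\<^sup>2 / 2 * (P t \<omega> x * plan G \<mu>s x a * (real H * (plan G (pol t \<omega>) x a / plan G \<mu>s x a)\<^sup>2))))"
      proof (intro sum.cong refl)
        fix x a assume x: "x \<in> Xs G" "a \<in> act G x"
        have *: "ratio t \<omega> x a * plan G \<mu>s x a = plan G (pol t \<omega>) x a"
          using plan_pos[OF pos x] by (simp add: ratio_def)
        show "(- lam * ratio t \<omega> x a) * (P t \<omega> x * plan G \<mu>s x a * Lh t \<omega> x a)
          + (lam * ?k x a \<omega> + lam\<^sup>2 / 2 * (real H * (ratio t \<omega> x a)\<^sup>2)) * (P t \<omega> x * plan G \<mu>s x a)
          = - lam * (P t \<omega> x * Lh t \<omega> x a * plan G (pol t \<omega>) x a)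
         + (lam * (P t \<omega> x * plan G \<mu>s x a * ?k x a \<omega>)
         + lam\<^sup>2 / 2 * (P t \<omega> x * plan G \<mu>s x a * (real H * (plan G (pol t \<omega>) x a / plan G \<mu>s x a)\<^sup>2)))"
          unfolding ratio_def[symmetric] unfolding *[symmetric] by (simp add: algebra_simps)
      qed
      also have "\<dots> = - lam * ell t \<omega>
         + (lam * (\<Sum>x\<in>Xs G. \<Sum>a\<in>act G x. P t \<omega> x * plan G \<mu>s x a * ?k x a \<omega>)
         + lam\<^sup>2 / 2 * (\<Sum>x\<in>Xs G. \<Sum>a\<in>act G x. P t \<omega> x * plan G \<mu>s x a * (real H * (plan G (pol t \<omega>) x a / plan G \<mu>s x a)\<^sup>2)))"
        unfolding ell_def sum_distrib_left sum.distrib by simp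
      also have "\<dots> \<le> - lam * ell t \<omega> + c"
        unfolding c_def
        using ep.cost_flow[OF elim(1) rate_def] eta_pos lam
          ep.plan_square_flow[OF elim(1)] P_range[OF t elim(2)]
        by (intro add_mono mult_left_mono order_refl) auto
      finally have "1 + ?g \<omega> \<le> 1 + - ?z \<omega>" by simp
      also have "\<dots> \<le> exp (- ?z \<omega>)" by (rule exp_ge_add_one_self)
      finally have "exp (?z \<omega>) * (1 + ?g \<omega>) \<le> exp (?z \<omega>) * exp (- ?z \<omega>)"
        by (intro mult_left_mono) auto
      then show ?case by (simp only: exp_minus_inverse)
    qed
    show "\<forall>\<omega>\<in>space M. exp (value_dev lam t \<omega>) \<le> exp (?z \<omega>) * (1 + ?V \<omega>)"
    proof
      fix \<omega> assume w: "\<omega> \<in> space M"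
      let ?q = "qt t \<omega> 1"
      have "exp (- (lam * ?q)) \<le> 1 - lam * ?q + (lam * ?q)\<^sup>2 / 2"
        using qt_nonneg[OF t w] lam by (intro exp_minus_le_quadratic) auto
      also have "\<dots> = 1 + (lam * (- ?q) + lam\<^sup>2 / 2 * ?q\<^sup>2)" by (simp add: power_mult_distrib)
      also have "\<dots> \<le> 1 + (lam * ((\<Sum>x\<in>Xs G. \<Sum>a\<in>act G x. ?k x a \<omega> * vis t x a \<omega>)
             - (\<Sum>x\<in>Xs G. \<Sum>a\<in>act G x. ratio t \<omega> x a * ?l x a \<omega>))
           + lam\<^sup>2 / 2 * (\<Sum>x\<in>Xs G. \<Sum>a\<in>act G x. real H * (ratio t \<omega> x a)\<^sup>2 * vis t x a \<omega>))"
        using qt_lower[OF t w] qt_square[OF t w] lam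
        by (intro add_left_mono add_mono mult_left_mono) auto
      also have "\<dots> = 1 + ?V \<omega>"
        unfolding right_diff_distrib sum_distrib_left sum_subtractf[symmetric] sum.distrib[symmetric]
        by (intro arg_cong[of _ _ "(+) 1"] sum.cong refl) (simp add: algebra_simps)
      finally have "exp (?z \<omega>) * exp (- (lam * ?q)) \<le> exp (?z \<omega>) * (1 + ?V \<omega>)"
        by (intro mult_left_mono) auto
      then show "exp (value_dev lam t \<omega>) \<le> exp (?z \<omega>) * (1 + ?V \<omega>)" unfolding eq .
    qed
  qed
qed

section \<open>Summation over rounds\<close>

lemma ell_le:
  assumes t: "t \<in> {1..T}" and w: "\<omega> \<in> space M" and "flow (P t \<omega>)"
  shows "ell t \<omega> \<le> real H"
proof -
  have "ell t \<omega> \<le> (\<Sum>x\<in>Xs G. \<Sum>a\<in>act G x. P t \<omega> x * plan G (pol t \<omega>) x a)"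
    unfolding ell_def
    using P_range[OF t w] Lh_range[OF t w] plan_bounds[OF pol_policy[OF t w]]
    by (intro sum_mono mult_right_mono mult_left_le) auto
  also have "\<dots> \<le> real H" using assms by (intro flow_plan_sum pol_policy) auto
  finally show ?thesis .
qed

definition comp_loss :: "('x \<Rightarrow> 'a \<Rightarrow> real) \<Rightarrow> nat \<Rightarrow> 'w \<Rightarrow> real" where
  "comp_loss m t \<omega> = (\<Sum>x\<in>Xs G. \<Sum>a\<in>act G x. P t \<omega> x * Lh t \<omega> x a * plan G m x a)"

lemma comp_loss_nonneg:
  assumes "t \<in> {1..T}" "\<omega> \<in> space M" "is_policy G m"
  shows "0 \<le> comp_loss m t \<omega>"
  unfolding comp_loss_def
  using P_range[OF assms(1,2)] Lh_range[OF assms(1,2)] plan_bounds[OF assms(3)]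
  by (intro sum_nonneg mult_nonneg_nonneg) auto

text \<open>The deviation is linear in the plan of \<open>m\<close> with nonnegative weights, so
  bounds for the finitely many pairs serve all policies at once. The terms \<open>s / lam\<close>
  add up to a multiple of \<open>kappa_fun m\<close>, the others to at most \<open>lam * H\<close>
  per round by \<open>flow_plan_sum\<close>.\<close>

lemma policy_dev_sum:
  assumes w: "\<omega> \<in> space M" and m: "is_policy G m"
    and fl: "\<And>t. t \<in> {1..T} \<Longrightarrow> flow (P t \<omega>)"
    and lam: "0 < lam" and s: "0 \<le> s"
    and dev: "\<And>x a. x \<in> Xs G \<Longrightarrow> a \<in> act G x \<Longrightarrow> (\<Sum>t=1..T. loss_dev lam x a t \<omega>) \<le> s"
  shows "(\<Sum>t=1..T. (\<Sum>x\<in>Xs G. \<Sum>a\<in>act G x. plan G m x a / plan G \<mu>s x a * (LR t (dep G x) \<omega> * vis t x a \<omega>))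
      - comp_loss m t \<omega>) \<le> lam * (real H * real T) + s * kappa G \<mu>s / lam"
proof -
  let ?l = "\<lambda>t x a. LR t (dep G x) \<omega> * vis t x a \<omega>"
  let ?e = "\<lambda>t x a. P t \<omega> x * plan G \<mu>s x a * Lh t \<omega> x a"
  have "(\<Sum>t=1..T. (\<Sum>x\<in>Xs G. \<Sum>a\<in>act G x. plan G m x a / plan G \<mu>s x a * ?l t x a) - comp_loss m t \<omega>)
     = (\<Sum>t=1..T. \<Sum>x\<in>Xs G. \<Sum>a\<in>act G x. plan G m x a / plan G \<mu>s x a * (?l t x a - ?e t x a))"
  proof (intro sum.cong refl)
    fix t
    have "comp_loss m t \<omega> = (\<Sum>x\<in>Xs G. \<Sum>a\<in>act G x. plan G m x a / plan G \<mu>s x a * ?e t x a)"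
      unfolding comp_loss_def
    proof (intro sum.cong refl)
      fix x a assume "x \<in> Xs G" "a \<in> act G x"
      from plan_pos[OF pos this]
      show "P t \<omega> x * Lh t \<omega> x a * plan G m x a = plan G m x a / plan G \<mu>s x a * ?e t x a" by simp
    qed
    then show "(\<Sum>x\<in>Xs G. \<Sum>a\<in>act G x. plan G m x a / plan G \<mu>s x a * ?l t x a) - comp_loss m t \<omega>
       = (\<Sum>x\<in>Xs G. \<Sum>a\<in>act G x. plan G m x a / plan G \<mu>s x a * (?l t x a - ?e t x a))"
      by (simp add: right_diff_distrib sum_subtractf)
  qed
  also have "\<dots> = (\<Sum>x\<in>Xs G. \<Sum>a\<in>act G x. plan G m x a / plan G \<mu>s x a * (\<Sum>t=1..T. ?l t x a - ?e t x a))"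
    unfolding sum_distrib_left
    by (subst sum.swap, rule sum.cong[OF refl], rule sum.swap)
  also have "\<dots> \<le> (\<Sum>x\<in>Xs G. \<Sum>a\<in>act G x. plan G m x a / plan G \<mu>s x a *
       (lam * plan G \<mu>s x a * (\<Sum>t=1..T. P t \<omega> x) + s / lam))"
  proof (intro sum_mono mult_left_mono)
    fix x a assume x: "x \<in> Xs G" "a \<in> act G x"
    have "lam * (\<Sum>t=1..T. ?l t x a - ?e t x a) - lam\<^sup>2 * (plan G \<mu>s x a * (\<Sum>t=1..T. P t \<omega> x)) \<le> s"
      using dev[OF x] unfolding loss_dev_def
      by (simp add: sum_subtractf sum.distrib sum_distrib_left right_diff_distrib mult_ac)
    then have "lam * (\<Sum>t=1..T. ?l t x a - ?e t x a) \<le> lam * (lam * plan G \<mu>s x a * (\<Sum>t=1..T. P t \<omega> x) + s / lam)"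
      using lam by (simp add: distrib_left power2_eq_square mult_ac)
    then show "(\<Sum>t=1..T. ?l t x a - ?e t x a) \<le> lam * plan G \<mu>s x a * (\<Sum>t=1..T. P t \<omega> x) + s / lam"
      using lam by simp
    show "0 \<le> plan G m x a / plan G \<mu>s x a"
      using plan_bounds[OF m x(1)] plan_pos[OF pos x] by auto
  qed
  also have "\<dots> = lam * (\<Sum>t=1..T. \<Sum>x\<in>Xs G. \<Sum>a\<in>act G x. P t \<omega> x * plan G m x a)
      + s / lam * kappa_fun m"
  proof -
    have "(\<Sum>t=1..T. \<Sum>x\<in>Xs G. \<Sum>a\<in>act G x. P t \<omega> x * plan G m x a)
       = (\<Sum>x\<in>Xs G. \<Sum>a\<in>act G x. \<Sum>t=1..T. P t \<omega> x * plan G m x a)"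
      by (subst sum.swap, rule sum.cong[OF refl], rule sum.swap)
    then show ?thesis
      unfolding kappa_fun_def
      by (simp only: sum_distrib_left sum.distrib[symmetric], intro sum.cong refl)
         (use plan_pos[OF pos] in \<open>force simp: distrib_left sum_distrib_left sum_distrib_right mult_ac\<close>)
  qed
  also have "\<dots> \<le> lam * (\<Sum>t=1..T. real H) + s / lam * kappa G \<mu>s"
    using lam s kappa_fun_le[OF m] flow_plan_sum[OF fl m]
    by (intro add_mono mult_left_mono sum_mono) auto
  finally show ?thesis by (simp add: mult.commute)
qed

text \<open>After exchanging sums only the divergences at rounds 1 and \<open>Suc T\<close> remain.
  The first is to the uniform policy, the last is dropped as nonnegative, and
  \<open>kappa_at_sum\<close> adds up the inverse rates.\<close>

lemma comparator_sum:
  assumes w: "\<omega> \<in> space M" and m: "is_policy G m"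
  shows "(\<Sum>t=1..T. qt t \<omega> 1 - (\<Sum>x\<in>Xs G. \<Sum>a\<in>act G x. plan G m x a / plan G \<mu>s x a * (LR t (dep G x) \<omega> * vis t x a \<omega>)))
     \<le> ln (real (Amax G)) * (real H * kappa G \<mu>s) / \<eta>"
proof -
  let ?B = "\<lambda>t x. breg (act G x) (m x) (pol t \<omega> x)"
  let ?r = "\<lambda>x. reach G m x / reach G \<mu>s x"
  have r0: "0 \<le> ?r x" if "x \<in> Xs G" for x
    using reach_bounds[OF m that] reach_pos[OF pos that] by auto
  have "(\<Sum>t=1..T. qt t \<omega> 1 - (\<Sum>x\<in>Xs G. \<Sum>a\<in>act G x. plan G m x a / plan G \<mu>s x a * (LR t (dep G x) \<omega> * vis t x a \<omega>)))
    = (\<Sum>t=1..T. \<Sum>x\<in>Xs G. ?r x * (1 / rate x * (?B t x - ?B (Suc t) x)))"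
    by (intro sum.cong refl) (subst qt_comparator[OF _ w m], assumption, simp only: add_diff_cancel_left')
  also have "\<dots> = (\<Sum>x\<in>Xs G. \<Sum>t=1..T. ?r x * (1 / rate x * (?B t x - ?B (Suc t) x)))"
    by (rule sum.swap)
  also have "\<dots> = (\<Sum>x\<in>Xs G. ?r x * (1 / rate x * (?B 1 x - ?B (Suc T) x)))"
  proof (intro sum.cong refl)
    fix x
    have "(\<Sum>t=1..T. ?B t x - ?B (Suc t) x) = ?B 1 x - ?B (Suc T) x"
      by (induction T) auto
    then show "(\<Sum>t=1..T. ?r x * (1 / rate x * (?B t x - ?B (Suc t) x))) = ?r x * (1 / rate x * (?B 1 x - ?B (Suc T) x))"
      by (simp only: sum_distrib_left[symmetric])
  qed
  also have "\<dots> \<le> (\<Sum>x\<in>Xs G. ?r x * (1 / rate x * ln (real (Amax G))))"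
  proof (intro sum_mono mult_left_mono)
    fix x assume x: "x \<in> Xs G"
    have c: "0 < card (act G x)" using x act_nonempty by (simp add: card_gt_0_iff)
    note mp = policy_nonneg[OF m x] policy_sum[OF m x]
    have "?B 1 x = breg (act G x) (m x) (\<lambda>a. if a \<in> act G x then 1 / real (card (act G x)) else 0)"
      by (rule arg_cong[of _ _ "breg (act G x) (m x)"]) (simp add: pol_1 uniform_policy_def fun_eq_iff)
    also have "\<dots> \<le> ln (real (card (act G x)))"
      using x act_nonempty mp by (intro breg_uniform_le) auto
    also have "\<dots> \<le> ln (real (Amax G))"
    proof (rule ln_mono)
      show "real (card (act G x)) \<le> real (Amax G)"
        unfolding Amax_def of_nat_le_iff using x by (intro Max_ge) auto
    qed (use c in simp)
    finally have 1: "?B 1 x \<le> ln (real (Amax G))" .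
    have pp: "positive_policy G (pol (Suc T) \<omega>)" using w by (intro pol_positive) auto
    have "0 \<le> ?B (Suc T) x"
      using x mp policy_sum[OF positive_policyD(1)[OF pp] x] positive_policyD(2)[OF pp x]
      by (intro breg_nonneg) auto
    then show "?B 1 x - ?B (Suc T) x \<le> ln (real (Amax G))" using 1 by simp
    show "0 \<le> 1 / rate x" using rate_pos[OF x] by simp
    show "0 \<le> ?r x" by (rule r0[OF x])
  qed
  also have "\<dots> = ln (real (Amax G)) / \<eta> * (\<Sum>x\<in>Xs G. ?r x * kappa_at G \<mu>s x)"
    unfolding sum_distrib_left rate_def by (intro sum.cong refl) (simp add: mult_ac)
  also have "\<dots> \<le> ln (real (Amax G)) / \<eta> * (real H * kappa G \<mu>s)"
  proof (intro mult_left_mono kappa_at_sum[OF m])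
    \<comment> \<open>The value \<open>Amax G = 0\<close> is harmless because
      \<open>ln 0 = 0\<close>.\<close>
    show "0 \<le> ln (real (Amax G)) / \<eta>" using eta_pos by (cases "Amax G = 0") (auto intro!: divide_nonneg_pos)
  qed
  finally show ?thesis by simp
qed

text \<open>The three parts of the decomposition are added; dividing the bound on
  \<open>value_dev\<close> by \<open>lam2\<close> makes it a bound on the first part.\<close>

lemma regret_bound:
  assumes w: "\<omega> \<in> space M" and m: "is_policy G m"
    and fl: "\<And>t. t \<in> {1..T} \<Longrightarrow> flow (P t \<omega>)"
    and s: "0 \<le> s" and lam1: "0 < lam1" and lam2: "0 < lam2"
    and dev1: "\<And>x a. x \<in> Xs G \<Longrightarrow> a \<in> act G x \<Longrightarrow> (\<Sum>t=1..T. loss_dev lam1 x a t \<omega>) \<le> s"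
    and dev2: "(\<Sum>t=1..T. value_dev lam2 t \<omega>) \<le> s"
  shows "(\<Sum>t=1..T. ell t \<omega> - comp_loss m t \<omega>) \<le>
     ln (real (Amax G)) * (real H * kappa G \<mu>s) / \<eta> + real T * (\<eta> * (real H)\<^sup>2 / 2)
     + (lam1 * (real H * real T) + s * kappa G \<mu>s / lam1)
     + (real T * (lam2 / 2 * (real H * kappa G \<mu>s)) + s / lam2)"
proof -
  let ?e = "\<lambda>t. \<Sum>x\<in>Xs G. \<Sum>a\<in>act G x. plan G m x a / plan G \<mu>s x a * (LR t (dep G x) \<omega> * vis t x a \<omega>)"
  have "lam2 * (\<Sum>t=1..T. ell t \<omega> - qt t \<omega> 1) \<le> lam2 * (real T * (\<eta> * (real H)\<^sup>2 / 2)
       + real T * (lam2 / 2 * (real H * kappa G \<mu>s)) + s / lam2)"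
    using dev2 lam2 unfolding value_dev_def
    by (simp add: sum_subtractf sum_distrib_left[symmetric] distrib_left power2_eq_square mult_ac)
  then have 1: "(\<Sum>t=1..T. ell t \<omega> - qt t \<omega> 1) \<le> real T * (\<eta> * (real H)\<^sup>2 / 2)
       + real T * (lam2 / 2 * (real H * kappa G \<mu>s)) + s / lam2"
    using lam2 by (simp only: mult_le_cancel_left_pos)
  have "(\<Sum>t=1..T. ell t \<omega> - comp_loss m t \<omega>) = (\<Sum>t=1..T. ell t \<omega> - qt t \<omega> 1)
      + (\<Sum>t=1..T. qt t \<omega> 1 - ?e t) + (\<Sum>t=1..T. ?e t - comp_loss m t \<omega>)"
    by (simp add: sum_subtractf)
  then show ?thesis
    using 1 comparator_sum[OF w m] policy_dev_sum[OF w m fl lam1 s dev1] by linarith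
qed

end

lemma powr_three_halves: "0 < h \<Longrightarrow> (h\<^sup>2) powr (3/2) = (h ^ 3 :: real)"
proof -
  assume h: "0 < h"
  then have "h\<^sup>2 = h powr 2" by simp
  then have "(h\<^sup>2) powr (3/2) = h powr 3" by (simp only: powr_powr) simp
  then show ?thesis using h by simp
qed

text \<open>Here \<open>A\<close>, \<open>i\<close> and \<open>k\<close> stand for
  \<open>ln (Amax G)\<close>, \<iota> and \<kappa>. In terms of square roots all quantities are
  monomials, and every term is compared with \<open>h ^ 3 * (s * j * c * \<tau>)\<close>.\<close>

lemma tuned_bound:
  fixes H A i k T :: real
  assumes "1 \<le> H" "2 / 3 \<le> A" "1 \<le> i" "0 < k" "0 < T"
  defines "\<eta> \<equiv> sqrt (A * k / (3 * H * T))" and "lam1 \<equiv> sqrt (i * k / (H * T))"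
    and "lam2 \<equiv> sqrt (i / (H * k * T))"
  shows "A * (H * k) / \<eta> + T * (\<eta> * H\<^sup>2 / 2) + (lam1 * (H * T) + i * k / lam1)
       + (T * (lam2 / 2 * (H * k)) + i / lam2) \<le> (4 + 2 * sqrt 3) * H powr (3/2) * sqrt (A * i * k * T)"
    and "H * T \<le> i * k \<Longrightarrow> H * T \<le> (4 + 2 * sqrt 3) * H powr (3/2) * sqrt (A * i * k * T)"
proof -
  define h s j c \<tau> where "h = sqrt H" and "s = sqrt A" and "j = sqrt i" and "c = sqrt k" and "\<tau> = sqrt T"
  have sq: "H = h\<^sup>2" "A = s\<^sup>2" "i = j\<^sup>2" "k = c\<^sup>2" "T = \<tau>\<^sup>2"
    using assms by (simp_all add: h_def s_def j_def c_def \<tau>_def)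
  have h: "1 \<le> h" and j: "1 \<le> j" and c: "0 < c" and \<tau>: "0 < \<tau>"
    using assms by (auto simp: h_def j_def c_def \<tau>_def)
  \<comment> \<open>\<open>(4 / 5)\<^sup>2 = 16 / 25 \<le> 2 / 3\<close>; hence
    \<open>1 \<le> 5 / 4 * s\<close> supplies the factor \<open>s\<close> that the deviation terms
    lack.\<close>
  have s: "4 / 5 \<le> s" unfolding s_def using assms by (intro real_le_rsqrt) (simp add: power2_eq_square)
  define d where "d = sqrt (3 :: real)"
  have d2: "d * d = 3" and d0: "0 < d" by (simp_all add: d_def)
  have d: "17 / 10 \<le> d" unfolding d_def by (intro real_le_rsqrt) (simp add: power2_eq_square)
  have d': "1 / d = d / 3" using d2 d0 by (simp add: field_simps)
  have eta: "\<eta> = s * c / (d * h * \<tau>)" and lam1: "lam1 = j * c / (h * \<tau>)" and lam2: "lam2 = j / (h * c * \<tau>)"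
    using h s j c \<tau> by (simp_all add: \<eta>_def lam1_def lam2_def sq d_def real_sqrt_divide real_sqrt_mult)
  have rhs: "(4 + 2 * sqrt 3) * H powr (3/2) * sqrt (A * i * k * T) = (4 + 2 * d) * (h ^ 3 * (s * j * c * \<tau>))"
    using h s j c \<tau> by (simp add: sq d_def real_sqrt_mult powr_three_halves)
  have pos: "0 < h" "0 < s" "0 < j" using h s j by auto
  have hct: "0 < h * c * \<tau>" using pos c \<tau> by simp
  have h3: "h * c * \<tau> \<le> h ^ 3 * c * \<tau>"
  proof -
    have "h ^ 1 \<le> h ^ 3" using h by (intro power_increasing) auto
    then show ?thesis using c \<tau> by (intro mult_right_mono) auto
  qed
  have base: "h * c * \<tau> * j \<le> 5 / 4 * (h ^ 3 * (s * j * c * \<tau>))"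
  proof -
    have "h * c * \<tau> * j \<le> h ^ 3 * c * \<tau> * j * (5 / 4 * s)"
      using mult_mono[of "h * c * \<tau> * j" "h ^ 3 * c * \<tau> * j" 1 "5 / 4 * s"] h3 s pos c \<tau>
      by (simp add: mult_right_mono)
    then show ?thesis by (simp add: mult_ac)
  qed
  have base2: "h ^ 3 * (s * c * \<tau>) \<le> h ^ 3 * (s * j * c * \<tau>)"
    using mult_left_mono[of 1 j "h ^ 3 * (s * c * \<tau>)"] j pos c \<tau> by (simp add: mult_ac)
  have B0: "0 \<le> h ^ 3 * (s * j * c * \<tau>)" using pos c \<tau> by simp
  have t1: "A * (H * k) / \<eta> = d * (h ^ 3 * (s * c * \<tau>))"
    using pos c \<tau> d0 by (simp add: eta sq field_simps power2_eq_square power3_eq_cube)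
  have t2: "T * (\<eta> * H\<^sup>2 / 2) = d / 6 * (h ^ 3 * (s * c * \<tau>))"
  proof -
    have "T * (\<eta> * H\<^sup>2 / 2) = 1 / d * (h ^ 3 * (s * c * \<tau>)) / 2"
      using pos c \<tau> d0 by (simp add: eta sq field_simps power2_eq_square power3_eq_cube)
    then show ?thesis unfolding d' by simp
  qed
  \<comment> \<open>\<open>lam1\<close> balances its two terms at \<open>h * c * \<tau> * j\<close>
    each; with \<open>lam2\<close> the terms are one half and one such monomial.\<close>
  have t3: "lam1 * (H * T) + i * k / lam1 = 2 * (h * c * \<tau> * j)"
    using pos c \<tau> by (simp add: lam1 sq field_simps power2_eq_square)
  have t4: "T * (lam2 / 2 * (H * k)) + i / lam2 = 3 / 2 * (h * c * \<tau> * j)"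
    using pos c \<tau> by (simp add: lam2 sq field_simps power2_eq_square)
  have "d * (h ^ 3 * (s * c * \<tau>)) + d / 6 * (h ^ 3 * (s * c * \<tau>)) + 2 * (h * c * \<tau> * j) + 3 / 2 * (h * c * \<tau> * j)
     \<le> (7 / 6 * d + 35 / 8) * (h ^ 3 * (s * j * c * \<tau>))"
    using base mult_left_mono[OF base2, of "7 / 6 * d"] d0 by (simp add: algebra_simps)
  \<comment> \<open>The deviation terms contribute \<open>(2 + 3 / 2) * 5 / 4 = 35 / 8\<close>; the
    excess \<open>3 / 8\<close> over 4 is covered by \<open>5 / 6 * d\<close>.\<close>
  also have "\<dots> \<le> (4 + 2 * d) * (h ^ 3 * (s * j * c * \<tau>))"
    using d B0 by (intro mult_right_mono) auto
  finally show "A * (H * k) / \<eta> + T * (\<eta> * H\<^sup>2 / 2) + (lam1 * (H * T) + i * k / lam1)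
       + (T * (lam2 / 2 * (H * k)) + i / lam2) \<le> (4 + 2 * sqrt 3) * H powr (3/2) * sqrt (A * i * k * T)"
    unfolding rhs t1 t2 t3 t4 by simp
  assume "H * T \<le> i * k"
  then have "(h * \<tau>)\<^sup>2 \<le> (j * c)\<^sup>2" by (simp add: sq power_mult_distrib)
  then have "h * \<tau> \<le> j * c" by (rule power2_le_imp_le) (use pos c in auto)
  then have "h * \<tau> * (h * \<tau>) \<le> h * \<tau> * (j * c)" using pos \<tau> by (intro mult_left_mono) auto
  then have "H * T \<le> h * c * \<tau> * j" by (simp add: sq power2_eq_square mult_ac)
  also have "\<dots> \<le> 5 / 4 * (h ^ 3 * (s * j * c * \<tau>))" by (rule base)
  also have "\<dots> \<le> (4 + 2 * d) * (h ^ 3 * (s * j * c * \<tau>))"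
    using d B0 by (intro mult_right_mono) auto
  finally show "H * T \<le> (4 + 2 * sqrt 3) * H powr (3/2) * sqrt (A * i * k * T)" unfolding rhs .
qed

section \<open>Union bound and conclusion\<close>

context learning
begin

lemma regret_le:
  assumes "\<And>m. is_policy G m \<Longrightarrow> (\<Sum>t=1..T. ell t \<omega> - comp_loss m t \<omega>) \<le> B"
  shows "regret G (\<lambda>t x a. P t \<omega> x * Lh t \<omega> x a) (\<lambda>t. pol t \<omega>) T \<le> B"
  unfolding regret_def
proof (rule cSup_least)
  show "{\<Sum>t\<in>{1..T}. inner G (\<lambda>x a. P t \<omega> x * Lh t \<omega> x a)
      (\<lambda>x a. plan G (pol t \<omega>) x a - plan G \<mu>d x a) | \<mu>d. is_policy G \<mu>d} \<noteq> {}"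
    using policy_mus by auto
  fix r assume "r \<in> {\<Sum>t\<in>{1..T}. inner G (\<lambda>x a. P t \<omega> x * Lh t \<omega> x a)
      (\<lambda>x a. plan G (pol t \<omega>) x a - plan G \<mu>d x a) | \<mu>d. is_policy G \<mu>d}"
  then obtain m where m: "is_policy G m"
    and r: "r = (\<Sum>t\<in>{1..T}. inner G (\<lambda>x a. P t \<omega> x * Lh t \<omega> x a) (\<lambda>x a. plan G (pol t \<omega>) x a - plan G m x a))"
    by auto
  have "r = (\<Sum>t=1..T. ell t \<omega> - comp_loss m t \<omega>)"
    unfolding r by (simp add: inner_def ell_def comp_loss_def right_diff_distrib sum_subtractf)
  then show "r \<le> B" using assms[OF m] by simp
qed

text \<open>Outside a null set where \<open>flow\<close> fails there are \<open>A_X G + 1\<close>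
  bad events, one per pair and one for the value deviation. Each has probability at most
  \<open>exp (- \<iota>)\<close>, in total \<open>\<delta> / 2\<close>.\<close>

theorem high_probability_regret:
  assumes T: "0 < T" and A2: "2 \<le> Amax G" and \<delta>: "0 < \<delta>" "\<delta> < 1"
    and \<eta>: "\<eta> = sqrt (ln (real (Amax G)) * kappa G \<mu>s / (3 * real H * real T))"
  shows "\<exists>E\<in>sets M. measure M E \<ge> 1 - \<delta> \<and> (\<forall>\<omega>\<in>E.
     regret G (\<lambda>t x a. P t \<omega> x * Lh t \<omega> x a) (\<lambda>t. pol t \<omega>) T
       \<le> (4 + 2 * sqrt 3) * real H powr (3/2) *
          sqrt (ln (real (Amax G)) * ln (2 * (real (A_X G) + 1) / \<delta>) * kappa G \<mu>s * real T))"
proof -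
  define \<iota> where "\<iota> = ln (2 * (real (A_X G) + 1) / \<delta>)"
  let ?A = "ln (real (Amax G))" and ?k = "kappa G \<mu>s"
  let ?B = "(4 + 2 * sqrt 3) * real H powr (3/2) * sqrt (?A * \<iota> * ?k * real T)"
  define lam1 where "lam1 = sqrt (\<iota> * ?k / (real H * real T))"
  define lam2 where "lam2 = sqrt (\<iota> / (real H * ?k * real T))"
  have "XR 1 1 \<omega> \<in> Xs G" if "\<omega> \<in> space M" for \<omega>
    using traj[of 1 1 \<omega>] T hor_pos that by simp
  then have Xne: "Xs G \<noteq> {}" using not_empty by auto
  have k: "0 < ?k" using kappa_pos[OF Xne] .
  have "2 \<le> real (Amax G)" using A2 by simp
  then have "ln 2 \<le> ?A" by (intro ln_mono) auto
  then have A: "2 / 3 \<le> ?A" using ln2_ge_two_thirds by simp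
  have "A_X G \<noteq> 0"
    unfolding A_X_def using Xne act_nonempty by (simp add: ex_in_conv[symmetric])
  then have AX: "1 \<le> real (A_X G)" by simp
  \<comment> \<open>This gives
    \<open>\<iota> \<ge> ln (2 * 2) = 2 * ln 2 \<ge> 4 / 3\<close>.\<close>
  have "2 * 2 \<le> 2 * (real (A_X G) + 1) / \<delta>"
    using AX \<delta> mult_mono[of \<delta> 1 4 "2 * (real (A_X G) + 1)"] by (simp add: field_simps)
  then have "ln (2 * 2) \<le> \<iota>" unfolding \<iota>_def by (intro ln_mono) auto
  then have \<iota>: "1 \<le> \<iota>" using ln2_ge_two_thirds by (simp only: ln_mult) simp
  have exp_\<iota>: "exp (- \<iota>) = \<delta> / (2 * (real (A_X G) + 1))"
    using \<delta> AX by (simp add: \<iota>_def exp_minus)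
  have HT: "1 \<le> real H" "0 < real T" using hor_pos T by auto
  note tuned = tuned_bound[OF HT(1) A \<iota> k HT(2)]
  have "AE \<omega> in M. \<forall>t\<in>{1..T}. flow (P t \<omega>)"
    using AE_flow by (intro AE_finite_allI) auto
  then obtain N where N: "N \<in> null_sets M" "\<And>\<omega>. \<omega> \<in> space M - N \<Longrightarrow> \<forall>t\<in>{1..T}. flow (P t \<omega>)"
    by (auto elim!: AE_E3)
  define Z where "Z = (SIGMA x:Xs G. act G x)"
  have Zf: "finite Z" unfolding Z_def by auto
  have Zc: "card Z = A_X G" unfolding Z_def A_X_def by (simp add: card_SigmaI)
  define D1 where "D1 xa = {\<omega> \<in> space M. \<iota> \<le> (\<Sum>t=1..T. loss_dev lam1 (fst xa) (snd xa) t \<omega>)}" for xa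
  define D2 where "D2 = {\<omega> \<in> space M. \<iota> \<le> (\<Sum>t=1..T. value_dev lam2 t \<omega>)}"
  show ?thesis
  proof (cases "\<iota> * ?k \<le> real H * real T")
    \<comment> \<open>The losses are at most \<open>H\<close> per round outside the null set
      \<open>N\<close>, so the second part of \<open>tuned_bound\<close> applies without any
      deviation event.\<close>
    case False
    show ?thesis
    proof (intro bexI conjI ballI)
      show "space M - N \<in> sets M" using N by auto
      have "prob (space M - N) = 1"
        using N by (subst prob_compl) (auto simp: measure_eq_0_null_sets)
      then show "1 - \<delta> \<le> prob (space M - N)" using \<delta> by simp
      fix \<omega> assume w: "\<omega> \<in> space M - N"
      show "regret G (\<lambda>t x a. P t \<omega> x * Lh t \<omega> x a) (\<lambda>t. pol t \<omega>) T
         \<le> (4 + 2 * sqrt 3) * real H powr (3/2) * sqrt (?A * ln (2 * (real (A_X G) + 1) / \<delta>) * ?k * real T)"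
        unfolding \<iota>_def[symmetric]
      proof (rule regret_le)
        fix m assume m: "is_policy G m"
        have "(\<Sum>t=1..T. ell t \<omega> - comp_loss m t \<omega>) \<le> (\<Sum>t=1..T. real H - 0)"
          using ell_le[of _ \<omega>] comp_loss_nonneg[of _ \<omega> m] w N m by (intro sum_mono diff_mono) auto
        also have "\<dots> = real H * real T" by simp
        also have "\<dots> \<le> ?B" using False by (intro tuned(2)) auto
        finally show "(\<Sum>t=1..T. ell t \<omega> - comp_loss m t \<omega>) \<le> ?B" .
      qed
    qed
  next
    case True
    \<comment> \<open>The case hypothesis is exactly what makes \<open>lam1 \<le> 1\<close>, as
      \<open>loss_dev_tail\<close> requires.\<close>
    have lam1: "0 < lam1" "lam1 \<le> 1" and lam2: "0 < lam2"
      using True \<iota> k HT by (auto simp: lam1_def lam2_def)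
    have D1: "D1 xa \<in> sets M \<and> prob (D1 xa) \<le> exp (- \<iota>)" if "xa \<in> Z" for xa
      unfolding D1_def using that lam1 by (intro loss_dev_tail) (auto simp: Z_def)
    have D2: "D2 \<in> sets M \<and> prob D2 \<le> exp (- \<iota>)"
      unfolding D2_def using lam2 by (intro value_dev_tail) auto
    define Bad where "Bad = N \<union> (D2 \<union> (\<Union>xa\<in>Z. D1 xa))"
    have U: "(\<Union>xa\<in>Z. D1 xa) \<in> sets M" using D1 Zf by auto
    have BadM: "Bad \<in> sets M" unfolding Bad_def using N D2 U by auto
    have "prob Bad \<le> prob N + (prob D2 + prob (\<Union>xa\<in>Z. D1 xa))"
      unfolding Bad_def using N D2 U
      by (intro order_trans[OF measure_Un_le] add_left_mono measure_Un_le) auto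
    also have "\<dots> \<le> 0 + (exp (- \<iota>) + (\<Sum>xa\<in>Z. exp (- \<iota>)))"
    proof (intro add_mono)
      show "prob N \<le> 0" using N by (simp add: measure_eq_0_null_sets)
      show "prob D2 \<le> exp (- \<iota>)" using D2 by simp
      have "prob (\<Union>xa\<in>Z. D1 xa) \<le> (\<Sum>xa\<in>Z. prob (D1 xa))"
        using D1 Zf by (intro measure_UNION_le) auto
      also have "\<dots> \<le> (\<Sum>xa\<in>Z. exp (- \<iota>))" using D1 by (intro sum_mono) auto
      finally show "prob (\<Union>xa\<in>Z. D1 xa) \<le> (\<Sum>xa\<in>Z. exp (- \<iota>))" .
    qed
    also have "\<dots> = (real (A_X G) + 1) * exp (- \<iota>)" by (simp add: Zc algebra_simps)
    also have "\<dots> = \<delta> / 2" unfolding exp_\<iota> using AX by (simp add: field_simps)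
    also have "\<dots> \<le> \<delta>" using \<delta> by simp
    finally have Bad: "prob Bad \<le> \<delta>" .
    show ?thesis
    proof (intro bexI conjI ballI)
      show "space M - Bad \<in> sets M" using BadM by auto
      show "1 - \<delta> \<le> prob (space M - Bad)" using Bad BadM by (subst prob_compl) auto
      fix \<omega> assume w: "\<omega> \<in> space M - Bad"
      then have wM: "\<omega> \<in> space M" by auto
      show "regret G (\<lambda>t x a. P t \<omega> x * Lh t \<omega> x a) (\<lambda>t. pol t \<omega>) T
         \<le> (4 + 2 * sqrt 3) * real H powr (3/2) * sqrt (?A * ln (2 * (real (A_X G) + 1) / \<delta>) * ?k * real T)"
        unfolding \<iota>_def[symmetric]
      proof (rule regret_le)
        fix m assume m: "is_policy G m"
        have "(\<Sum>t=1..T. ell t \<omega> - comp_loss m t \<omega>) \<le>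
           ?A * (real H * ?k) / \<eta> + real T * (\<eta> * (real H)\<^sup>2 / 2)
           + (lam1 * (real H * real T) + \<iota> * ?k / lam1)
           + (real T * (lam2 / 2 * (real H * ?k)) + \<iota> / lam2)"
        proof (rule regret_bound[OF wM m])
          show "flow (P t \<omega>)" if "t \<in> {1..T}" for t using N w that by (auto simp: Bad_def)
          show "(\<Sum>t=1..T. loss_dev lam1 x a t \<omega>) \<le> \<iota>" if "x \<in> Xs G" "a \<in> act G x" for x a
          proof -
            have "\<omega> \<notin> D1 (x, a)" using w that by (auto simp: Bad_def Z_def)
            then show ?thesis using wM by (simp add: D1_def)
          qed
          show "(\<Sum>t=1..T. value_dev lam2 t \<omega>) \<le> \<iota>"
            using w by (auto simp: Bad_def D2_def)
        qed (use \<iota> lam1 lam2 in auto)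
        also have "\<dots> \<le> ?B" using tuned(1) unfolding \<eta> lam1_def lam2_def .
        finally show "(\<Sum>t=1..T. ell t \<omega> - comp_loss m t \<omega>) \<le> ?B" .
      qed
    qed
  qed
qed

end

theorem theorem4:
  fixes G :: "('x, 'a) game"
    and M :: "'w measure" and F :: "nat \<Rightarrow> 'w measure"
    and \<mu>s :: "'x \<Rightarrow> 'a \<Rightarrow> real"
    and T :: nat and \<delta> :: real
    and XR :: "nat \<Rightarrow> nat \<Rightarrow> 'w \<Rightarrow> 'x" and AR :: "nat \<Rightarrow> nat \<Rightarrow> 'w \<Rightarrow> 'a"
    and LR :: "nat \<Rightarrow> nat \<Rightarrow> 'w \<Rightarrow> real"
    and P :: "nat \<Rightarrow> 'w \<Rightarrow> 'x \<Rightarrow> real" and Lh :: "nat \<Rightarrow> 'w \<Rightarrow> 'x \<Rightarrow> 'a \<Rightarrow> real"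
  assumes game: "valid_game G"
    and A2: "Amax G \<ge> 2"
    and pos: "positive_policy G \<mu>s"
    and prob: "prob_space M"
    and filt_sub: "\<And>t. subalgebra M (F t)"
    and filt_mono: "\<And>s t. s \<le> t \<Longrightarrow> sets (F s) \<subseteq> sets (F t)"
    \<comment> \<open>the adversary's quantities p^{nu^t}, l^{nu^t}_h are F^{t-1}-measurable, with values in [0,1]\<close>
    and P_meas: "\<And>t x. t \<in> {1..T} \<Longrightarrow> x \<in> Xs G \<Longrightarrow> (\<lambda>\<omega>. P t \<omega> x) \<in> borel_measurable (F (t - 1))"
    and Lh_meas: "\<And>t x a. t \<in> {1..T} \<Longrightarrow> x \<in> Xs G \<Longrightarrow> a \<in> act G x \<Longrightarrow>
                    (\<lambda>\<omega>. Lh t \<omega> x a) \<in> borel_measurable (F (t - 1))"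
    and P_range: "\<And>t \<omega> x. t \<in> {1..T} \<Longrightarrow> \<omega> \<in> space M \<Longrightarrow> x \<in> Xs G \<Longrightarrow> 0 \<le> P t \<omega> x \<and> P t \<omega> x \<le> 1"
    and Lh_range: "\<And>t \<omega> x a. t \<in> {1..T} \<Longrightarrow> \<omega> \<in> space M \<Longrightarrow> x \<in> Xs G \<Longrightarrow> a \<in> act G x \<Longrightarrow>
                    0 \<le> Lh t \<omega> x a \<and> Lh t \<omega> x a \<le> 1"
    \<comment> \<open>the round-t trajectory is F^t-measurable\<close>
    and XR_meas: "\<And>t h. t \<in> {1..T} \<Longrightarrow> h \<in> {1..hor G} \<Longrightarrow> XR t h \<in> measurable (F t) (count_space UNIV)"
    and AR_meas: "\<And>t h. t \<in> {1..T} \<Longrightarrow> h \<in> {1..hor G} \<Longrightarrow> AR t h \<in> measurable (F t) (count_space UNIV)"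
    and LR_meas: "\<And>t h. t \<in> {1..T} \<Longrightarrow> h \<in> {1..hor G} \<Longrightarrow> LR t h \<in> borel_measurable (F t)"
    \<comment> \<open>shape of an episode trajectory\<close>
    and traj: "\<And>t h \<omega>. t \<in> {1..T} \<Longrightarrow> h \<in> {1..hor G} \<Longrightarrow> \<omega> \<in> space M \<Longrightarrow>
                 XR t h \<omega> \<in> Xs G \<and> dep G (XR t h \<omega>) = h \<and> AR t h \<omega> \<in> act G (XR t h \<omega>)
                 \<and> 0 \<le> LR t h \<omega> \<and> LR t h \<omega> \<le> 1"
    and traj_follow: "\<And>t h \<omega>. t \<in> {1..T} \<Longrightarrow> 1 \<le> h \<Longrightarrow> h < hor G \<Longrightarrow> \<omega> \<in> space M \<Longrightarrow>
                 par G (XR t (Suc h) \<omega>) = Some (XR t h \<omega>, AR t h \<omega>)"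
    \<comment> \<open>a_h is drawn from mu^s(.|x_h) conditionally on F^{t-1} and the past of the episode\<close>
    and sampling: "\<And>t h B x a. t \<in> {1..T} \<Longrightarrow> h \<in> {1..hor G} \<Longrightarrow>
                 B \<in> sets (past_sigma M (F (t - 1)) (XR t) (AR t) (LR t) h) \<Longrightarrow>
                 x \<in> Xs G \<Longrightarrow> dep G x = h \<Longrightarrow> a \<in> act G x \<Longrightarrow>
                 measure M (B \<inter> {\<omega> \<in> space M. XR t h \<omega> = x \<and> AR t h \<omega> = a})
                   = (\<integral>\<omega>. indicator B \<omega> * indicator {\<omega>. XR t h \<omega> = x} \<omega> * \<mu>s x a \<partial>M)"
    \<comment> \<open>conditionally on F^{t-1}: P(x_h=x,a_h=a) = p(x) mu^s_{1:}(x,a)\<close>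
    and visit: "\<And>t B x a. t \<in> {1..T} \<Longrightarrow> B \<in> sets (F (t - 1)) \<Longrightarrow> x \<in> Xs G \<Longrightarrow> a \<in> act G x \<Longrightarrow>
                 measure M (B \<inter> {\<omega> \<in> space M. XR t (dep G x) \<omega> = x \<and> AR t (dep G x) \<omega> = a})
                   = (\<integral>\<omega>. indicator B \<omega> * (P t \<omega> x * plan G \<mu>s x a) \<partial>M)"
    \<comment> \<open>conditionally on F^{t-1}: E[l_h 1{x_h=x,a_h=a}] = p(x) mu^s_{1:}(x,a) l_h(x,a)\<close>
    and loss: "\<And>t B x a. t \<in> {1..T} \<Longrightarrow> B \<in> sets (F (t - 1)) \<Longrightarrow> x \<in> Xs G \<Longrightarrow> a \<in> act G x \<Longrightarrow>
                 (\<integral>\<omega>. indicator B \<omega> * (LR t (dep G x) \<omega> *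
                       indicator {\<omega>. XR t (dep G x) \<omega> = x \<and> AR t (dep G x) \<omega> = a} \<omega>) \<partial>M)
                   = (\<integral>\<omega>. indicator B \<omega> * (P t \<omega> x * plan G \<mu>s x a * Lh t \<omega> x a) \<partial>M)"
    and delta: "0 < \<delta>" "\<delta> < 1"
  shows "let A = real (Amax G); H = real (hor G); \<kappa> = kappa G \<mu>s;
             \<eta> = sqrt (ln A * \<kappa> / (3 * H * real T));
             eta = (\<lambda>(t::nat) x. \<eta> / kappa_at G \<mu>s x);
             \<iota> = ln (2 * (real (A_X G) + 1) / \<delta>);
             pols = (\<lambda>\<omega> t. localomd G \<mu>s eta (uniform_policy G)
                        (\<lambda>t h. XR t h \<omega>) (\<lambda>t h. AR t h \<omega>) (\<lambda>t h. LR t h \<omega>) t);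
             Ls = (\<lambda>\<omega> t x a. P t \<omega> x * Lh t \<omega> x a)
         in \<exists>E\<in>sets M. measure M E \<ge> 1 - \<delta> \<and>
              (\<forall>\<omega>\<in>E. regret G (Ls \<omega>) (pols \<omega>) T
                        \<le> (4 + 2 * sqrt 3) * H powr (3/2) * sqrt (ln A * \<iota> * \<kappa> * real T))"
proof -
  interpret prob_space M by (rule prob)
  interpret sg: sampled_game G \<mu>s by unfold_locales (rule game, rule pos)
  define \<eta> where "\<eta> = sqrt (ln (real (Amax G)) * kappa G \<mu>s / (3 * real (hor G) * real T))"
  show ?thesis
  \<comment> \<open>For \<open>T = 0\<close> division by zero makes \<eta> equal to 0, which
    \<open>learning\<close> excludes; the regret is then the supremum of the single value 0.\<close>
  proof (cases "T = 0")
    case True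
    have ne: "\<exists>\<mu>. is_policy G \<mu>" using sg.policy_mus by blast
    show ?thesis unfolding Let_def
      by (rule bexI[of _ "space M"]) (use True ne delta in \<open>auto simp: regret_def prob_space\<close>)
  next
    case False
    obtain \<omega> where "\<omega> \<in> space M" using not_empty by auto
    with traj[of 1 1 \<omega>] False sg.hor_pos have "Xs G \<noteq> {}" by auto
    then have "0 < kappa G \<mu>s" by (rule sg.kappa_pos)
    then have "0 < \<eta>" unfolding \<eta>_def using A2 False sg.hor_pos by simp
    interpret learning G \<mu>s M F T XR AR LR P Lh \<eta>
      by (unfold_locales; (fact | rule \<open>0 < \<eta>\<close>))
    have eta: "(\<lambda>(t::nat) x. \<eta> / kappa_at G \<mu>s x) = (\<lambda>t. rate)"
      by (simp add: fun_eq_iff rate_def)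
    show ?thesis
      using high_probability_regret[OF _ A2 delta \<eta>_def] False
      unfolding Let_def \<eta>_def[symmetric] eta pol_def by simp
  qed
qed

end
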